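(* Let $\Bbbk$ be a field of characteristic zero. Let $B$ be a Poisson domain that is integrally closed (in its fraction field). Let $A$ be a Poisson subalgebra of $B$ such that $B\subseteq Q(A)$ (the fraction field of $A$) and $\dim_\Bbbk B/A<\infty$. (1) If $B$ has the Dixmier property, then so does $A$. (2) Let $R$ be a Poisson domain such that $B\otimes R$ is an integrally closed domain. If $B$ is $R$-Dixmier, then so is $A$. (3) Let $n$ be a positive integer. If $B$ has the $n$-Dixmier property, then so does $A$. (4) Let $R$ be a Poisson algebra such that $B\otimes R$ is an integrally closed domain. If $B$ is augmented $R$-Dixmier, then $A$ is augmented $R$-Dixmier.
   Context: All algebras and tensor products are over $\Bbbk$; Poisson algebras are commutative as associative algebras, and tensor products carry the bracket $\{a\otimes b,a'\otimes b'\}=\{a,a'\}\otimes bb'+aa'\otimes\{b,b'\}$. A Poisson algebra $A$ is Dixmier if every injective Poisson algebra morphism $A\to A$ is bijective. For Poisson algebras $A,R$, $A$ is $R$-Dixmier if for every injective Poisson algebra morphism $f\colon A\to A\otimes R$ one has $\mathrm{im}(f)=A\otimes\Bbbk$. $A$ has the $n$-Dixmier property if $A$ is $\Bbbk[x_1,\dots,x_n]$-Dixmier, where the polynomial algebra has zero Poisson bracket. An augmentation of a Poisson algebra $R$ is a Poisson $\Bbbk$-algebra homomorphism $\pi\colon R\to\Bbbk$ (where $\Bbbk$ has zero bracket). $A$ is augmented $R$-Dixmier if, for any Poisson algebra morphism $\phi\colon A\to A\otimes R$ and any augmentation $\pi\colon R\to\Bbbk$ such that $A\xrightarrow{\phi}A\otimes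 R\xrightarrow{\mathrm{Id}_A\otimes\pi}A\otimes\Bbbk\cong A$ is the identity, one has $\mathrm{im}(\phi)=A\otimes\Bbbk$. *)

theory Defs
  imports
    "HOL-Algebra.QuotRing"
    "HOL-Algebra.Polynomials"
begin

section \<open>Poisson algebras\<close>

record ('k, 'a) palg = "('k, 'a) module" +
  pbracket :: "['a, 'a] \<Rightarrow> 'a" (\<open>\<lbrace>_,/ _\<rbrace>\<index>\<close>)

text \<open>A commutative associative unital algebra over a field with a Lie bracket (bilinear,
  alternating, Jacobi) that is a derivation in each argument. Linearity and the Leibniz rule are
  stated in the first argument only, as the bracket is alternating.\<close>

locale poisson_algebra = K?: field K + algebra K P
  for K :: "('k, 'x) ring_scheme" and P :: "('k, 'a, 'y) palg_scheme" (structure) +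
  assumes bracket_closed:
      "\<lbrakk>x \<in> carrier P; y \<in> carrier P\<rbrakk> \<Longrightarrow> \<lbrace>x, y\<rbrace> \<in> carrier P"
    and bracket_add:
      "\<lbrakk>x \<in> carrier P; y \<in> carrier P; z \<in> carrier P\<rbrakk> \<Longrightarrow> \<lbrace>x \<oplus> y, z\<rbrace> = \<lbrace>x, z\<rbrace> \<oplus> \<lbrace>y, z\<rbrace>"
    and bracket_smult:
      "\<lbrakk>c \<in> carrier K; x \<in> carrier P; y \<in> carrier P\<rbrakk> \<Longrightarrow> \<lbrace>c \<odot> x, y\<rbrace> = c \<odot> \<lbrace>x, y\<rbrace>"
    and bracket_self:
      "x \<in> carrier P \<Longrightarrow> \<lbrace>x, x\<rbrace> = \<zero>"
    and bracket_antisym: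
      "\<lbrakk>x \<in> carrier P; y \<in> carrier P\<rbrakk> \<Longrightarrow> \<lbrace>y, x\<rbrace> = \<ominus> \<lbrace>x, y\<rbrace>"
    and bracket_jacobi:
      "\<lbrakk>x \<in> carrier P; y \<in> carrier P; z \<in> carrier P\<rbrakk>
        \<Longrightarrow> \<lbrace>x, \<lbrace>y, z\<rbrace>\<rbrace> \<oplus> \<lbrace>y, \<lbrace>z, x\<rbrace>\<rbrace> \<oplus> \<lbrace>z, \<lbrace>x, y\<rbrace>\<rbrace> = \<zero>"
    and bracket_leibniz:
      "\<lbrakk>x \<in> carrier P; y \<in> carrier P; z \<in> carrier P\<rbrakk>
        \<Longrightarrow> \<lbrace>x \<otimes> y, z\<rbrace> = x \<otimes> \<lbrace>y, z\<rbrace> \<oplus> \<lbrace>x, z\<rbrace> \<otimes> y"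

locale poisson_domain = poisson_algebra K P + domain P
  for K :: "('k, 'x) ring_scheme" and P :: "('k, 'a, 'y) palg_scheme" (structure)

definition poisson_subalgebra ::
    "('k, 'x) ring_scheme \<Rightarrow> 'a set \<Rightarrow> ('k, 'a, 'y) palg_scheme \<Rightarrow> bool" where
  "poisson_subalgebra K H P \<longleftrightarrow>
     subring H P \<and> submodule H K P \<and> (\<forall>x\<in>H. \<forall>y\<in>H. \<lbrace>x, y\<rbrace>\<^bsub>P\<^esub> \<in> H)"

definition poisson_hom ::
    "('k, 'x) ring_scheme \<Rightarrow> ('k, 'a, 'y) palg_scheme \<Rightarrow> ('k, 'b, 'z) palg_scheme \<Rightarrow> ('a \<Rightarrow> 'b) set"
  where
  "poisson_hom K P Q = {f \<in> ring_hom P Q.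
     (\<forall>c\<in>carrier K. \<forall>x\<in>carrier P. f (c \<odot>\<^bsub>P\<^esub> x) = c \<odot>\<^bsub>Q\<^esub> f x) \<and>
     (\<forall>x\<in>carrier P. \<forall>y\<in>carrier P. f \<lbrace>x, y\<rbrace>\<^bsub>P\<^esub> = \<lbrace>f x, f y\<rbrace>\<^bsub>Q\<^esub>)}"

text \<open>The ground field as a Poisson algebra over itself, with zero bracket.\<close>

definition base_palg :: "('k, 'x) ring_scheme \<Rightarrow> ('k, 'k) palg" where
  "base_palg K = \<lparr>carrier = carrier K, mult = mult K, one = \<one>\<^bsub>K\<^esub>, zero = \<zero>\<^bsub>K\<^esub>, add = add K,
     smult = mult K, pbracket = (\<lambda>_ _. \<zero>\<^bsub>K\<^esub>)\<rparr>"

definition char_zero :: "('k, 'x) ring_scheme \<Rightarrow> bool" where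
  "char_zero K \<longleftrightarrow> (\<forall>m::nat. 0 < m \<longrightarrow> add_pow K m \<one>\<^bsub>K\<^esub> \<noteq> \<zero>\<^bsub>K\<^esub>)"


definition lin_span :: "('k, 'x) ring_scheme \<Rightarrow> ('k, 'a, 'y) module_scheme \<Rightarrow> 'a set \<Rightarrow> 'a set" where
  "lin_span K M S = \<Inter>{N. submodule N K M \<and> S \<subseteq> N}"

definition finite_dimensional :: "('k, 'x) ring_scheme \<Rightarrow> ('k, 'a, 'y) module_scheme \<Rightarrow> bool" where
  "finite_dimensional K M \<longleftrightarrow> (\<exists>S. finite S \<and> S \<subseteq> carrier M \<and> lin_span K M S = carrier M)"


section \<open>Free vector spaces and monoid algebras\<close>

text \<open>The free \<open>K\<close>-vector space on a set \<open>S\<close> consists of the finitely supported functions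
  \<open>S \<rightarrow> K\<close>, extended by zero outside \<open>S\<close>. A family \<open>\<beta>\<close> of functions, indexed by (pairs of) basis
  elements, is extended linearly (bilinearly).\<close>

definition fun_supp :: "('k, 'x) ring_scheme \<Rightarrow> ('s \<Rightarrow> 'k) \<Rightarrow> 's set" where
  "fun_supp K x = {s. x s \<noteq> \<zero>\<^bsub>K\<^esub>}"

definition free_carrier :: "('k, 'x) ring_scheme \<Rightarrow> 's set \<Rightarrow> ('s \<Rightarrow> 'k) set" where
  "free_carrier K S = {x. range x \<subseteq> carrier K \<and> finite (fun_supp K x) \<and> fun_supp K x \<subseteq> S}"

definition free_unit :: "('k, 'x) ring_scheme \<Rightarrow> 's \<Rightarrow> ('s \<Rightarrow> 'k)" where
  "free_unit K s = (\<lambda>t. if t = s then \<one>\<^bsub>K\<^esub> else \<zero>\<^bsub>K\<^esub>)"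

definition lin_ext ::
    "('k, 'x) ring_scheme \<Rightarrow> ('s \<Rightarrow> 't \<Rightarrow> 'k) \<Rightarrow> ('s \<Rightarrow> 'k) \<Rightarrow> ('t \<Rightarrow> 'k)" where
  "lin_ext K \<beta> x = (\<lambda>u. \<Oplus>\<^bsub>K\<^esub> s \<in> fun_supp K x. x s \<otimes>\<^bsub>K\<^esub> \<beta> s u)"

definition bilin_ext ::
    "('k, 'x) ring_scheme \<Rightarrow> ('s \<Rightarrow> 's \<Rightarrow> 't \<Rightarrow> 'k) \<Rightarrow> ('s \<Rightarrow> 'k) \<Rightarrow> ('s \<Rightarrow> 'k) \<Rightarrow> ('t \<Rightarrow> 'k)" where
  "bilin_ext K \<beta> x y =
     (\<lambda>u. \<Oplus>\<^bsub>K\<^esub> s \<in> fun_supp K x. \<Oplus>\<^bsub>K\<^esub> t \<in> fun_supp K y. x s \<otimes>\<^bsub>K\<^esub> y t \<otimes>\<^bsub>K\<^esub> \<beta> s t u)"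

definition monoid_algebra :: "('k, 'x) ring_scheme \<Rightarrow> ('s, 'y) monoid_scheme \<Rightarrow> ('k, 's \<Rightarrow> 'k) module"
  where
  "monoid_algebra K M = \<lparr>carrier = free_carrier K (carrier M),
     mult = bilin_ext K (\<lambda>s t. free_unit K (s \<otimes>\<^bsub>M\<^esub> t)), one = free_unit K \<one>\<^bsub>M\<^esub>,
     zero = (\<lambda>_. \<zero>\<^bsub>K\<^esub>), add = (\<lambda>x y s. x s \<oplus>\<^bsub>K\<^esub> y s), smult = (\<lambda>c x s. c \<otimes>\<^bsub>K\<^esub> x s)\<rparr>"

text \<open>The polynomial algebra \<open>K[x\<^sub>1,\<dots>,x\<^sub>n]\<close> with zero bracket. Monomials are multisets of
  variable indices.\<close>

definition monomials :: "nat \<Rightarrow> nat multiset monoid" where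
  "monomials n = \<lparr>carrier = {m. set_mset m \<subseteq> {1..n}}, mult = (+), one = {#}\<rparr>"

definition poly_palg :: "('k, 'x) ring_scheme \<Rightarrow> nat \<Rightarrow> ('k, nat multiset \<Rightarrow> 'k) palg" where
  "poly_palg K n = module.extend (monoid_algebra K (monomials n))
     (palg.fields (\<lambda>_ _. \<zero>\<^bsub>monoid_algebra K (monomials n)\<^esub>))"


section \<open>Quotients and tensor products\<close>

text \<open>When \<open>N\<close> is only a submodule and not an ideal, as for the quotient of an algebra by a
  subalgebra, the \<open>mult\<close> and \<open>one\<close> fields inherited from \<open>FactRing\<close> carry no meaning; the
  \<open>module\<close> locale does not refer to them.\<close>

definition quot_module :: "('k, 'a, 'y) module_scheme \<Rightarrow> 'a set \<Rightarrow> ('k, 'a set) module" where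
  "quot_module M N = ring.extend (M Quot N)
     (module.fields (\<lambda>c U. \<Union>x\<in>U. N +>\<^bsub>M\<^esub> (c \<odot>\<^bsub>M\<^esub> x)))"

text \<open>\<open>P \<otimes> Q\<close> is the free vector space on \<open>P \<times> Q\<close> modulo the span of the bilinearity relations.
  The product \<open>(a \<otimes> b)(a' \<otimes> b') = aa' \<otimes> bb'\<close> comes from the product of the multiplicative
  monoids of \<open>P\<close> and \<open>Q\<close>.\<close>

definition tensor_free ::
    "('k, 'x) ring_scheme \<Rightarrow> ('k, 'a, 'y) palg_scheme \<Rightarrow> ('k, 'b, 'z) palg_scheme
      \<Rightarrow> ('k, 'a \<times> 'b \<Rightarrow> 'k) module" where
  "tensor_free K P Q = monoid_algebra K (P \<times>\<times> Q)"

definition tensor_gens ::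
    "('k, 'x) ring_scheme \<Rightarrow> ('k, 'a, 'y) palg_scheme \<Rightarrow> ('k, 'b, 'z) palg_scheme
      \<Rightarrow> ('a \<times> 'b \<Rightarrow> 'k) set" where
  "tensor_gens K P Q = (let F = tensor_free K P Q; e = free_unit K in
     {e (a \<oplus>\<^bsub>P\<^esub> a', b) \<ominus>\<^bsub>F\<^esub> (e (a, b) \<oplus>\<^bsub>F\<^esub> e (a', b)) | a a' b.
        a \<in> carrier P \<and> a' \<in> carrier P \<and> b \<in> carrier Q} \<union>
     {e (a, b \<oplus>\<^bsub>Q\<^esub> b') \<ominus>\<^bsub>F\<^esub> (e (a, b) \<oplus>\<^bsub>F\<^esub> e (a, b')) | a b b'.
        a \<in> carrier P \<and> b \<in> carrier Q \<and> b' \<in> carrier Q} \<union>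
     {e (c \<odot>\<^bsub>P\<^esub> a, b) \<ominus>\<^bsub>F\<^esub> (c \<odot>\<^bsub>F\<^esub> e (a, b)) | c a b.
        c \<in> carrier K \<and> a \<in> carrier P \<and> b \<in> carrier Q} \<union>
     {e (a, c \<odot>\<^bsub>Q\<^esub> b) \<ominus>\<^bsub>F\<^esub> (c \<odot>\<^bsub>F\<^esub> e (a, b)) | c a b.
        c \<in> carrier K \<and> a \<in> carrier P \<and> b \<in> carrier Q})"

definition tensor_rels ::
    "('k, 'x) ring_scheme \<Rightarrow> ('k, 'a, 'y) palg_scheme \<Rightarrow> ('k, 'b, 'z) palg_scheme
      \<Rightarrow> ('a \<times> 'b \<Rightarrow> 'k) set" where
  "tensor_rels K P Q = lin_span K (tensor_free K P Q) (tensor_gens K P Q)"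

definition tensor_free_bracket ::
    "('k, 'x) ring_scheme \<Rightarrow> ('k, 'a, 'y) palg_scheme \<Rightarrow> ('k, 'b, 'z) palg_scheme
      \<Rightarrow> ('a \<times> 'b \<Rightarrow> 'k) \<Rightarrow> ('a \<times> 'b \<Rightarrow> 'k) \<Rightarrow> ('a \<times> 'b \<Rightarrow> 'k)" where
  "tensor_free_bracket K P Q = bilin_ext K (\<lambda>(a, b) (a', b').
     free_unit K (\<lbrace>a, a'\<rbrace>\<^bsub>P\<^esub>, b \<otimes>\<^bsub>Q\<^esub> b') \<oplus>\<^bsub>tensor_free K P Q\<^esub>
     free_unit K (a \<otimes>\<^bsub>P\<^esub> a', \<lbrace>b, b'\<rbrace>\<^bsub>Q\<^esub>))"

definition tensor ::
    "('k, 'x) ring_scheme \<Rightarrow> ('k, 'a, 'y) palg_scheme \<Rightarrow> ('k, 'b, 'z) palg_scheme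
      \<Rightarrow> ('k, ('a \<times> 'b \<Rightarrow> 'k) set) palg" where
  "tensor K P Q = module.extend (quot_module (tensor_free K P Q) (tensor_rels K P Q))
     (palg.fields (\<lambda>U V. \<Union>x\<in>U. \<Union>y\<in>V.
        tensor_rels K P Q +>\<^bsub>tensor_free K P Q\<^esub> tensor_free_bracket K P Q x y))"

definition pure_tensor ::
    "('k, 'x) ring_scheme \<Rightarrow> ('k, 'a, 'y) palg_scheme \<Rightarrow> ('k, 'b, 'z) palg_scheme
      \<Rightarrow> 'a \<Rightarrow> 'b \<Rightarrow> ('a \<times> 'b \<Rightarrow> 'k) set" where
  "pure_tensor K P Q a b = tensor_rels K P Q +>\<^bsub>tensor_free K P Q\<^esub> free_unit K (a, b)"

text \<open>The map \<open>f \<otimes> g : P \<otimes> Q \<rightarrow> P' \<otimes> Q'\<close> of linear maps \<open>f : P \<rightarrow> P'\<close> and \<open>g : Q \<rightarrow> Q'\<close>.\<close>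

definition tensor_map ::
    "('k, 'x) ring_scheme \<Rightarrow> ('k, 'a', 'y) palg_scheme \<Rightarrow> ('k, 'b', 'z) palg_scheme
      \<Rightarrow> ('a \<Rightarrow> 'a') \<Rightarrow> ('b \<Rightarrow> 'b') \<Rightarrow> ('a \<times> 'b \<Rightarrow> 'k) set \<Rightarrow> ('a' \<times> 'b' \<Rightarrow> 'k) set" where
  "tensor_map K P' Q' f g U = (\<Union>x\<in>U.
     tensor_rels K P' Q' +>\<^bsub>tensor_free K P' Q'\<^esub> lin_ext K (\<lambda>(a, b). free_unit K (f a, g b)) x)"

text \<open>The copy of \<open>P \<otimes> K\<close> in \<open>P \<otimes> Q\<close>. Since \<open>a \<otimes> c\<cdot>1 = (c\<cdot>a) \<otimes> 1\<close>, its elements are the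
  \<open>a \<otimes> 1\<close>.\<close>

definition tensor_base ::
    "('k, 'x) ring_scheme \<Rightarrow> ('k, 'a, 'y) palg_scheme \<Rightarrow> ('k, 'b, 'z) palg_scheme
      \<Rightarrow> ('a \<times> 'b \<Rightarrow> 'k) set set" where
  "tensor_base K P Q = {pure_tensor K P Q a \<one>\<^bsub>Q\<^esub> | a. a \<in> carrier P}"


section \<open>Fraction fields and integral closedness\<close>

definition frac_rel :: "('a, 'y) ring_scheme \<Rightarrow> (('a \<times> 'a) \<times> ('a \<times> 'a)) set" where
  "frac_rel D = {((a, b), (c, d)) | a b c d.
     a \<in> carrier D \<and> b \<in> carrier D - {\<zero>\<^bsub>D\<^esub>} \<and> c \<in> carrier D \<and> d \<in> carrier D - {\<zero>\<^bsub>D\<^esub>} \<and>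
     a \<otimes>\<^bsub>D\<^esub> d = c \<otimes>\<^bsub>D\<^esub> b}"

definition frac :: "('a, 'y) ring_scheme \<Rightarrow> 'a \<Rightarrow> 'a \<Rightarrow> ('a \<times> 'a) set" where
  "frac D a b = frac_rel D `` {(a, b)}"

definition frac_field :: "('a, 'y) ring_scheme \<Rightarrow> ('a \<times> 'a) set ring" where
  "frac_field D = \<lparr>carrier = (carrier D \<times> (carrier D - {\<zero>\<^bsub>D\<^esub>})) // frac_rel D,
     mult = (\<lambda>U V. \<Union>(a, b)\<in>U. \<Union>(c, d)\<in>V. frac D (a \<otimes>\<^bsub>D\<^esub> c) (b \<otimes>\<^bsub>D\<^esub> d)),
     one = frac D \<one>\<^bsub>D\<^esub> \<one>\<^bsub>D\<^esub>,
     zero = frac D \<zero>\<^bsub>D\<^esub> \<one>\<^bsub>D\<^esub>,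
     add = (\<lambda>U V. \<Union>(a, b)\<in>U. \<Union>(c, d)\<in>V.
       frac D (a \<otimes>\<^bsub>D\<^esub> d \<oplus>\<^bsub>D\<^esub> c \<otimes>\<^bsub>D\<^esub> b) (b \<otimes>\<^bsub>D\<^esub> d))\<rparr>"

definition frac_embed :: "('a, 'y) ring_scheme \<Rightarrow> 'a \<Rightarrow> ('a \<times> 'a) set" where
  "frac_embed D a = frac D a \<one>\<^bsub>D\<^esub>"

text \<open>For a subring \<open>H\<close> of \<open>D\<close>, the subfield \<open>Q(H)\<close> of the fraction field of \<open>D\<close>.\<close>

definition sub_fracs :: "('a, 'y) ring_scheme \<Rightarrow> 'a set \<Rightarrow> ('a \<times> 'a) set set" where
  "sub_fracs D H = {frac D a b | a b. a \<in> H \<and> b \<in> H \<and> b \<noteq> \<zero>\<^bsub>D\<^esub>}"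

definition integral_over :: "('a, 'y) ring_scheme \<Rightarrow> 'a set \<Rightarrow> 'a \<Rightarrow> bool" where
  "integral_over R S x \<longleftrightarrow>
     (\<exists>p. p \<noteq> [] \<and> set p \<subseteq> S \<and> lead_coeff p = \<one>\<^bsub>R\<^esub> \<and> ring.eval R p x = \<zero>\<^bsub>R\<^esub>)"

definition integrally_closed_domain :: "('a, 'y) ring_scheme \<Rightarrow> bool" where
  "integrally_closed_domain D \<longleftrightarrow> domain D \<and>
     (\<forall>x\<in>carrier (frac_field D).
        integral_over (frac_field D) (frac_embed D ` carrier D) x \<longrightarrow> x \<in> frac_embed D ` carrier D)"


section \<open>Dixmier properties\<close>

definition dixmier :: "('k, 'x) ring_scheme \<Rightarrow> ('k, 'a, 'y) palg_scheme \<Rightarrow> bool" where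
  "dixmier K P \<longleftrightarrow>
     (\<forall>f\<in>poisson_hom K P P. inj_on f (carrier P) \<longrightarrow> bij_betw f (carrier P) (carrier P))"

definition rel_dixmier ::
    "('k, 'x) ring_scheme \<Rightarrow> ('k, 'b, 'z) palg_scheme \<Rightarrow> ('k, 'a, 'y) palg_scheme \<Rightarrow> bool" where
  "rel_dixmier K R P \<longleftrightarrow>
     (\<forall>f\<in>poisson_hom K P (tensor K P R).
        inj_on f (carrier P) \<longrightarrow> f ` carrier P = tensor_base K P R)"

definition n_dixmier :: "('k, 'x) ring_scheme \<Rightarrow> nat \<Rightarrow> ('k, 'a, 'y) palg_scheme \<Rightarrow> bool" where
  "n_dixmier K n P \<longleftrightarrow> rel_dixmier K (poly_palg K n) P"

definition augmentations ::
    "('k, 'x) ring_scheme \<Rightarrow> ('k, 'b, 'z) palg_scheme \<Rightarrow> ('b \<Rightarrow> 'k) set" where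
  "augmentations K R = poisson_hom K R (base_palg K)"

text \<open>The canonical isomorphism \<open>P \<cong> P \<otimes> K\<close> sends \<open>a\<close> to \<open>a \<otimes> 1\<close>, so the composite
  \<open>P \<rightarrow> P \<otimes> R \<rightarrow> P \<otimes> K \<cong> P\<close> is the identity iff \<open>(id \<otimes> \<pi>) (\<phi> a) = a \<otimes> 1\<close> for all \<open>a\<close>.\<close>

definition aug_dixmier ::
    "('k, 'x) ring_scheme \<Rightarrow> ('k, 'b, 'z) palg_scheme \<Rightarrow> ('k, 'a, 'y) palg_scheme \<Rightarrow> bool" where
  "aug_dixmier K R P \<longleftrightarrow>
     (\<forall>\<phi>\<in>poisson_hom K P (tensor K P R). \<forall>\<pi>\<in>augmentations K R.
        (\<forall>a\<in>carrier P. tensor_map K P (base_palg K) id \<pi> (\<phi> a)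
           = pure_tensor K P (base_palg K) a \<one>\<^bsub>K\<^esub>) \<longrightarrow>
        \<phi> ` carrier P = tensor_base K P R)"

end

theory Submission
  imports Defs "HOL-Algebra.UnivPoly"
begin

text \<open>Modulo \<open>A\<close> the powers of \<open>b \<in> B\<close> are linearly dependent, so \<open>p(b) \<in> A\<close> for a monic \<open>p\<close> over
  \<open>K\<close>. Hence if \<open>f\<close> is an injective Poisson morphism from \<open>A\<close> to an integrally closed Poisson
  domain \<open>T\<close> and \<open>a b \<in> A\<close>, the fraction \<open>f(ab)/f(a)\<close> is integral over \<open>T\<close>, so it lies in \<open>T\<close>,
  and \<open>f\<close> extends uniquely to an injective Poisson morphism on \<open>B\<close>. In (1), \<open>T = B\<close>; otherwise
  \<open>T = B \<otimes> R\<close>. The hypothesis on \<open>B\<close> makes the extension an automorphism of \<open>B\<close> followed by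
  \<open>b \<mapsto> b \<otimes> 1\<close>. The automorphism maps \<open>A\<close> into \<open>A\<close> and is surjective on the finite-dimensional space
  \<open>B/A\<close>, hence injective there, so it maps \<open>A\<close> onto \<open>A\<close>.

  For (3) one needs that \<open>B[x\<^sub>1,\<dots>,x\<^sub>n]\<close> is integrally closed. In one variable over \<open>C \<supseteq> K\<close>, let \<open>s/t\<close>
  be integral over \<open>C[x]\<close>. The polynomials \<open>h\<close> with \<open>h (s/t)\<^sup>i \<in> C[x]\<close> for all \<open>i\<close> form a nonzero ideal
  that is stable under \<open>s/t\<close>; dividing by an element of minimal degree gives \<open>c s/t = q \<in> C[x]\<close> with
  \<open>0 \<noteq> c \<in> C\<close>. For all but finitely many \<open>\<xi> \<in> K\<close> the value \<open>q(\<xi>)/c\<close> is integral over \<open>C\<close>, so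
  it lies in \<open>C\<close>, and by interpolation at such \<open>\<xi>\<close> the coefficients of \<open>q/c\<close> lie in \<open>C\<close>.\<close>

section \<open>Fractions and integral equations\<close>


text \<open>Integral equations for a fraction \<open>s/t\<close> are kept in cleared form, as
  relations between powers of \<open>s\<close> and \<open>t\<close> inside the ring. In this form
  they can be pushed through any homomorphism, in particular through evaluation at a point. In the
  induction on the number of variables the coefficients form a domain, and interpolation must invert
  differences of points. It therefore works with an infinite set of elements whose differences are
  units, a condition that passes to polynomial rings. In (2) and (4) the morphism takes values in A
  \<otimes> R, which is a quotient of a different free space than B \<otimes> R. A linear retraction
  of B onto A makes A \<otimes> R -> B \<otimes> R injective. A linear form l on R with l(1) = 1
  yields id \<otimes> l, which recovers b from b \<otimes> 1 and sends A \<otimes> R into A. So an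
  element of A \<otimes> R that becomes b \<otimes> 1 has b in A and equals b \<otimes> 1 already
  there. In (4) injectivity comes from the augmentation, whose condition extends from A to B by
  cancelling denominators. There the automorphism of B is the identity on A.\<close>

lemma ring_hom_cring_of_hom:
  "\<lbrakk>cring R; cring S; h \<in> ring_hom R S\<rbrakk> \<Longrightarrow> ring_hom_cring R S h"
  by (simp add: ring_hom_cring_def ring_hom_cring_axioms_def)

text \<open>The values at \<open>(s, t)\<close> of the forms \<open>c\<^sub>0 t\<^sup>d + c\<^sub>1
  s t\<^sup>d\<^sup>-\<^sup>1 + ... + c\<^sub>d\<^sub>-\<^sub>1 s\<^sup>d\<^sup>-\<^sup>1 t\<close>,
  nested in the style of Horner. Membership of the \<open>d\<close>-th power of \<open>s\<close> is
  a monic equation of degree \<open>d\<close> for \<open>s/t\<close>, multiplied by the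
  \<open>d\<close>-th power of \<open>t\<close>.\<close>

primrec lower_forms :: "('a, 'm) ring_scheme \<Rightarrow> 'a \<Rightarrow> 'a \<Rightarrow> nat \<Rightarrow> 'a set" where
  "lower_forms R s t 0 = {\<zero>\<^bsub>R\<^esub>}"
| "lower_forms R s t (Suc d) =
    {t \<otimes>\<^bsub>R\<^esub> (u \<oplus>\<^bsub>R\<^esub> c \<otimes>\<^bsub>R\<^esub> s [^]\<^bsub>R\<^esub> d) | u c. u \<in> lower_forms R s t d \<and> c \<in> carrier R}"

text \<open>Integral closedness in terms of elements of \<open>R\<close> alone: every integral
  fraction is a quotient that exists in \<open>R\<close>. No fraction field has to be carried along
  when the property is moved to polynomial rings and tensor products.\<close>

definition frac_closed :: "('a, 'm) ring_scheme \<Rightarrow> bool" where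
  "frac_closed R \<longleftrightarrow> domain R \<and>
    (\<forall>s\<in>carrier R. \<forall>t\<in>carrier R - {\<zero>\<^bsub>R\<^esub>}. \<forall>d. s [^]\<^bsub>R\<^esub> d \<in> lower_forms R s t d \<longrightarrow>
      (\<exists>w\<in>carrier R. s = w \<otimes>\<^bsub>R\<^esub> t))"

lemma frac_closedD:
  assumes "frac_closed R" "s \<in> carrier R" "t \<in> carrier R" "t \<noteq> \<zero>\<^bsub>R\<^esub>"
    "s [^]\<^bsub>R\<^esub> (d::nat) \<in> lower_forms R s t d"
  obtains w where "w \<in> carrier R" "s = w \<otimes>\<^bsub>R\<^esub> t"
  using assms unfolding frac_closed_def by blast

lemma (in cring) lower_forms_closed:
  assumes "s \<in> carrier R" "t \<in> carrier R"
  shows "lower_forms R s t d \<subseteq> carrier R"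
  using assms by (induction d) auto

lemma (in cring) lower_forms_uminus:
  assumes "s \<in> carrier R" "t \<in> carrier R" "u \<in> lower_forms R s t d"
  shows "\<ominus> u \<in> lower_forms R s t d"
  using assms(3)
proof (induction d arbitrary: u)
  case (Suc d)
  then obtain v c where v: "v \<in> lower_forms R s t d" "c \<in> carrier R"
    and u: "u = t \<otimes> (v \<oplus> c \<otimes> s [^] d)" by auto
  have vc: "v \<in> carrier R" using lower_forms_closed assms v by blast
  have "\<ominus> u = t \<otimes> (\<ominus> v \<oplus> (\<ominus> c) \<otimes> s [^] d)"
    unfolding u using assms(2) v(2) vc nat_pow_closed[OF assms(1), of d] by algebra
  then show ?case using Suc.IH[OF v(1)] v(2) by auto
qed auto

text \<open>An integral equation survives every homomorphism. This is applied to isomorphisms and to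
  the evaluation of polynomials at a point.\<close>

lemma (in ring_hom_cring) hom_lower_forms:
  assumes "s \<in> carrier R" "t \<in> carrier R" "u \<in> lower_forms R s t d"
  shows "h u \<in> lower_forms S (h s) (h t) d"
  using assms(3)
proof (induction d arbitrary: u)
  case (Suc d)
  then obtain v c where v: "v \<in> lower_forms R s t d" "c \<in> carrier R"
    and u: "u = t \<otimes>\<^bsub>R\<^esub> (v \<oplus>\<^bsub>R\<^esub> c \<otimes>\<^bsub>R\<^esub> s [^]\<^bsub>R\<^esub> d)" by auto
  have "v \<in> carrier R" using R.lower_forms_closed assms v by blast
  then have "h u = h t \<otimes>\<^bsub>S\<^esub> (h v \<oplus>\<^bsub>S\<^esub> h c \<otimes>\<^bsub>S\<^esub> h s [^]\<^bsub>S\<^esub> d)"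
    unfolding u using assms v by simp
  then show ?case using Suc.IH[OF v(1)] v(2) by auto
qed auto

lemma frac_closed_iso:
  assumes R: "frac_closed R" and S: "cring S"
    and h: "h \<in> ring_hom R S" "bij_betw h (carrier R) (carrier S)"
  shows "frac_closed S"
proof -
  interpret R: domain R using R by (simp add: frac_closed_def)
  interpret S: cring S by fact
  interpret h: ring_hom_cring R S h by (rule ring_hom_cring_of_hom) (use R.is_cring S h in auto)
  let ?g = "inv_into (carrier R) h"
  have iso: "h \<in> ring_iso R S" using h by (simp add: ring_iso_def)
  have g: "?g \<in> ring_hom S R"
    using ring_iso_set_sym[OF R.ring_axioms iso] by (simp add: ring_iso_def)
  interpret g: ring_hom_cring S R ?g by (rule ring_hom_cring_of_hom) (use R.is_cring S g in auto)
  have hg: "h (?g x) = x" if "x \<in> carrier S" for x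
    using that h(2) by (simp add: bij_betw_def f_inv_into_f)
  have g0: "?g x \<noteq> \<zero>\<^bsub>R\<^esub>" if "x \<in> carrier S" "x \<noteq> \<zero>\<^bsub>S\<^esub>" for x
    using hg[OF that(1)] that(2) by auto
  have "domain S"
  proof (unfold_locales)
    show "\<one>\<^bsub>S\<^esub> \<noteq> \<zero>\<^bsub>S\<^esub>" using g.hom_one g.hom_zero R.one_not_zero by metis
  next
    fix a b assume ab: "a \<otimes>\<^bsub>S\<^esub> b = \<zero>\<^bsub>S\<^esub>" "a \<in> carrier S" "b \<in> carrier S"
    then have "?g a \<otimes>\<^bsub>R\<^esub> ?g b = \<zero>\<^bsub>R\<^esub>" by (metis g.hom_mult g.hom_zero)
    then show "a = \<zero>\<^bsub>S\<^esub> \<or> b = \<zero>\<^bsub>S\<^esub>"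
      using R.integral[of "?g a" "?g b"] g0 ab by auto
  qed
  moreover have "\<exists>w\<in>carrier S. s = w \<otimes>\<^bsub>S\<^esub> t"
    if s: "s \<in> carrier S" and t: "t \<in> carrier S" "t \<noteq> \<zero>\<^bsub>S\<^esub>"
      and d: "s [^]\<^bsub>S\<^esub> d \<in> lower_forms S s t d" for s t and d :: nat
  proof -
    have "?g s [^]\<^bsub>R\<^esub> d \<in> lower_forms R (?g s) (?g t) d"
      using g.hom_lower_forms[OF s t(1) d] s by simp
    then obtain w where "w \<in> carrier R" "?g s = w \<otimes>\<^bsub>R\<^esub> ?g t"
      using frac_closedD[OF R] g0 s t g.hom_closed by metis
    then have "s = h w \<otimes>\<^bsub>S\<^esub> t" using hg s t h.hom_mult g.hom_closed by metis
    then show ?thesis using \<open>w \<in> carrier R\<close> by auto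
  qed
  ultimately show ?thesis unfolding frac_closed_def by blast
qed

text \<open>The ring generated by \<open>s/t\<close> is spanned by the powers below the
  \<open>d\<close>-th, so one denominator, the \<open>d\<close>-th power of \<open>t\<close>, serves
  all powers of \<open>s/t\<close>.\<close>

lemma (in domain) pow_divides_pow_mult:
  assumes s: "s \<in> carrier R" and t: "t \<in> carrier R"
    and d: "s [^] (d::nat) \<in> lower_forms R s t d"
  shows "\<exists>y\<in>carrier R. t [^] d \<otimes> s [^] i = t [^] (i::nat) \<otimes> y"
proof (induction i rule: less_induct)
  case (less i)
  \<comment> \<open>Generalised to all lower forms, so that an inner induction can follow their
    recursion. Stripping the outer factor \<open>t\<close> lowers \<open>e\<close> by one, and the
    monomial in the new coefficient is covered by the outer hypothesis at
    \<open>m + e < i\<close>.\<close>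
  have step: "\<exists>y\<in>carrier R. t [^] d \<otimes> s [^] m \<otimes> u = t [^] (m + e) \<otimes> y"
    if "u \<in> lower_forms R s t e" "m + e \<le> i" for u m e
    using that
  proof (induction e arbitrary: u)
    case 0
    then show ?case using s t by (intro bexI[of _ "\<zero>"]) auto
  next
    case (Suc e)
    then obtain v c where v: "v \<in> lower_forms R s t e" "c \<in> carrier R"
      and u: "u = t \<otimes> (v \<oplus> c \<otimes> s [^] e)" by auto
    have vc: "v \<in> carrier R" using lower_forms_closed s t v by blast
    obtain y where y: "y \<in> carrier R" "t [^] d \<otimes> s [^] m \<otimes> v = t [^] (m + e) \<otimes> y"
      using Suc v by force
    obtain z where z: "z \<in> carrier R" "t [^] d \<otimes> s [^] (m + e) = t [^] (m + e) \<otimes> z"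
      using less[of "m + e"] Suc.prems by force
    have "t [^] d \<otimes> s [^] m \<otimes> u = t \<otimes> (t [^] d \<otimes> s [^] m \<otimes> v \<oplus> c \<otimes> (t [^] d \<otimes> (s [^] m \<otimes> s [^] e)))"
      unfolding u using s t v(2) vc nat_pow_closed[OF s, of m] nat_pow_closed[OF s, of e]
        nat_pow_closed[OF t, of d] by algebra
    also have "\<dots> = t \<otimes> (t [^] (m + e) \<otimes> y \<oplus> c \<otimes> (t [^] (m + e) \<otimes> z))"
      using y z s by (simp add: nat_pow_mult)
    also have "\<dots> = (t [^] (m + e) \<otimes> t) \<otimes> (y \<oplus> c \<otimes> z)"
      using t v(2) y(1) z(1) nat_pow_closed[OF t, of "m + e"] by algebra
    finally show ?case using y z v by (intro bexI[of _ "y \<oplus> c \<otimes> z"]) auto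
  qed
  show ?case
  proof (cases "i \<le> d")
    case True
    then have "t [^] d = t [^] i \<otimes> t [^] (d - i)" using t by (simp add: nat_pow_mult)
    then show ?thesis using s t by (intro bexI[of _ "t [^] (d - i) \<otimes> s [^] i"]) (auto simp: m_assoc)
  next
    case False
    then have "s [^] i = s [^] (i - d) \<otimes> s [^] d" using s by (simp add: nat_pow_mult)
    then show ?thesis using step[OF d, of "i - d"] False s t by (simp add: m_assoc)
  qed
qed


section \<open>Arithmetic in the fraction field\<close>

context domain
begin

lemma frac_rel_equiv: "equiv (carrier R \<times> (carrier R - {\<zero>})) (frac_rel R)"
proof (rule equivI)
  show "frac_rel R \<subseteq> (carrier R \<times> (carrier R - {\<zero>})) \<times> (carrier R \<times> (carrier R - {\<zero>}))"
    by (auto simp: frac_rel_def)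
  show "refl_on (carrier R \<times> (carrier R - {\<zero>})) (frac_rel R)"
    by (auto simp: refl_on_def frac_rel_def)
  show "sym (frac_rel R)" by (auto simp: sym_def frac_rel_def)
  show "trans (frac_rel R)"
  proof (rule transI)
    fix x y z assume "(x, y) \<in> frac_rel R" "(y, z) \<in> frac_rel R"
    then obtain a b c d e f where x: "x = (a, b)" "y = (c, d)" "z = (e, f)"
      and carr: "a \<in> carrier R" "b \<in> carrier R" "c \<in> carrier R" "d \<in> carrier R"
        "e \<in> carrier R" "f \<in> carrier R" "b \<noteq> \<zero>" "d \<noteq> \<zero>" "f \<noteq> \<zero>"
      and eq: "a \<otimes> d = c \<otimes> b" "c \<otimes> f = e \<otimes> d"
      by (auto simp: frac_rel_def)
    have "d \<otimes> (a \<otimes> f) = (a \<otimes> d) \<otimes> f" using carr by algebra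
    also have "\<dots> = (c \<otimes> f) \<otimes> b" using carr by (simp only: eq(1)) algebra
    also have "\<dots> = d \<otimes> (e \<otimes> b)" using carr by (simp only: eq(2)) algebra
    finally have "a \<otimes> f = e \<otimes> b" using carr by (simp add: m_lcancel)
    then show "(x, z) \<in> frac_rel R" using carr by (auto simp: x frac_rel_def)
  qed
qed

lemma frac_eq_iff:
  assumes "a \<in> carrier R" "b \<in> carrier R - {\<zero>}" "c \<in> carrier R" "d \<in> carrier R - {\<zero>}"
  shows "frac R a b = frac R c d \<longleftrightarrow> a \<otimes> d = c \<otimes> b"
proof -
  have "frac R a b = frac R c d \<longleftrightarrow> ((a, b), (c, d)) \<in> frac_rel R"
    unfolding frac_def using assms by (intro eq_equiv_class_iff[OF frac_rel_equiv]) auto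
  also have "\<dots> \<longleftrightarrow> a \<otimes> d = c \<otimes> b" using assms by (auto simp: frac_rel_def)
  finally show ?thesis .
qed

lemma frac_self: "\<lbrakk>a \<in> carrier R; b \<in> carrier R - {\<zero>}\<rbrakk> \<Longrightarrow> (a, b) \<in> frac R a b"
  by (auto simp: frac_def frac_rel_def)

lemma mem_frac:
  assumes "(c, d) \<in> frac R a b"
  shows "a \<in> carrier R" "b \<in> carrier R" "c \<in> carrier R" "d \<in> carrier R"
    "b \<noteq> \<zero>" "d \<noteq> \<zero>" "a \<otimes> d = c \<otimes> b"
  using assms by (auto simp: frac_def frac_rel_def)

lemma frac_in_carrier: "\<lbrakk>a \<in> carrier R; b \<in> carrier R - {\<zero>}\<rbrakk> \<Longrightarrow> frac R a b \<in> carrier (frac_field R)"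
  by (auto simp: frac_field_def frac_def intro!: quotientI)

lemma frac_cases:
  assumes "x \<in> carrier (frac_field R)"
  obtains a b where "a \<in> carrier R" "b \<in> carrier R - {\<zero>}" "x = frac R a b"
  using assms by (auto simp: frac_field_def frac_def elim!: quotientE)

lemma frac_mult:
  assumes "a \<in> carrier R" "b \<in> carrier R - {\<zero>}" "c \<in> carrier R" "d \<in> carrier R - {\<zero>}"
  shows "frac R a b \<otimes>\<^bsub>frac_field R\<^esub> frac R c d = frac R (a \<otimes> c) (b \<otimes> d)"
proof -
  have eq: "frac R (a' \<otimes> c') (b' \<otimes> d') = frac R (a \<otimes> c) (b \<otimes> d)"
    if "(a', b') \<in> frac R a b" "(c', d') \<in> frac R c d" for a' b' c' d'
  proof -
    note m = mem_frac(1-6)[OF that(1)] mem_frac(1-6)[OF that(2)]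
    note e = mem_frac(7)[OF that(1)] mem_frac(7)[OF that(2)]
    have "(a' \<otimes> c') \<otimes> (b \<otimes> d) = (a' \<otimes> b) \<otimes> (c' \<otimes> d)" using m by algebra
    also have "\<dots> = (a \<otimes> c) \<otimes> (b' \<otimes> d')" using m
      by (simp only: e[symmetric]) algebra
    finally show ?thesis using m integral by (subst frac_eq_iff) auto
  qed
  have "frac R a b \<otimes>\<^bsub>frac_field R\<^esub> frac R c d =
      (\<Union>(a', b')\<in>frac R a b. \<Union>(c', d')\<in>frac R c d. frac R (a' \<otimes> c') (b' \<otimes> d'))"
    by (simp add: frac_field_def)
  also have "\<dots> = frac R (a \<otimes> c) (b \<otimes> d)"
    using frac_self[OF assms(1,2)] frac_self[OF assms(3,4)] eq by fast
  finally show ?thesis .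
qed

lemma frac_add:
  assumes "a \<in> carrier R" "b \<in> carrier R - {\<zero>}" "c \<in> carrier R" "d \<in> carrier R - {\<zero>}"
  shows "frac R a b \<oplus>\<^bsub>frac_field R\<^esub> frac R c d = frac R (a \<otimes> d \<oplus> c \<otimes> b) (b \<otimes> d)"
proof -
  have eq: "frac R (a' \<otimes> d' \<oplus> c' \<otimes> b') (b' \<otimes> d') = frac R (a \<otimes> d \<oplus> c \<otimes> b) (b \<otimes> d)"
    if "(a', b') \<in> frac R a b" "(c', d') \<in> frac R c d" for a' b' c' d'
  proof -
    note m = mem_frac(1-6)[OF that(1)] mem_frac(1-6)[OF that(2)]
    note e = mem_frac(7)[OF that(1)] mem_frac(7)[OF that(2)]
    have "(a' \<otimes> d' \<oplus> c' \<otimes> b') \<otimes> (b \<otimes> d)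
        = (a' \<otimes> b) \<otimes> (d \<otimes> d') \<oplus> (c' \<otimes> d) \<otimes> (b \<otimes> b')" using m by algebra
    also have "\<dots> = (a \<otimes> d \<oplus> c \<otimes> b) \<otimes> (b' \<otimes> d')" using m
      by (simp only: e[symmetric]) algebra
    finally show ?thesis using m integral by (subst frac_eq_iff) auto
  qed
  have "frac R a b \<oplus>\<^bsub>frac_field R\<^esub> frac R c d =
      (\<Union>(a', b')\<in>frac R a b. \<Union>(c', d')\<in>frac R c d. frac R (a' \<otimes> d' \<oplus> c' \<otimes> b') (b' \<otimes> d'))"
    by (simp add: frac_field_def)
  also have "\<dots> = frac R (a \<otimes> d \<oplus> c \<otimes> b) (b \<otimes> d)"
    using frac_self[OF assms(1,2)] frac_self[OF assms(3,4)] eq by fast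
  finally show ?thesis .
qed

lemma frac_one: "\<one>\<^bsub>frac_field R\<^esub> = frac R \<one> \<one>"
  and frac_zero: "\<zero>\<^bsub>frac_field R\<^esub> = frac R \<zero> \<one>"
  by (simp_all add: frac_field_def)

lemmas frac_simps = frac_mult frac_add frac_one frac_zero frac_eq_iff frac_in_carrier

lemma frac_field_cring: "cring (frac_field R)"
proof (rule cringI)
  note [simp] = frac_simps integral_iff
  show "abelian_group (frac_field R)"
  proof (rule abelian_groupI)
    fix x y assume "x \<in> carrier (frac_field R)" "y \<in> carrier (frac_field R)"
    then show "x \<oplus>\<^bsub>frac_field R\<^esub> y \<in> carrier (frac_field R)"
      by (elim frac_cases) simp
  next
    show "\<zero>\<^bsub>frac_field R\<^esub> \<in> carrier (frac_field R)" by simp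
  next
    fix x y z assume "x \<in> carrier (frac_field R)" "y \<in> carrier (frac_field R)" "z \<in> carrier (frac_field R)"
    then show "x \<oplus>\<^bsub>frac_field R\<^esub> y \<oplus>\<^bsub>frac_field R\<^esub> z = x \<oplus>\<^bsub>frac_field R\<^esub> (y \<oplus>\<^bsub>frac_field R\<^esub> z)"
      by (elim frac_cases) (simp, algebra)
  next
    fix x y assume "x \<in> carrier (frac_field R)" "y \<in> carrier (frac_field R)"
    then show "x \<oplus>\<^bsub>frac_field R\<^esub> y = y \<oplus>\<^bsub>frac_field R\<^esub> x"
      by (elim frac_cases) (simp, algebra)
  next
    fix x assume "x \<in> carrier (frac_field R)"
    then show "\<zero>\<^bsub>frac_field R\<^esub> \<oplus>\<^bsub>frac_field R\<^esub> x = x" by (elim frac_cases) simp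
  next
    fix x assume "x \<in> carrier (frac_field R)"
    then obtain a b where ab: "a \<in> carrier R" "b \<in> carrier R - {\<zero>}" "x = frac R a b" by (elim frac_cases)
    then have "(\<ominus> a) \<otimes> b \<oplus> a \<otimes> b = \<zero>" by simp algebra
    then show "\<exists>y\<in>carrier (frac_field R). y \<oplus>\<^bsub>frac_field R\<^esub> x = \<zero>\<^bsub>frac_field R\<^esub>"
      using ab by (intro bexI[of _ "frac R (\<ominus> a) b"]) simp_all
  qed
  show "comm_monoid (frac_field R)"
  proof (rule comm_monoidI)
    fix x y assume "x \<in> carrier (frac_field R)" "y \<in> carrier (frac_field R)"
    then show "x \<otimes>\<^bsub>frac_field R\<^esub> y \<in> carrier (frac_field R)"
      by (elim frac_cases) simp
  next
    show "\<one>\<^bsub>frac_field R\<^esub> \<in> carrier (frac_field R)" by simp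
  next
    fix x y z assume "x \<in> carrier (frac_field R)" "y \<in> carrier (frac_field R)" "z \<in> carrier (frac_field R)"
    then show "x \<otimes>\<^bsub>frac_field R\<^esub> y \<otimes>\<^bsub>frac_field R\<^esub> z = x \<otimes>\<^bsub>frac_field R\<^esub> (y \<otimes>\<^bsub>frac_field R\<^esub> z)"
      by (elim frac_cases) (simp, algebra)
  next
    fix x assume "x \<in> carrier (frac_field R)"
    then show "\<one>\<^bsub>frac_field R\<^esub> \<otimes>\<^bsub>frac_field R\<^esub> x = x" by (elim frac_cases) simp
  next
    fix x y assume "x \<in> carrier (frac_field R)" "y \<in> carrier (frac_field R)"
    then show "x \<otimes>\<^bsub>frac_field R\<^esub> y = y \<otimes>\<^bsub>frac_field R\<^esub> x"
      by (elim frac_cases) (simp, algebra)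
  qed
  fix x y z assume "x \<in> carrier (frac_field R)" "y \<in> carrier (frac_field R)" "z \<in> carrier (frac_field R)"
  then show "(x \<oplus>\<^bsub>frac_field R\<^esub> y) \<otimes>\<^bsub>frac_field R\<^esub> z =
      x \<otimes>\<^bsub>frac_field R\<^esub> z \<oplus>\<^bsub>frac_field R\<^esub> y \<otimes>\<^bsub>frac_field R\<^esub> z"
    by (elim frac_cases) (simp, algebra)
qed

lemma pow_nonzero: "\<lbrakk>a \<in> carrier R; a \<noteq> \<zero>\<rbrakk> \<Longrightarrow> a [^] (n::nat) \<noteq> \<zero>"
  by (induction n) (auto simp: integral_iff)

lemma frac_pow:
  assumes "a \<in> carrier R" "b \<in> carrier R - {\<zero>}"
  shows "frac R a b [^]\<^bsub>frac_field R\<^esub> (n::nat) = frac R (a [^] n) (b [^] n)"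
proof (induction n)
  case (Suc n)
  have "b [^] n \<noteq> \<zero>" using assms by (simp add: pow_nonzero)
  then show ?case using Suc assms
    by (simp add: frac_mult)
qed (simp add: frac_one)

text \<open>Dehomogenisation. List polynomials have the leading coefficient in front; the length is
  exactly \<open>d\<close>, with leading zeros allowed, so that a further entry put in front becomes
  the coefficient of degree \<open>d\<close>.\<close>

lemma eval_lower_forms:
  assumes s: "s \<in> carrier R" and t: "t \<in> carrier R - {\<zero>}" and u: "u \<in> lower_forms R s t d"
  shows "\<exists>p. length p = d \<and> set p \<subseteq> frac_embed R ` carrier R \<and>
    ring.eval (frac_field R) p (frac R s t) = frac R u (t [^] d)"
  using u
proof (induction d arbitrary: u)
  case 0
  interpret F: cring "frac_field R" by (rule frac_field_cring)
  show ?case using 0 by (simp add: frac_zero)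
next
  case (Suc d)
  interpret F: cring "frac_field R" by (rule frac_field_cring)
  obtain v c where v: "v \<in> lower_forms R s t d" "c \<in> carrier R"
    and u: "u = t \<otimes> (v \<oplus> c \<otimes> s [^] d)" using Suc.prems by auto
  have vc: "v \<in> carrier R" using lower_forms_closed s t v by blast
  obtain p where p: "length p = d" "set p \<subseteq> frac_embed R ` carrier R"
    "ring.eval (frac_field R) p (frac R s t) = frac R v (t [^] d)" using Suc.IH[OF v(1)] by auto
  have td: "t [^] d \<in> carrier R - {\<zero>}" using t by (simp add: pow_nonzero)
  have sd: "s [^] d \<in> carrier R" using s by simp
  \<comment> \<open>The cross-multiplied form of the equality of fractions below. The powers of
    \<open>s\<close> and \<open>t\<close> are replaced by variables, which leaves a plain ring
    identity.\<close>
  have key: "(c \<otimes> S \<otimes> T \<oplus> v \<otimes> T) \<otimes> (T \<otimes> t) = t \<otimes> (v \<oplus> c \<otimes> S) \<otimes> (T \<otimes> T)"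
    if "S \<in> carrier R" "T \<in> carrier R" for S T
  proof -
    have "t \<in> carrier R" using t by simp
    then show ?thesis using that vc v(2) by algebra
  qed
  have "ring.eval (frac_field R) (frac_embed R c # p) (frac R s t)
      = frac R c \<one> \<otimes>\<^bsub>frac_field R\<^esub> frac R (s [^] d) (t [^] d) \<oplus>\<^bsub>frac_field R\<^esub> frac R v (t [^] d)"
    using p s t by (simp add: frac_embed_def frac_pow)
  also have "\<dots> = frac R u (t [^] Suc d)"
    using td sd t vc v(2) by (simp add: frac_simps integral_iff u key)
  finally show ?case using p v(2) by (intro exI[of _ "frac_embed R c # p"]) auto
qed

end

lemma integrally_closed_imp_frac_closed:
  assumes "integrally_closed_domain R"
  shows "frac_closed R"
proof -
  interpret domain R using assms by (simp add: integrally_closed_domain_def)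
  interpret F: cring "frac_field R" by (rule frac_field_cring)
  have "\<exists>w\<in>carrier R. s = w \<otimes>\<^bsub>R\<^esub> t"
    if s: "s \<in> carrier R" and t: "t \<in> carrier R - {\<zero>\<^bsub>R\<^esub>}"
      and d: "s [^]\<^bsub>R\<^esub> d \<in> lower_forms R s t d" for s t and d :: nat
  proof -
    let ?F = "frac_field R" and ?x = "frac R s t"
    \<comment> \<open>The sign is moved into the lower form: the list for the negated power, with a
      leading one in front, then has the value zero at \<open>s/t\<close>.\<close>
    have "\<ominus>\<^bsub>R\<^esub> (s [^]\<^bsub>R\<^esub> d) \<in> lower_forms R s t d" using lower_forms_uminus[OF s _ d] t by blast
    then obtain p where p: "length p = d" "set p \<subseteq> frac_embed R ` carrier R"
      "ring.eval ?F p ?x = frac R (\<ominus>\<^bsub>R\<^esub> (s [^]\<^bsub>R\<^esub> d)) (t [^]\<^bsub>R\<^esub> d)"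
      using eval_lower_forms[OF s t] by blast
    have td: "t [^]\<^bsub>R\<^esub> d \<in> carrier R - {\<zero>\<^bsub>R\<^esub>}" using t by (simp add: pow_nonzero)
    have sd: "s [^]\<^bsub>R\<^esub> d \<in> carrier R" using s by simp
    have "ring.eval ?F (\<one>\<^bsub>?F\<^esub> # p) ?x = \<zero>\<^bsub>?F\<^esub>"
      using p s t td sd
      by (simp add: frac_pow frac_simps integral_iff l_minus r_neg)
    moreover have "\<one>\<^bsub>?F\<^esub> \<in> frac_embed R ` carrier R"
      by (simp add: frac_embed_def frac_one)
    ultimately have "integral_over ?F (frac_embed R ` carrier R) ?x"
      unfolding integral_over_def using p(2) by (intro exI[of _ "\<one>\<^bsub>?F\<^esub> # p"]) auto
    then have "?x \<in> frac_embed R ` carrier R"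
      using assms frac_in_carrier[OF s t] by (simp add: integrally_closed_domain_def)
    then show ?thesis using s t by (auto simp: frac_embed_def frac_eq_iff)
  qed
  then show ?thesis unfolding frac_closed_def using domain_axioms by blast
qed

section \<open>Polynomials over a domain\<close>


lemma (in ideal) finsum_mem:
  "finite A \<Longrightarrow> (\<And>a. a \<in> A \<Longrightarrow> f a \<in> I) \<Longrightarrow> finsum R f A \<in> I"
proof (induction A rule: finite_induct)
  case (insert x F)
  then have "f \<in> insert x F \<rightarrow> carrier R" using a_subset by auto
  then show ?case using insert by (simp add: Pi_iff)
qed simp

lemma (in UP_domain) eval_UP_hom:
  "x \<in> carrier R \<Longrightarrow> ring_hom_cring P R (UnivPoly.eval R R id x)"
  using UP_pre_univ_prop.eval_ring_hom[OF UP_pre_univ_propI[OF R.is_cring R.is_cring id_ring_hom], of x, folded P_def]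
  by (intro ring_hom_cring_of_hom P.is_cring R.is_cring)

lemma (in UP_domain) eval_UP_const:
  "\<lbrakk>x \<in> carrier R; c \<in> carrier R\<rbrakk> \<Longrightarrow> UnivPoly.eval R R id x (up_ring.monom P c 0) = c"
  using UP_pre_univ_prop.eval_const[OF UP_pre_univ_propI[OF R.is_cring R.is_cring id_ring_hom], of x c, folded P_def]
  by simp

lemma (in UP_domain) eval_UP_X:
  "x \<in> carrier R \<Longrightarrow> UnivPoly.eval R R id x (up_ring.monom P \<one> 1) = x"
  using UP_pre_univ_prop.eval_monom1[OF UP_pre_univ_propI[OF R.is_cring R.is_cring id_ring_hom], of x, folded P_def]
  by simp

text \<open>Over \<open>R / I\<close> this says that a polynomial with more zeros than its degree vanishes, if the
  differences of the zeros are invertible.\<close>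

lemma (in UP_domain) coeff_mem_ideal:
  assumes I: "ideal I R"
  shows "\<lbrakk>f \<in> carrier P; finite J; J \<subseteq> carrier R; deg R f < card J;
      \<And>x y. \<lbrakk>x \<in> J; y \<in> J; x \<noteq> y\<rbrakk> \<Longrightarrow> x \<ominus> y \<in> Units R;
      \<And>x. x \<in> J \<Longrightarrow> UnivPoly.eval R R id x f \<in> I\<rbrakk> \<Longrightarrow> up_ring.coeff P f n \<in> I"
proof (induction "deg R f" arbitrary: f J n rule: less_induct)
  case less
  interpret I: ideal I R by fact
  obtain a where a: "a \<in> J" using less.prems by fastforce
  then have aR: "a \<in> carrier R" using less.prems by auto
  interpret ea: ring_hom_cring P R "UnivPoly.eval R R id a" by (rule eval_UP_hom[OF aR])
  have triv: "carrier R \<noteq> {\<zero>}" using R.one_not_zero R.one_closed by blast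
  let ?c = "UnivPoly.eval R R id a f"
  have c: "?c \<in> carrier R" "?c \<in> I" using less.prems a by auto
  show ?case
  proof (cases "deg R f = 0")
    case True
    then have f: "f = up_ring.monom P (up_ring.coeff P f 0) 0" using deg_zero_impl_monom less.prems(1) by blast
    have "?c = up_ring.coeff P f 0"
      using less.prems(1) aR by (subst f) (simp add: eval_UP_const)
    then show ?thesis using c less.prems(1) by (subst f) simp
  next
    case False
    obtain q where q: "q \<in> carrier P"
      and f: "f = (up_ring.monom P \<one> 1 \<ominus>\<^bsub>P\<^esub> up_ring.monom P a 0) \<otimes>\<^bsub>P\<^esub> q \<oplus>\<^bsub>P\<^esub> up_ring.monom P ?c 0"
      using remainder_theorem[OF less.prems(1) aR triv] by blast
    let ?X = "up_ring.monom P \<one> 1 \<ominus>\<^bsub>P\<^esub> up_ring.monom P a 0"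
    have X: "?X \<in> carrier P" using aR by simp
    have dX: "deg R ?X = 1" by (rule deg_monom_minus[OF aR triv])
    \<comment> \<open>A zero quotient would make \<open>f\<close> constant, while the degree is
      positive in this case. With \<open>q\<close> nonzero, degrees add in the domain and the
      induction descends.\<close>
    have q0: "q \<noteq> \<zero>\<^bsub>P\<^esub>"
    proof
      assume "q = \<zero>\<^bsub>P\<^esub>"
      then have "f = up_ring.monom P ?c 0" using f c(1) X by simp
      then show False using False c(1) by (metis deg_const)
    qed
    have X0: "?X \<noteq> \<zero>\<^bsub>P\<^esub>" using dX by (metis deg_zero zero_neq_one)
    have "?X \<otimes>\<^bsub>P\<^esub> q = f \<ominus>\<^bsub>P\<^esub> up_ring.monom P ?c 0"
      using X q c(1) by (subst f) (simp add: P.minus_eq P.a_assoc P.r_neg)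
    then have "1 + deg R q = deg R (f \<ominus>\<^bsub>P\<^esub> up_ring.monom P ?c 0)"
      using deg_mult[OF X0 q0 X q] dX by simp
    also have "\<dots> \<le> deg R f"
      using deg_add[of f "\<ominus>\<^bsub>P\<^esub> up_ring.monom P ?c 0"] less.prems(1) c(1) by (simp add: P.minus_eq)
    finally have dq: "deg R q < deg R f" by simp
    have qI: "up_ring.coeff P q n \<in> I" for n
    proof (rule less.hyps[OF dq q, of "J - {a}"])
      show "deg R q < card (J - {a})" using dq less.prems a by simp
      fix y assume y: "y \<in> J - {a}"
      then have yR: "y \<in> carrier R" using less.prems by auto
      interpret ey: ring_hom_cring P R "UnivPoly.eval R R id y" by (rule eval_UP_hom[OF yR])
      let ?v = "UnivPoly.eval R R id y q"
      have v: "?v \<in> carrier R" using q by simp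
      have u: "y \<ominus> a \<in> Units R" using y a less.prems by auto
      have "UnivPoly.eval R R id y f = (y \<ominus> a) \<otimes> ?v \<oplus> ?c"
        using q aR c(1) yR
        by (subst f) (simp add: P.minus_eq R.minus_eq eval_UP_const eval_UP_X del: One_nat_def)
      \<comment> \<open>The values of \<open>q\<close> at the remaining points lie in
        \<open>I\<close>: the difference of two values of \<open>f\<close> does, and
        \<open>y \<ominus> a\<close> can be divided out because it is a unit.\<close>
      then have "(y \<ominus> a) \<otimes> ?v = UnivPoly.eval R R id y f \<ominus> ?c"
        using v c(1) yR aR by (simp add: R.minus_eq R.a_assoc R.r_neg)
      also have "\<dots> \<in> I" using less.prems(6)[of y] y c(2) by (simp add: R.minus_eq)
      finally have "inv (y \<ominus> a) \<otimes> ((y \<ominus> a) \<otimes> ?v) \<in> I"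
        using u by (rule I.I_l_closed[OF _ R.Units_inv_closed])
      moreover have "inv (y \<ominus> a) \<otimes> ((y \<ominus> a) \<otimes> ?v) = ?v"
        using u v R.m_assoc[of "inv (y \<ominus> a)" "y \<ominus> a" ?v] R.Units_l_inv R.Units_inv_closed R.Units_closed R.l_one
        by metis
      ultimately show "?v \<in> I" by simp
    qed (use less.prems in auto)
    have "up_ring.coeff P (?X \<otimes>\<^bsub>P\<^esub> q) n \<in> I"
      using X q by (simp add: coeff_mult, intro I.finsum_mem I.I_l_closed qI) auto
    moreover have "up_ring.coeff P (up_ring.monom P ?c 0) n \<in> I" using c by simp
    ultimately show ?thesis using X q c(1) by (subst f) (simp add: I.a_closed)
  qed
qed

section \<open>Denominators of integral fractions of polynomials\<close>

lemma (in UP_domain) smult_eq_mult: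
  "\<lbrakk>a \<in> carrier R; p \<in> carrier P\<rbrakk> \<Longrightarrow> a \<odot>\<^bsub>P\<^esub> p = up_ring.monom P a 0 \<otimes>\<^bsub>P\<^esub> p"
  by (simp add: monom_mult_is_smult)

lemma (in UP_domain) pseudo_quotient:
  assumes s: "s \<in> carrier P" and t: "t \<in> carrier P" "t \<noteq> \<zero>\<^bsub>P\<^esub>"
    and d: "s [^]\<^bsub>P\<^esub> (d::nat) \<in> lower_forms P s t d"
  obtains c q where "c \<in> carrier R" "c \<noteq> \<zero>" "q \<in> carrier P" "c \<odot>\<^bsub>P\<^esub> s = t \<otimes>\<^bsub>P\<^esub> q"
proof -
  \<comment> \<open>The ideal of common denominators of all powers of \<open>s/t\<close>, written
    without fractions. The \<open>d\<close>-th power of \<open>t\<close> is a nonzero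
    member.\<close>
  define D where "D = {h \<in> carrier P. \<forall>i::nat. \<exists>y\<in>carrier P. h \<otimes>\<^bsub>P\<^esub> s [^]\<^bsub>P\<^esub> i = t [^]\<^bsub>P\<^esub> i \<otimes>\<^bsub>P\<^esub> y}"
  have "t [^]\<^bsub>P\<^esub> d \<in> D - {\<zero>\<^bsub>P\<^esub>}"
    using domain.pow_divides_pow_mult[OF UP_domain s t(1) d] t domain.pow_nonzero[OF UP_domain] by (auto simp: D_def)
  then obtain h where hD: "h \<in> D - {\<zero>\<^bsub>P\<^esub>}"
    and min: "\<And>g. g \<in> D - {\<zero>\<^bsub>P\<^esub>} \<Longrightarrow> deg R h \<le> deg R g"
    using ex_has_least_nat[of "\<lambda>g. g \<in> D - {\<zero>\<^bsub>P\<^esub>}" _ "deg R"] by blast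
  then have h: "h \<in> D" "h \<noteq> \<zero>\<^bsub>P\<^esub>" by auto
  have hP: "h \<in> carrier P" using h by (simp add: D_def)
  obtain g where g: "g \<in> carrier P" "h \<otimes>\<^bsub>P\<^esub> s = t \<otimes>\<^bsub>P\<^esub> g"
  proof -
    have "\<exists>y\<in>carrier P. h \<otimes>\<^bsub>P\<^esub> s [^]\<^bsub>P\<^esub> (1::nat) = t [^]\<^bsub>P\<^esub> (1::nat) \<otimes>\<^bsub>P\<^esub> y"
      using h(1) unfolding D_def by blast
    then show ?thesis using s t that by auto
  qed
  \<comment> \<open>\<open>g\<close> is \<open>h\<close> times \<open>s/t\<close>. Each of its
    conditions is the next one for \<open>h\<close>, from which one factor \<open>t\<close> is
    cancelled.\<close>
  have gD: "\<exists>y\<in>carrier P. g \<otimes>\<^bsub>P\<^esub> s [^]\<^bsub>P\<^esub> i = t [^]\<^bsub>P\<^esub> i \<otimes>\<^bsub>P\<^esub> y" for i :: nat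
  proof -
    obtain y where y: "y \<in> carrier P" "h \<otimes>\<^bsub>P\<^esub> s [^]\<^bsub>P\<^esub> Suc i = t [^]\<^bsub>P\<^esub> Suc i \<otimes>\<^bsub>P\<^esub> y"
      using h(1) unfolding D_def by blast
    have "t \<otimes>\<^bsub>P\<^esub> (g \<otimes>\<^bsub>P\<^esub> s [^]\<^bsub>P\<^esub> i) = (t \<otimes>\<^bsub>P\<^esub> g) \<otimes>\<^bsub>P\<^esub> s [^]\<^bsub>P\<^esub> i"
      using s t g by (simp add: P.m_assoc)
    also have "\<dots> = h \<otimes>\<^bsub>P\<^esub> s [^]\<^bsub>P\<^esub> Suc i"
      using s hP by (simp add: g(2)[symmetric] P.m_ac)
    also have "\<dots> = t \<otimes>\<^bsub>P\<^esub> (t [^]\<^bsub>P\<^esub> i \<otimes>\<^bsub>P\<^esub> y)"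
      unfolding y(2) using t(1) y(1) by (simp add: P.m_ac)
    finally have "g \<otimes>\<^bsub>P\<^esub> s [^]\<^bsub>P\<^esub> i = t [^]\<^bsub>P\<^esub> i \<otimes>\<^bsub>P\<^esub> y"
      using domain.m_lcancel[OF UP_domain t(2,1)] s t(1) g(1) y(1) by simp
    then show ?thesis using y(1) by blast
  qed
  have lh: "lcoeff h \<in> carrier R" "lcoeff h \<noteq> \<zero>" using hP h(2) lcoeff_nonzero2 by auto
  \<comment> \<open>The leading coefficient of \<open>h\<close> need not be a unit, so the division
    has to be paid for with a power of it. This power is the constant \<open>c\<close> of the
    statement.\<close>
  obtain q r and k :: nat where qr: "q \<in> carrier P" "r \<in> carrier P"
    and eq: "lcoeff h [^] k \<odot>\<^bsub>P\<^esub> g = h \<otimes>\<^bsub>P\<^esub> q \<oplus>\<^bsub>P\<^esub> r"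
    and r: "r = \<zero>\<^bsub>P\<^esub> \<or> deg R r < deg R h"
    using long_div_theorem[OF hP g(1) h(2)] by blast
  define c where "c = lcoeff h [^] k"
  have c: "c \<in> carrier R" "c \<noteq> \<zero>" using lh R.pow_nonzero by (auto simp: c_def)
  have "r \<in> D"
  proof -
    have rr: "r = c \<odot>\<^bsub>P\<^esub> g \<ominus>\<^bsub>P\<^esub> h \<otimes>\<^bsub>P\<^esub> q"
      unfolding c_def eq using qr hP by (simp add: P.minus_eq P.a_ac P.r_neg)
    have "\<exists>y\<in>carrier P. r \<otimes>\<^bsub>P\<^esub> s [^]\<^bsub>P\<^esub> i = t [^]\<^bsub>P\<^esub> i \<otimes>\<^bsub>P\<^esub> y" for i :: nat
    proof -
      obtain y where y: "y \<in> carrier P" "h \<otimes>\<^bsub>P\<^esub> s [^]\<^bsub>P\<^esub> i = t [^]\<^bsub>P\<^esub> i \<otimes>\<^bsub>P\<^esub> y"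
        using h(1) unfolding D_def by blast
      obtain z where z: "z \<in> carrier P" "g \<otimes>\<^bsub>P\<^esub> s [^]\<^bsub>P\<^esub> i = t [^]\<^bsub>P\<^esub> i \<otimes>\<^bsub>P\<^esub> z"
        using gD by blast
      let ?m = "up_ring.monom P c 0"
      have m: "?m \<in> carrier P" using c by simp
      have si: "s [^]\<^bsub>P\<^esub> i \<in> carrier P" and ti: "t [^]\<^bsub>P\<^esub> i \<in> carrier P" using s t by auto
      have "r \<otimes>\<^bsub>P\<^esub> s [^]\<^bsub>P\<^esub> i = ?m \<otimes>\<^bsub>P\<^esub> (g \<otimes>\<^bsub>P\<^esub> s [^]\<^bsub>P\<^esub> i) \<ominus>\<^bsub>P\<^esub> q \<otimes>\<^bsub>P\<^esub> (h \<otimes>\<^bsub>P\<^esub> s [^]\<^bsub>P\<^esub> i)"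
        unfolding rr smult_eq_mult[OF c(1) g(1)] using m g(1) hP qr(1) si
        by algebra
      also have "\<dots> = t [^]\<^bsub>P\<^esub> i \<otimes>\<^bsub>P\<^esub> (?m \<otimes>\<^bsub>P\<^esub> z \<ominus>\<^bsub>P\<^esub> q \<otimes>\<^bsub>P\<^esub> y)"
        unfolding y(2) z(2) using m y(1) z(1) qr(1) ti
        by (simp add: P.minus_eq P.r_distr P.r_minus P.m_ac)
      finally show ?thesis using m y(1) z(1) qr(1) by blast
    qed
    then show ?thesis using qr by (simp add: D_def)
  qed
  \<comment> \<open>The remainder is again a common denominator, of smaller degree than
    \<open>h\<close> unless it is zero. Minimality of \<open>h\<close> leaves only zero.\<close>
  then have "r = \<zero>\<^bsub>P\<^esub>" using r min[of r] by (metis Diff_iff not_less singletonD)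
  then have cg: "c \<odot>\<^bsub>P\<^esub> g = h \<otimes>\<^bsub>P\<^esub> q" using eq qr hP by (simp add: c_def)
  have m: "up_ring.monom P c 0 \<in> carrier P" using c by simp
  have "h \<otimes>\<^bsub>P\<^esub> (c \<odot>\<^bsub>P\<^esub> s) = up_ring.monom P c 0 \<otimes>\<^bsub>P\<^esub> (h \<otimes>\<^bsub>P\<^esub> s)"
    using c s hP m by (simp add: smult_eq_mult P.m_ac)
  also have "\<dots> = t \<otimes>\<^bsub>P\<^esub> (c \<odot>\<^bsub>P\<^esub> g)"
    unfolding g(2) using c g(1) t(1) m by (simp add: smult_eq_mult P.m_ac)
  also have "\<dots> = h \<otimes>\<^bsub>P\<^esub> (t \<otimes>\<^bsub>P\<^esub> q)"
    unfolding cg using hP t(1) qr(1) by (simp add: P.m_ac)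
  finally have "c \<odot>\<^bsub>P\<^esub> s = t \<otimes>\<^bsub>P\<^esub> q"
    using domain.m_lcancel[OF UP_domain h(2) hP] c s t qr by simp
  then show ?thesis using that c qr by blast
qed

text \<open>The points of \<open>N\<close> take the place of scalars of the field: interpolation
  only divides by their differences. This lets the coefficient ring itself be a polynomial
  ring.\<close>

lemma (in UP_domain) frac_closed_UP:
  assumes R: "frac_closed R"
    and N: "infinite N" "N \<subseteq> carrier R" "\<And>x y. \<lbrakk>x \<in> N; y \<in> N; x \<noteq> y\<rbrakk> \<Longrightarrow> x \<ominus> y \<in> Units R"
  shows "frac_closed P"
proof -
  have "\<exists>w\<in>carrier P. s = w \<otimes>\<^bsub>P\<^esub> t"
    if s: "s \<in> carrier P" and t: "t \<in> carrier P" "t \<noteq> \<zero>\<^bsub>P\<^esub>"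
      and d: "s [^]\<^bsub>P\<^esub> d \<in> lower_forms P s t d" for s t and d :: nat
  proof -
    obtain c q where c: "c \<in> carrier R" "c \<noteq> \<zero>" and q: "q \<in> carrier P"
      and eq: "c \<odot>\<^bsub>P\<^esub> s = t \<otimes>\<^bsub>P\<^esub> q"
      using pseudo_quotient[OF s t d] .
    let ?e = "UnivPoly.eval R R id"
    define Y where "Y = {x \<in> N. ?e x t \<noteq> \<zero>}"
    have "finite (N - Y)"
    proof (rule ccontr)
      assume "infinite (N - Y)"
      then obtain J where J: "J \<subseteq> N - Y" "finite J" "card J = Suc (deg R t)"
        by (meson infinite_arbitrarily_large)
      \<comment> \<open>Interpolation modulo the zero ideal: more zeros than its degree would force
        \<open>t\<close> to vanish.\<close>
      have "up_ring.coeff P t n \<in> {\<zero>}" for n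
        by (rule coeff_mem_ideal[OF R.zeroideal t(1) J(2)]) (use J N(2) in \<open>auto simp: Y_def intro!: N(3)\<close>)
      then have "t = \<zero>\<^bsub>P\<^esub>" using t(1) by (intro up_eqI) auto
      then show False using t by simp
    qed
    then have "infinite Y" using N(1) by (metis finite_Diff2)
    then obtain J where J: "J \<subseteq> Y" "finite J" "card J = Suc (deg R q)"
      by (meson infinite_arbitrarily_large)
    have "\<exists>w. w \<in> carrier R \<and> up_ring.coeff P q n = w \<otimes> c" for n
    proof -
      \<comment> \<open>Instead of interpolating \<open>q/c\<close> in the fraction field,
        \<open>q\<close> is interpolated modulo the ideal generated by \<open>c\<close>. At an
        admissible point \<open>s/t\<close> specialises to an integral fraction, hence to some
        \<open>w\<close> in \<open>R\<close>, and the value of \<open>q\<close> is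
        \<open>w \<otimes> c\<close>.\<close>
      have "up_ring.coeff P q n \<in> PIdl c"
      proof (rule coeff_mem_ideal[OF R.cgenideal_ideal[OF c(1)] q J(2)])
        fix x assume x: "x \<in> J"
        then have xR: "x \<in> carrier R" and tx: "?e x t \<noteq> \<zero>" using J N by (auto simp: Y_def)
        interpret e: ring_hom_cring P R "?e x" by (rule eval_UP_hom[OF xR])
        have "?e x s [^] d \<in> lower_forms R (?e x s) (?e x t) d"
          using e.hom_lower_forms[OF s t(1) d] s by simp
        then obtain w where w: "w \<in> carrier R" "?e x s = w \<otimes> ?e x t"
          using frac_closedD[OF R, of "?e x s" "?e x t" d] tx s t by auto
        have "?e x (c \<odot>\<^bsub>P\<^esub> s) = c \<otimes> ?e x s"
          using c s xR by (simp add: smult_eq_mult eval_UP_const)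
        then have "?e x t \<otimes> ?e x q = ?e x t \<otimes> (w \<otimes> c)"
          using w c s t q by (simp add: eq R.m_ac)
        then have "?e x q = w \<otimes> c" using R.m_lcancel tx t q w c by simp
        then show "?e x q \<in> PIdl c" using w by (auto simp: cgenideal_def)
      qed (use J N(2) in \<open>auto simp: Y_def intro!: N(3)\<close>)
      then show ?thesis by (auto simp: cgenideal_def)
    qed
    then obtain w where w: "\<And>n. w n \<in> carrier R" "\<And>n. up_ring.coeff P q n = w n \<otimes> c" by metis
    have "w \<in> carrier P"
    proof -
      \<comment> \<open>As \<open>c\<close> is not a zero divisor, the quotients vanish wherever the
        coefficients of \<open>q\<close> do; hence the sequence \<open>w\<close> is a
        polynomial.\<close>
      have "w n = \<zero>" if "n > deg R q" for n
        using deg_aboveD[OF that q] w[of n] c R.integral by metis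
      then show ?thesis using w(1) by (auto simp: P_def UP_def intro!: mem_upI exI[of _ "deg R q"] bound.intro)
    qed
    moreover have "q = c \<odot>\<^bsub>P\<^esub> w"
    proof (rule up_eqI)
      show "up_ring.coeff P q n = up_ring.coeff P (c \<odot>\<^bsub>P\<^esub> w) n" for n
      proof -
        have "up_ring.coeff P w n = w n" using \<open>w \<in> carrier P\<close> by (simp add: P_def UP_def)
        then show ?thesis using w[of n] c \<open>w \<in> carrier P\<close> by (simp add: R.m_comm)
      qed
    qed (use q c \<open>w \<in> carrier P\<close> in auto)
    moreover have "up_ring.monom P c 0 \<noteq> \<zero>\<^bsub>P\<^esub>"
      using c by (metis coeff_monom coeff_zero)
    moreover have "up_ring.monom P c 0 \<in> carrier P" using c by simp
    moreover have "up_ring.monom P c 0 \<otimes>\<^bsub>P\<^esub> s = up_ring.monom P c 0 \<otimes>\<^bsub>P\<^esub> (w \<otimes>\<^bsub>P\<^esub> t)"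
      using eq calculation s t c by (simp add: smult_eq_mult P.m_ac)
    ultimately have "s = w \<otimes>\<^bsub>P\<^esub> t"
      using domain.m_lcancel[OF UP_domain, of "up_ring.monom P c 0" s "w \<otimes>\<^bsub>P\<^esub> t"] s t(1) by simp
    then show ?thesis using \<open>w \<in> carrier P\<close> by blast
  qed
  then show ?thesis unfolding frac_closed_def using UP_domain by blast
qed

section \<open>Free modules and monoid algebras\<close>


text \<open>The common shape of linear and bilinear extensions, of lifts from the free space to a
  module, and of the passage from polynomials to tensors. The sum is formed in \<open>G\<close>,
  which need not be the coefficient ring.\<close>

definition supp_sum ::
    "('k, 'x) ring_scheme \<Rightarrow> ('g, 'y) ring_scheme \<Rightarrow> ('s \<Rightarrow> 'k \<Rightarrow> 'g) \<Rightarrow> ('s \<Rightarrow> 'k) \<Rightarrow> 'g" where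
  "supp_sum K G h x = (\<Oplus>\<^bsub>G\<^esub> s \<in> fun_supp K x. h s (x s))"

definition free_single :: "('k, 'x) ring_scheme \<Rightarrow> 's \<Rightarrow> 'k \<Rightarrow> 's \<Rightarrow> 'k" where
  "free_single K s c = (\<lambda>t. if t = s then c else \<zero>\<^bsub>K\<^esub>)"

lemma free_unit_eq_single: "free_unit K s = free_single K s \<one>\<^bsub>K\<^esub>"
  by (simp add: free_unit_def free_single_def)

lemma (in abelian_monoid) hom_finsum:
  assumes "finite A" "f \<in> A \<rightarrow> carrier G" "\<phi> \<zero> = \<zero>"
    "\<And>a b. \<lbrakk>a \<in> carrier G; b \<in> carrier G\<rbrakk> \<Longrightarrow> \<phi> (a \<oplus> b) = \<phi> a \<oplus> \<phi> b"
    "\<And>a. a \<in> carrier G \<Longrightarrow> \<phi> a \<in> carrier G"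
  shows "\<phi> (finsum G f A) = finsum G (\<lambda>a. \<phi> (f a)) A"
  using assms(1,2)
proof (induction A rule: finite_induct)
  case (insert a A)
  then have "f \<in> A \<rightarrow> carrier G" "f a \<in> carrier G" "(\<lambda>a. \<phi> (f a)) \<in> A \<rightarrow> carrier G"
    using assms(5) by auto
  then show ?case using insert assms(4,5) by simp
qed (simp add: assms(3))

section \<open>Sums over finite supports\<close>

locale additive_family = K?: ring K + G?: abelian_group G
  for K (structure) and G (structure) +
  fixes S :: "'s set" and h
  assumes h_closed: "\<lbrakk>s \<in> S; c \<in> carrier K\<rbrakk> \<Longrightarrow> h s c \<in> carrier G"
    and h_add: "\<lbrakk>s \<in> S; c \<in> carrier K; d \<in> carrier K\<rbrakk> \<Longrightarrow> h s (c \<oplus> d) = h s c \<oplus>\<^bsub>G\<^esub> h s d"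
begin

lemma h_zero: "s \<in> S \<Longrightarrow> h s \<zero> = \<zero>\<^bsub>G\<^esub>"
  using h_add[of s \<zero> \<zero>] h_closed[of s \<zero>] by (metis G.add.r_cancel_one' K.r_zero K.zero_closed)

text \<open>Supports may shrink by cancellation when functions are added. Extra points contribute
  zero by \<open>h_zero\<close>, so sums of several functions can be compared over one common finite
  set.\<close>

lemma supp_sum_superset:
  assumes "x \<in> free_carrier K S" "finite A" "fun_supp K x \<subseteq> A" "A \<subseteq> S"
  shows "supp_sum K G h x = (\<Oplus>\<^bsub>G\<^esub> s \<in> A. h s (x s))"
  unfolding supp_sum_def
proof (rule G.add.finprod_mono_neutral_cong_left)
  show "h i (x i) = \<zero>\<^bsub>G\<^esub>" if "i \<in> A - fun_supp K x" for i
    using that assms h_zero[of i] by (auto simp: fun_supp_def)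
  show "(\<lambda>s. h s (x s)) \<in> A \<rightarrow> carrier G"
    using assms by (auto simp: free_carrier_def image_subset_iff intro!: h_closed)
qed (use assms in auto)

lemma supp_sum_closed: "x \<in> free_carrier K S \<Longrightarrow> supp_sum K G h x \<in> carrier G"
  unfolding supp_sum_def by (intro G.finsum_closed) (auto simp: free_carrier_def image_subset_iff intro!: h_closed)

lemma supp_sum_add:
  assumes "x \<in> free_carrier K S" "y \<in> free_carrier K S"
  shows "supp_sum K G h (\<lambda>s. x s \<oplus> y s) = supp_sum K G h x \<oplus>\<^bsub>G\<^esub> supp_sum K G h y"
proof -
  let ?A = "fun_supp K x \<union> fun_supp K y"
  have A: "finite ?A" "?A \<subseteq> S" using assms by (auto simp: free_carrier_def image_subset_iff)
  have xy: "fun_supp K (\<lambda>s. x s \<oplus> y s) \<subseteq> ?A" by (auto simp: fun_supp_def)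
  then have c: "(\<lambda>s. x s \<oplus> y s) \<in> free_carrier K S"
    using assms A by (auto simp: free_carrier_def image_subset_iff intro: finite_subset)
  have "supp_sum K G h (\<lambda>s. x s \<oplus> y s) = (\<Oplus>\<^bsub>G\<^esub> s \<in> ?A. h s (x s \<oplus> y s))"
    by (rule supp_sum_superset) (use c A xy in auto)
  also have "\<dots> = (\<Oplus>\<^bsub>G\<^esub> s \<in> ?A. h s (x s) \<oplus>\<^bsub>G\<^esub> h s (y s))"
    using assms A by (intro G.finsum_cong') (auto simp: free_carrier_def image_subset_iff intro!: h_closed h_add G.a_closed)
  also have "\<dots> = (\<Oplus>\<^bsub>G\<^esub> s \<in> ?A. h s (x s)) \<oplus>\<^bsub>G\<^esub> (\<Oplus>\<^bsub>G\<^esub> s \<in> ?A. h s (y s))"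
    using assms A by (intro G.finsum_addf) (auto simp: free_carrier_def image_subset_iff intro!: h_closed)
  also have "\<dots> = supp_sum K G h x \<oplus>\<^bsub>G\<^esub> supp_sum K G h y"
    using assms A by (simp add: supp_sum_superset[of x ?A] supp_sum_superset[of y ?A])
  finally show ?thesis .
qed

lemma supp_sum_single:
  assumes "s \<in> S" "c \<in> carrier K"
  shows "supp_sum K G h (free_single K s c) = h s c"
proof -
  have "free_single K s c \<in> free_carrier K S" "fun_supp K (free_single K s c) \<subseteq> {s}"
    using assms by (auto simp: free_carrier_def image_subset_iff free_single_def fun_supp_def
        intro: finite_subset[of _ "{s}"])
  then show ?thesis
    using assms h_closed
    by (subst supp_sum_superset[of _ "{s}"]) (auto simp: free_single_def)
qed

text \<open>With multiplication by a scalar as both \<open>\<psi>\<close> and \<open>\<phi>\<close>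
  this is homogeneity of the extended map.\<close>

lemma supp_sum_hom:
  assumes x: "x \<in> free_carrier K S"
    and \<phi>: "\<And>a b. \<lbrakk>a \<in> carrier G; b \<in> carrier G\<rbrakk> \<Longrightarrow> \<phi> (a \<oplus>\<^bsub>G\<^esub> b) = \<phi> a \<oplus>\<^bsub>G\<^esub> \<phi> b"
      "\<And>a. a \<in> carrier G \<Longrightarrow> \<phi> a \<in> carrier G"
    and \<psi>: "\<psi> \<zero> = \<zero>" "\<And>k. k \<in> carrier K \<Longrightarrow> \<psi> k \<in> carrier K"
    and eq: "\<And>s k. \<lbrakk>s \<in> S; k \<in> carrier K\<rbrakk> \<Longrightarrow> h s (\<psi> k) = \<phi> (h s k)"
  shows "supp_sum K G h (\<lambda>s. \<psi> (x s)) = \<phi> (supp_sum K G h x)"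
proof -
  let ?A = "fun_supp K x"
  have A: "finite ?A" "?A \<subseteq> S" using x by (auto simp: free_carrier_def image_subset_iff)
  have sub: "fun_supp K (\<lambda>s. \<psi> (x s)) \<subseteq> ?A" using \<psi>(1) by (auto simp: fun_supp_def)
  then have c: "(\<lambda>s. \<psi> (x s)) \<in> free_carrier K S"
    using x \<psi>(2) A by (auto simp: free_carrier_def image_subset_iff intro: finite_subset)
  have "\<phi> \<zero>\<^bsub>G\<^esub> = \<zero>\<^bsub>G\<^esub>" using \<phi> by (metis G.add.r_cancel_one' G.r_zero G.zero_closed)
  then have "\<phi> (\<Oplus>\<^bsub>G\<^esub> s \<in> ?A. h s (x s)) = (\<Oplus>\<^bsub>G\<^esub> s \<in> ?A. \<phi> (h s (x s)))"
    using x A \<phi> by (intro G.hom_finsum) (auto simp: free_carrier_def image_subset_iff intro!: h_closed)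
  also have "\<dots> = (\<Oplus>\<^bsub>G\<^esub> s \<in> ?A. h s (\<psi> (x s)))"
    using x A \<psi>(2) by (intro G.finsum_cong') (auto simp: free_carrier_def image_subset_iff subset_iff eq intro!: h_closed)
  also have "\<dots> = supp_sum K G h (\<lambda>s. \<psi> (x s))"
    using c A sub by (simp add: supp_sum_superset[of _ ?A])
  finally show ?thesis using x A by (simp add: supp_sum_superset[of x ?A])
qed

end

section \<open>Finitely supported functions\<close>

context ring
begin

lemma free_carrierD:
  assumes "x \<in> free_carrier R S"
  shows "x s \<in> carrier R" "finite (fun_supp R x)" "fun_supp R x \<subseteq> S" "s \<notin> S \<Longrightarrow> x s = \<zero>"
  using assms by (auto simp: free_carrier_def image_subset_iff fun_supp_def)

lemma free_single_closed: "\<lbrakk>s \<in> S; c \<in> carrier R\<rbrakk> \<Longrightarrow> free_single R s c \<in> free_carrier R S"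
  by (auto simp: free_carrier_def image_subset_iff free_single_def fun_supp_def intro: finite_subset[of _ "{s}"])

lemma free_zero_closed: "(\<lambda>_. \<zero>) \<in> free_carrier R S"
  by (auto simp: free_carrier_def image_subset_iff fun_supp_def)

lemma free_add_closed:
  assumes "x \<in> free_carrier R S" "y \<in> free_carrier R S"
  shows "(\<lambda>s. x s \<oplus> y s) \<in> free_carrier R S"
proof -
  have "fun_supp R (\<lambda>s. x s \<oplus> y s) \<subseteq> fun_supp R x \<union> fun_supp R y" by (auto simp: fun_supp_def)
  then show ?thesis using assms by (auto simp: free_carrier_def image_subset_iff intro: finite_subset)
qed

lemma free_map_closed:
  assumes "x \<in> free_carrier R S" "f \<zero> = \<zero>" "\<And>c. c \<in> carrier R \<Longrightarrow> f c \<in> carrier R"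
  shows "(\<lambda>s. f (x s)) \<in> free_carrier R S"
proof -
  have "fun_supp R (\<lambda>s. f (x s)) \<subseteq> fun_supp R x" using assms(2) by (auto simp: fun_supp_def)
  then show ?thesis using assms by (auto simp: free_carrier_def image_subset_iff intro: finite_subset)
qed

text \<open>Induction on a finite set that contains the support, splitting off the value at one
  point. Additive statements about free spaces are thereby reduced to multiples of one basis
  element.\<close>

lemma free_induct [consumes 1, case_names zero single add]:
  assumes x: "x \<in> free_carrier R S"
    and "P (\<lambda>_. \<zero>)"
    and "\<And>s c. \<lbrakk>s \<in> S; c \<in> carrier R\<rbrakk> \<Longrightarrow> P (free_single R s c)"
    and "\<And>x y. \<lbrakk>x \<in> free_carrier R S; y \<in> free_carrier R S; P x; P y\<rbrakk> \<Longrightarrow> P (\<lambda>s. x s \<oplus> y s)"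
  shows "P x"
proof -
  have "P x" if "finite A" "fun_supp R x \<subseteq> A" "x \<in> free_carrier R S" for A x
    using that
  proof (induction A arbitrary: x rule: finite_induct)
    case empty
    then have "x = (\<lambda>_. \<zero>)" by (auto simp: fun_supp_def)
    then show ?case using assms(2) by simp
  next
    case (insert s A)
    show ?case
    proof (cases "x s = \<zero>")
      case True
      then have "fun_supp R x \<subseteq> A" using insert.prems(1) by (auto simp: fun_supp_def)
      then show ?thesis using insert by blast
    next
      case False
      then have s: "s \<in> S" using insert.prems(2) by (auto simp: free_carrier_def image_subset_iff fun_supp_def)
      define y where "y = x(s := \<zero>)"
      have sub: "fun_supp R y \<subseteq> fun_supp R x - {s}" by (auto simp: fun_supp_def y_def)
      moreover have "y t \<in> carrier R" for t
        using free_carrierD(1)[OF insert.prems(2)] by (simp add: y_def)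
      ultimately have y: "y \<in> free_carrier R S"
        using insert.prems(2) by (auto simp: free_carrier_def image_subset_iff intro: finite_subset)
      have "x = (\<lambda>t. free_single R s (x s) t \<oplus> y t)"
        using free_carrierD(1)[OF insert.prems(2)] by (auto simp: free_single_def fun_eq_iff y_def)
      moreover have "P (\<lambda>t. free_single R s (x s) t \<oplus> y t)"
        using assms(3)[OF s] y insert.IH[OF _ y] sub insert.prems free_carrierD(1)[OF insert.prems(2)]
        by (intro assms(4) free_single_closed) (auto intro: s)
      ultimately show ?thesis by metis
    qed
  qed
  then show ?thesis using x by (auto simp: free_carrier_def image_subset_iff)
qed

end

section \<open>Bilinear extension from basis elements\<close>

locale bilinear_family = K?: cring K for K :: "('k, 'x) ring_scheme" (structure) +
  fixes S :: "'s set" and T :: "'t set" and \<beta> :: "'s \<Rightarrow> 's \<Rightarrow> 't \<Rightarrow> 'k"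
  assumes \<beta>_closed: "\<lbrakk>s \<in> S; t \<in> S\<rbrakk> \<Longrightarrow> \<beta> s t \<in> free_carrier K T"
begin

lemma \<beta>_in: "\<lbrakk>s \<in> S; t \<in> S\<rbrakk> \<Longrightarrow> \<beta> s t u \<in> carrier K"
  using free_carrierD(1)[OF \<beta>_closed] .

lemma additive_inner:
  "\<lbrakk>s \<in> S; a \<in> carrier K\<rbrakk> \<Longrightarrow> additive_family K K S (\<lambda>t c. a \<otimes> c \<otimes> \<beta> s t u)"
  by unfold_locales (simp_all add: \<beta>_in l_distr r_distr)

text \<open>Two readings of the same double sum: exposing the inner sum gives additivity in the
  second argument, exposing both gives additivity in the first.\<close>

lemma bilin_ext_inner:
  "bilin_ext K \<beta> x y u = (\<Oplus> s \<in> fun_supp K x. supp_sum K K (\<lambda>t c. x s \<otimes> c \<otimes> \<beta> s t u) y)"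
  by (simp add: bilin_ext_def supp_sum_def)

lemma bilin_ext_outer:
  "bilin_ext K \<beta> x y u = supp_sum K K (\<lambda>s c. supp_sum K K (\<lambda>t d. c \<otimes> d \<otimes> \<beta> s t u) y) x"
  by (simp add: bilin_ext_def supp_sum_def)

lemma additive_outer:
  assumes y: "y \<in> free_carrier K S"
  shows "additive_family K K S (\<lambda>s c. supp_sum K K (\<lambda>t d. c \<otimes> d \<otimes> \<beta> s t u) y)"
proof unfold_locales
  fix s c assume s: "s \<in> S" and c: "c \<in> carrier K"
  show "supp_sum K K (\<lambda>t d. c \<otimes> d \<otimes> \<beta> s t u) y \<in> carrier K"
    by (rule additive_family.supp_sum_closed[OF additive_inner[OF s c] y])
  fix d assume d: "d \<in> carrier K"
  show "supp_sum K K (\<lambda>t e. (c \<oplus> d) \<otimes> e \<otimes> \<beta> s t u) y =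
      supp_sum K K (\<lambda>t e. c \<otimes> e \<otimes> \<beta> s t u) y \<oplus> supp_sum K K (\<lambda>t e. d \<otimes> e \<otimes> \<beta> s t u) y"
  proof -
    have y': "y t \<in> carrier K" "t \<in> fun_supp K y \<Longrightarrow> t \<in> S" for t
      using y by (auto simp: free_carrier_def)
    have "supp_sum K K (\<lambda>t e. (c \<oplus> d) \<otimes> e \<otimes> \<beta> s t u) y =
        (\<Oplus> t \<in> fun_supp K y. c \<otimes> y t \<otimes> \<beta> s t u \<oplus> d \<otimes> y t \<otimes> \<beta> s t u)"
      unfolding supp_sum_def using y' s c d by (intro finsum_cong') (auto simp: \<beta>_in l_distr)
    also have "\<dots> = supp_sum K K (\<lambda>t e. c \<otimes> e \<otimes> \<beta> s t u) y \<oplus> supp_sum K K (\<lambda>t e. d \<otimes> e \<otimes> \<beta> s t u) y"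
      unfolding supp_sum_def using y' s c d by (intro finsum_addf) (auto simp: \<beta>_in)
    finally show ?thesis .
  qed
qed

lemma bilin_ext_single:
  assumes "s \<in> S" "t \<in> S" "c \<in> carrier K" "d \<in> carrier K"
  shows "bilin_ext K \<beta> (free_single K s c) (free_single K t d) = (\<lambda>u. c \<otimes> d \<otimes> \<beta> s t u)"
proof
  fix u
  show "bilin_ext K \<beta> (free_single K s c) (free_single K t d) u = c \<otimes> d \<otimes> \<beta> s t u"
    unfolding bilin_ext_outer
      additive_family.supp_sum_single[OF additive_outer[OF free_single_closed[OF assms(2,4)]] assms(1,3)]
    by (rule additive_family.supp_sum_single[OF additive_inner[OF assms(1,3)] assms(2,4)])
qed

lemma bilin_ext_closed:
  assumes x: "x \<in> free_carrier K S" and y: "y \<in> free_carrier K S"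
  shows "bilin_ext K \<beta> x y \<in> free_carrier K T"
proof -
  have "bilin_ext K \<beta> x y u \<in> carrier K" for u
    unfolding bilin_ext_outer by (rule additive_family.supp_sum_closed[OF additive_outer[OF y] x])
  moreover have sub: "fun_supp K (bilin_ext K \<beta> x y) \<subseteq>
      (\<Union>s\<in>fun_supp K x. \<Union>t\<in>fun_supp K y. fun_supp K (\<beta> s t))" (is "_ \<subseteq> ?U")
  proof
    fix u assume u: "u \<in> fun_supp K (bilin_ext K \<beta> x y)"
    show "u \<in> ?U"
    proof (rule ccontr)
      assume nu: "u \<notin> ?U"
      have "\<beta> s t u = \<zero>" if "s \<in> fun_supp K x" "t \<in> fun_supp K y" for s t
      proof -
        have "u \<notin> fun_supp K (\<beta> s t)" using nu that by blast
        then show ?thesis by (simp add: fun_supp_def)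
      qed
      then have "bilin_ext K \<beta> x y u = \<zero>"
        unfolding bilin_ext_def
      proof (intro add.finprod_one_eqI)
        fix s t assume "s \<in> fun_supp K x" "t \<in> fun_supp K y"
        then show "x s \<otimes> y t \<otimes> \<beta> s t u = \<zero>"
          using \<open>\<And>s t. \<lbrakk>s \<in> fun_supp K x; t \<in> fun_supp K y\<rbrakk> \<Longrightarrow> \<beta> s t u = \<zero>\<close>
            free_carrierD(1)[OF x, of s] free_carrierD(1)[OF y, of t] by simp
      qed
      then show False using u by (simp add: fun_supp_def)
    qed
  qed
  moreover have "finite ?U"
    using free_carrierD(2,3)[OF x] free_carrierD(2,3)[OF y] free_carrierD(2)[OF \<beta>_closed]
    by (intro finite_UN_I) auto
  moreover have "?U \<subseteq> T"
    using free_carrierD(3)[OF x] free_carrierD(3)[OF y] free_carrierD(3)[OF \<beta>_closed]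
    by (intro UN_least) (meson subsetD)
  ultimately show ?thesis by (auto simp: free_carrier_def image_subset_iff intro: finite_subset)
qed

lemma bilin_ext_add_left:
  assumes "x \<in> free_carrier K S" "y \<in> free_carrier K S" "z \<in> free_carrier K S"
  shows "bilin_ext K \<beta> (\<lambda>s. x s \<oplus> y s) z = (\<lambda>u. bilin_ext K \<beta> x z u \<oplus> bilin_ext K \<beta> y z u)"
  unfolding bilin_ext_outer using assms
  by (simp add: additive_family.supp_sum_add[OF additive_outer])

lemma bilin_ext_add_right:
  assumes "x \<in> free_carrier K S" "y \<in> free_carrier K S" "z \<in> free_carrier K S"
  shows "bilin_ext K \<beta> z (\<lambda>s. x s \<oplus> y s) = (\<lambda>u. bilin_ext K \<beta> z x u \<oplus> bilin_ext K \<beta> z y u)"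
proof
  fix u
  have z: "z s \<in> carrier K" "s \<in> fun_supp K z \<Longrightarrow> s \<in> S" for s
    using assms(3) by (auto simp: free_carrier_def image_subset_iff)
  note ai = additive_inner[of s "z s" u for s]
  have "bilin_ext K \<beta> z (\<lambda>s. x s \<oplus> y s) u = (\<Oplus> s \<in> fun_supp K z.
      supp_sum K K (\<lambda>t c. z s \<otimes> c \<otimes> \<beta> s t u) x \<oplus> supp_sum K K (\<lambda>t c. z s \<otimes> c \<otimes> \<beta> s t u) y)"
    unfolding bilin_ext_inner
    by (intro finsum_cong') (use assms z additive_family.supp_sum_add[OF ai]
        additive_family.supp_sum_closed[OF ai] in auto)
  also have "\<dots> = bilin_ext K \<beta> z x u \<oplus> bilin_ext K \<beta> z y u"
    unfolding bilin_ext_inner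
    by (intro finsum_addf) (use assms z additive_family.supp_sum_closed[OF ai] in auto)
  finally show "bilin_ext K \<beta> z (\<lambda>s. x s \<oplus> y s) u = bilin_ext K \<beta> z x u \<oplus> bilin_ext K \<beta> z y u" .
qed

lemma bilin_ext_smult_left:
  assumes "x \<in> free_carrier K S" "y \<in> free_carrier K S" "c \<in> carrier K"
  shows "bilin_ext K \<beta> (\<lambda>s. c \<otimes> x s) y = (\<lambda>u. c \<otimes> bilin_ext K \<beta> x y u)"
proof
  fix u
  show "bilin_ext K \<beta> (\<lambda>s. c \<otimes> x s) y u = c \<otimes> bilin_ext K \<beta> x y u"
    unfolding bilin_ext_outer
  proof (rule additive_family.supp_sum_hom[OF additive_outer[OF assms(2)] assms(1)])
    fix s k assume sk: "s \<in> S" "k \<in> carrier K"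
    show "supp_sum K K (\<lambda>t d. (c \<otimes> k) \<otimes> d \<otimes> \<beta> s t u) y =
        c \<otimes> supp_sum K K (\<lambda>t d. k \<otimes> d \<otimes> \<beta> s t u) y"
      unfolding supp_sum_def using assms sk
      by (subst finsum_rdistr)
        (auto simp: free_carrier_def image_subset_iff subset_iff \<beta>_in m_assoc intro!: finsum_cong')
  qed (use assms(3) in \<open>auto simp: r_distr\<close>)
qed

lemma bilin_ext_zero:
  "bilin_ext K \<beta> (\<lambda>_. \<zero>) y = (\<lambda>_. \<zero>)" "bilin_ext K \<beta> y (\<lambda>_. \<zero>) = (\<lambda>_. \<zero>)"
  by (simp_all add: bilin_ext_def fun_supp_def)

end

section \<open>Monoid algebras are commutative algebras\<close>

locale monoid_alg = K?: cring K + M?: comm_monoid M for K (structure) and M (structure) +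
  fixes A (structure)
  defines A_def: "A \<equiv> monoid_algebra K M"
begin

lemma alg_simps:
  "carrier A = free_carrier K (carrier M)" "\<zero>\<^bsub>A\<^esub> = (\<lambda>_. \<zero>)" "x \<oplus>\<^bsub>A\<^esub> y = (\<lambda>s. x s \<oplus> y s)"
  "c \<odot>\<^bsub>A\<^esub> x = (\<lambda>s. c \<otimes> x s)" "\<one>\<^bsub>A\<^esub> = free_single K \<one>\<^bsub>M\<^esub> \<one>"
  by (simp_all add: A_def monoid_algebra_def free_unit_eq_single)

sublocale mult: bilinear_family K "carrier M" "carrier M" "\<lambda>s t. free_unit K (s \<otimes>\<^bsub>M\<^esub> t)"
  by unfold_locales (simp add: free_unit_eq_single free_single_closed)

lemma alg_mult: "x \<otimes>\<^bsub>A\<^esub> y = bilin_ext K (\<lambda>s t. free_unit K (s \<otimes>\<^bsub>M\<^esub> t)) x y"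
  by (simp add: A_def monoid_algebra_def)

lemma single_mult:
  "\<lbrakk>s \<in> carrier M; t \<in> carrier M; c \<in> carrier K; d \<in> carrier K\<rbrakk> \<Longrightarrow>
    free_single K s c \<otimes>\<^bsub>A\<^esub> free_single K t d = free_single K (s \<otimes>\<^bsub>M\<^esub> t) (c \<otimes> d)"
  unfolding alg_mult by (simp add: mult.bilin_ext_single) (auto simp: free_unit_def free_single_def)

lemmas mult_distr = mult.bilin_ext_add_left[folded alg_mult] mult.bilin_ext_add_right[folded alg_mult]
lemmas mult_zero = mult.bilin_ext_zero[folded alg_mult]
lemmas mult_closed' = mult.bilin_ext_closed[folded alg_mult]

lemma mult_assoc':
  assumes "x \<in> free_carrier K (carrier M)" "y \<in> free_carrier K (carrier M)" "z \<in> free_carrier K (carrier M)"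
  shows "x \<otimes>\<^bsub>A\<^esub> y \<otimes>\<^bsub>A\<^esub> z = x \<otimes>\<^bsub>A\<^esub> (y \<otimes>\<^bsub>A\<^esub> z)"
  using assms(1)
proof (induction rule: K.free_induct)
  case (single s c)
  show ?case using assms(2)
  proof (induction rule: K.free_induct)
    case (single t d)
    show ?case using assms(3)
    proof (induction rule: K.free_induct)
      case (single u e)
      then show ?case using \<open>s \<in> carrier M\<close> \<open>c \<in> carrier K\<close> \<open>t \<in> carrier M\<close> \<open>d \<in> carrier K\<close>
        by (simp add: single_mult M.m_assoc K.m_assoc)
    qed (use \<open>s \<in> carrier M\<close> \<open>c \<in> carrier K\<close> \<open>t \<in> carrier M\<close> \<open>d \<in> carrier K\<close> in
        \<open>simp_all add: mult_zero mult_distr mult_closed' free_single_closed\<close>)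
  qed (use \<open>s \<in> carrier M\<close> \<open>c \<in> carrier K\<close> assms(3) in
      \<open>simp_all add: mult_zero mult_distr mult_closed' free_single_closed\<close>)
qed (use assms in \<open>simp_all add: mult_zero mult_distr mult_closed'\<close>)

lemma mult_comm':
  assumes "x \<in> free_carrier K (carrier M)" "y \<in> free_carrier K (carrier M)"
  shows "x \<otimes>\<^bsub>A\<^esub> y = y \<otimes>\<^bsub>A\<^esub> x"
  using assms(1)
proof (induction rule: K.free_induct)
  case (single s c)
  show ?case using assms(2)
  proof (induction rule: K.free_induct)
    case (single t d)
    then show ?case using \<open>s \<in> carrier M\<close> \<open>c \<in> carrier K\<close>
      by (simp add: single_mult M.m_comm K.m_comm)
  qed (use \<open>s \<in> carrier M\<close> \<open>c \<in> carrier K\<close> in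
      \<open>simp_all add: mult_zero mult_distr free_single_closed\<close>)
qed (use assms in \<open>simp_all add: mult_zero mult_distr\<close>)

lemma mult_one':
  assumes "x \<in> free_carrier K (carrier M)"
  shows "free_single K \<one>\<^bsub>M\<^esub> \<one> \<otimes>\<^bsub>A\<^esub> x = x"
  using assms
proof (induction rule: K.free_induct)
  case (single s c)
  then show ?case by (simp add: single_mult)
qed (simp_all add: mult_zero mult_distr free_single_closed)

lemma alg_abelian_group: "abelian_group A"
proof (rule abelian_groupI)
  fix x assume x: "x \<in> carrier A"
  then show "\<exists>y\<in>carrier A. y \<oplus>\<^bsub>A\<^esub> x = \<zero>\<^bsub>A\<^esub>"
    by (intro bexI[of _ "\<lambda>s. \<ominus> x s"])
      (auto simp: alg_simps fun_eq_iff K.l_neg free_carrierD(1) intro!: K.free_map_closed[of _ _ "\<lambda>c. \<ominus> c"])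
qed (auto simp: alg_simps fun_eq_iff free_add_closed free_zero_closed free_carrierD(1) K.a_ac)

lemma alg_cring: "cring A"
proof (rule cringI[OF alg_abelian_group])
  show "comm_monoid A"
    by (rule comm_monoidI)
      (auto simp: alg_simps mult_closed' mult_one' free_single_closed intro: mult_assoc' mult_comm')
qed (auto simp: alg_simps mult_distr)

lemma alg_algebra: "algebra K A"
proof (rule algebraI[OF K.is_cring alg_cring])
  fix a x y assume a: "a \<in> carrier K" and x: "x \<in> carrier A" and y: "y \<in> carrier A"
  show "a \<odot>\<^bsub>A\<^esub> x \<otimes>\<^bsub>A\<^esub> y = a \<odot>\<^bsub>A\<^esub> (x \<otimes>\<^bsub>A\<^esub> y)"
    unfolding alg_simps(4) alg_mult
    by (rule mult.bilin_ext_smult_left[OF x[unfolded alg_simps] y[unfolded alg_simps] a])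
next
  fix a x assume "a \<in> carrier K" "x \<in> carrier A"
  then show "a \<odot>\<^bsub>A\<^esub> x \<in> carrier A"
    by (auto simp: alg_simps intro!: K.free_map_closed[of _ _ "\<lambda>c. a \<otimes> c"])
qed (auto simp: alg_simps fun_eq_iff free_carrierD(1) K.l_distr K.r_distr K.m_assoc)

end

section \<open>Polynomials in several variables\<close>


lemma monomials_comm_monoid: "comm_monoid (monomials n)"
  by (rule comm_monoidI) (auto simp: monomials_def)

lemma carrier_monomials: "m \<in> carrier (monomials n) \<longleftrightarrow> set_mset m \<subseteq> {1..n}"
  by (simp add: monomials_def)

lemma monom_split:
  fixes m :: "nat multiset"
  shows "m = filter_mset (\<lambda>i. i \<noteq> v) m + replicate_mset (count m v) v"
  by (intro multiset_eqI) (auto simp: count_eq_zero_iff)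

lemma (in ring_hom_cring) hom_unit_diff:
  assumes "x \<in> carrier R" "y \<in> carrier R" "x \<ominus>\<^bsub>R\<^esub> y \<in> Units R"
  shows "h x \<ominus>\<^bsub>S\<^esub> h y \<in> Units S"
proof -
  let ?u = "x \<ominus>\<^bsub>R\<^esub> y"
  have "h (inv\<^bsub>R\<^esub> ?u) \<otimes>\<^bsub>S\<^esub> h ?u = \<one>\<^bsub>S\<^esub>"
    using assms by (metis R.Units_closed R.Units_inv_closed R.Units_l_inv hom_mult hom_one)
  then have "h ?u \<in> Units S"
    using assms S.m_comm[of "h (inv\<^bsub>R\<^esub> ?u)" "h ?u"]
    by (auto simp: Units_def[of S] intro!: bexI[of _ "h (inv\<^bsub>R\<^esub> ?u)"])
  then show ?thesis using assms by (simp add: R.minus_eq S.minus_eq)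
qed

text \<open>A substitute for containing an infinite field, in the form that interpolation uses. It
  is inherited along injective homomorphisms, and so by polynomial rings via their
  constants.\<close>

definition unit_separated :: "('a, 'm) ring_scheme \<Rightarrow> bool" where
  "unit_separated R \<longleftrightarrow> (\<exists>N\<subseteq>carrier R. infinite N \<and>
     (\<forall>x\<in>N. \<forall>y\<in>N. x \<noteq> y \<longrightarrow> x \<ominus>\<^bsub>R\<^esub> y \<in> Units R))"

lemma (in ring_hom_cring) unit_separated_hom:
  assumes "unit_separated R" "inj_on h (carrier R)"
  shows "unit_separated S"
proof -
  obtain N where N: "N \<subseteq> carrier R" "infinite N"
    "\<And>x y. \<lbrakk>x \<in> N; y \<in> N; x \<noteq> y\<rbrakk> \<Longrightarrow> x \<ominus>\<^bsub>R\<^esub> y \<in> Units R"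
    using assms(1) unfolding unit_separated_def by blast
  have "infinite (h ` N)"
    using N assms(2) by (meson finite_imageD inj_on_subset)
  moreover have "h ` N \<subseteq> carrier S" using N by auto
  moreover have "x \<ominus>\<^bsub>S\<^esub> y \<in> Units S" if "x \<in> h ` N" "y \<in> h ` N" "x \<noteq> y" for x y
  proof -
    obtain a b where ab: "a \<in> N" "b \<in> N" "a \<noteq> b" and xy: "x = h a" "y = h b"
      using \<open>x \<in> h ` N\<close> \<open>y \<in> h ` N\<close> \<open>x \<noteq> y\<close> by blast
    show ?thesis unfolding xy using ab N(1) by (intro hom_unit_diff N(3)) auto
  qed
  ultimately show ?thesis unfolding unit_separated_def by blast
qed

section \<open>Separating off the last variable\<close>

locale poly_step = B?: cring B for B (structure) +
  fixes n :: nat and C D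
  defines C_def: "C \<equiv> monoid_algebra B (monomials n)"
    and D_def: "D \<equiv> monoid_algebra B (monomials (Suc n))"
begin

text \<open>Regards \<open>x\<close> as a polynomial in the last variable; the result at
  \<open>k\<close> is the coefficient of its \<open>k\<close>-th power. The value zero on monomials
  outside the first \<open>n\<close> variables keeps this coefficient in the carrier of
  \<open>C\<close>.\<close>

definition split_last where
  "split_last x = (\<lambda>k m. if set_mset m \<subseteq> {1..n} then x (m + replicate_mset k (Suc n)) else \<zero>)"

sublocale C: monoid_alg B "monomials n" C
  unfolding C_def by (intro monoid_alg.intro B.is_cring monomials_comm_monoid)
sublocale D: monoid_alg B "monomials (Suc n)" D
  unfolding D_def by (intro monoid_alg.intro B.is_cring monomials_comm_monoid)
sublocale CC: cring C by (rule C.alg_cring)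
sublocale DD: cring D by (rule D.alg_cring)
sublocale P: UP_cring C "UP C" by unfold_locales

lemma split_last_closed:
  assumes x: "x \<in> carrier D"
  shows "split_last x \<in> carrier (UP C)"
proof -
  have x': "x \<in> free_carrier B (carrier (monomials (Suc n)))" using x by (simp add: D.alg_simps)
  note xc = B.free_carrierD(1)[OF x'] and fin = B.free_carrierD(2)[OF x']
  have "split_last x k \<in> carrier C" for k
  proof -
    \<comment> \<open>Multiplying by the \<open>k\<close>-th power of the last variable embeds the
      support of the \<open>k\<close>-th coefficient into the finite support of
      \<open>x\<close>.\<close>
    have "(\<lambda>m. m + replicate_mset k (Suc n)) ` fun_supp B (split_last x k) \<subseteq> fun_supp B x"
      by (auto simp: fun_supp_def split_last_def split: if_splits)
    then have "finite (fun_supp B (split_last x k))"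
      using fin by (meson finite_imageD finite_subset inj_onI add_right_cancel)
    then show ?thesis using xc
      by (auto simp: C.alg_simps free_carrier_def carrier_monomials fun_supp_def split_last_def split: if_splits)
  qed
  moreover have "\<exists>N. bound \<zero>\<^bsub>C\<^esub> N (split_last x)"
  proof -
    obtain N where N: "\<And>m. m \<in> fun_supp B x \<Longrightarrow> count m (Suc n) \<le> N"
      using finite_imageI[OF fin, of "\<lambda>m. count m (Suc n)"]
      by (metis finite_nat_set_iff_bounded_le imageI)
    have "split_last x k = (\<lambda>_. \<zero>)" if "k > N" for k
    proof
      fix m
      show "split_last x k m = \<zero>"
        using N[of "m + replicate_mset k (Suc n)"] that
        by (auto simp: split_last_def fun_supp_def)
    qed
    then show ?thesis by (intro exI[of _ N] bound.intro) (simp add: C.alg_simps)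
  qed
  ultimately show ?thesis by (auto simp: UP_def intro!: mem_upI)
qed

lemma split_last_single:
  assumes m: "m \<in> carrier (monomials (Suc n))" and c: "c \<in> carrier B"
  shows "split_last (free_single B m c) = up_ring.monom (UP C)
      (free_single B (filter_mset (\<lambda>i. i \<noteq> Suc n) m) c) (count m (Suc n))"
proof -
  let ?m = "filter_mset (\<lambda>i. i \<noteq> Suc n) m"
  have m': "?m \<in> carrier (monomials n)" using m by (auto simp: carrier_monomials)
  then have "free_single B ?m c \<in> carrier C" using c by (simp add: C.alg_simps B.free_single_closed)
  moreover have "(q + replicate_mset k (Suc n) = m) = (q = ?m \<and> k = count m (Suc n))"
    if "set_mset q \<subseteq> {1..n}" for q k
  proof
    have q: "Suc n \<notin># q" using that by auto
    assume e: "q + replicate_mset k (Suc n) = m"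
    then have "k = count m (Suc n)" using q by (auto simp: count_eq_zero_iff)
    moreover have "q = ?m"
      using q by (intro multiset_eqI) (auto simp: e[symmetric] count_eq_zero_iff)
    ultimately show "q = ?m \<and> k = count m (Suc n)" by simp
  next
    assume "q = ?m \<and> k = count m (Suc n)"
    then show "q + replicate_mset k (Suc n) = m" using monom_split[of m "Suc n"] by simp
  qed
  ultimately show ?thesis using m'
    by (auto simp: UP_def split_last_def free_single_def fun_eq_iff C.alg_simps carrier_monomials)
qed

lemma split_last_add:
  assumes "x \<in> carrier D" "y \<in> carrier D"
  shows "split_last (x \<oplus>\<^bsub>D\<^esub> y) = split_last x \<oplus>\<^bsub>UP C\<^esub> split_last y"
proof -
  have "split_last x \<in> up C" "split_last y \<in> up C"
    using split_last_closed[OF assms(1)] split_last_closed[OF assms(2)] by (simp_all add: UP_def)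
  then show ?thesis
    by (auto simp: UP_def C.alg_simps D.alg_simps split_last_def fun_eq_iff)
qed

text \<open>Both sides are additive in each factor, so only monomials matter. For these the
  exponents of the last variable add, and so do the remaining parts.\<close>

lemma split_last_mult:
  assumes x: "x \<in> carrier D" and y: "y \<in> carrier D"
  shows "split_last (x \<otimes>\<^bsub>D\<^esub> y) = split_last x \<otimes>\<^bsub>UP C\<^esub> split_last y"
proof -
  note cl = split_last_closed[unfolded D.alg_simps] and ad = split_last_add[unfolded D.alg_simps]
  have z: "split_last (\<lambda>_. \<zero>) = \<zero>\<^bsub>UP C\<^esub>"
    by (auto simp: split_last_def UP_def C.alg_simps)
  show ?thesis using x[unfolded D.alg_simps]
  proof (induction rule: B.free_induct)
    case (single s c)
    show ?case using y[unfolded D.alg_simps]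
    proof (induction rule: B.free_induct)
      case (single t d)
      have M: "filter_mset (\<lambda>i. i \<noteq> Suc n) m \<in> carrier (monomials n)"
        if "m \<in> carrier (monomials (Suc n))" for m
        using that by (force simp: carrier_monomials)
      then have C: "free_single B (filter_mset (\<lambda>i. i \<noteq> Suc n) m) e \<in> carrier C"
        if "m \<in> carrier (monomials (Suc n))" "e \<in> carrier B" for m e
        using that by (auto simp: C.alg_simps intro!: B.free_single_closed)
      have st: "s \<otimes>\<^bsub>monomials (Suc n)\<^esub> t = s + t" "s + t \<in> carrier (monomials (Suc n))"
        using \<open>s \<in> _\<close> \<open>t \<in> _\<close> by (auto simp: monomials_def)
      have e: "filter_mset (\<lambda>i. i \<noteq> Suc n) s \<otimes>\<^bsub>monomials n\<^esub> filter_mset (\<lambda>i. i \<noteq> Suc n) t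
          = filter_mset (\<lambda>i. i \<noteq> Suc n) (s + t)" by (simp add: monomials_def)
      show ?case using \<open>s \<in> _\<close> \<open>t \<in> _\<close> \<open>c \<in> _\<close> \<open>d \<in> _\<close> C M
        by (simp add: D.single_mult st split_last_single P.monom_mult[symmetric] C.single_mult e
            del: filter_union_mset)
    qed (use \<open>s \<in> _\<close> \<open>c \<in> _\<close> in \<open>simp_all add: z ad cl D.mult_zero D.mult_distr D.mult_closed'
          B.free_single_closed P.P.r_distr\<close>)
  qed (use y in \<open>simp_all add: z ad cl D.mult_zero D.mult_distr D.mult_closed' P.P.l_distr D.alg_simps\<close>)
qed

lemma split_last_hom: "split_last \<in> ring_hom D (UP C)"
proof (rule ring_hom_memI)
  show "split_last \<one>\<^bsub>D\<^esub> = \<one>\<^bsub>UP C\<^esub>"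
    by (auto simp: D.alg_simps C.alg_simps split_last_def free_single_def UP_def monomials_def fun_eq_iff)
qed (simp_all add: split_last_closed split_last_mult split_last_add)

lemma split_last_bij: "bij_betw split_last (carrier D) (carrier (UP C))"
proof -
  \<comment> \<open>The inverse map: the multiplicity of the last variable selects the coefficient,
    and the rest of the monomial is its argument.\<close>
  define g where "g y m = (if set_mset m \<subseteq> {1..Suc n} then y (count m (Suc n)) (filter_mset (\<lambda>i. i \<noteq> Suc n) m)
    else \<zero>)" for y :: "nat \<Rightarrow> nat multiset \<Rightarrow> 'a" and m
  show ?thesis
  proof (rule bij_betw_byWitness[of _ g])
    show "\<forall>x\<in>carrier D. g (split_last x) = x"
    proof (intro ballI ext)
      fix x m assume x: "x \<in> carrier D"
      have "x m = \<zero>" if "\<not> set_mset m \<subseteq> {1..Suc n}"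
        using that B.free_carrierD(4)[OF x[unfolded D.alg_simps], of m] by (simp add: carrier_monomials)
      moreover have "set_mset (filter_mset (\<lambda>i. i \<noteq> Suc n) m) \<subseteq> {1..n}" if "set_mset m \<subseteq> {1..Suc n}"
        using that by auto
      ultimately show "g (split_last x) m = x m"
        using monom_split[of m "Suc n"] unfolding g_def split_last_def by simp
    qed
    have yC: "y k \<in> free_carrier B (carrier (monomials n))" if "y \<in> carrier (UP C)" for y k
      using that by (auto simp: UP_def C.alg_simps dest: mem_upD)
    show "\<forall>y\<in>carrier (UP C). split_last (g y) = y"
    proof (intro ballI ext)
      fix y k m assume y: "y \<in> carrier (UP C)"
      show "split_last (g y) k m = y k m"
      proof (cases "set_mset m \<subseteq> {1..n}")
        case True
        then have "Suc n \<notin># m" by auto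
        then have "filter_mset (\<lambda>i. i \<noteq> Suc n) (m + replicate_mset k (Suc n)) = m"
          and "count m (Suc n) = 0"
          by (auto intro!: multiset_eqI simp: count_eq_zero_iff)
        moreover have "set_mset (m + replicate_mset k (Suc n)) \<subseteq> {1..Suc n}" using True by auto
        ultimately show ?thesis
          using True by (simp add: split_last_def g_def del: filter_union_mset set_mset_union)
      next
        case False
        then show ?thesis using B.free_carrierD(4)[OF yC[OF y]]
          by (auto simp: split_last_def carrier_monomials)
      qed
    qed
    show "split_last ` carrier D \<subseteq> carrier (UP C)" using split_last_closed by blast
    show "g ` carrier (UP C) \<subseteq> carrier D"
    proof (intro image_subsetI)
      fix y assume y: "y \<in> carrier (UP C)"
      obtain N where N: "bound \<zero>\<^bsub>C\<^esub> N y" using y by (auto simp: UP_def up_def)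
      have "fun_supp B (g y) \<subseteq> (\<Union>k\<le>N. (\<lambda>m. m + replicate_mset k (Suc n)) ` fun_supp B (y k))"
      proof
        fix m assume "m \<in> fun_supp B (g y)"
        then have *: "y (count m (Suc n)) (filter_mset (\<lambda>i. i \<noteq> Suc n) m) \<noteq> \<zero>"
          by (auto simp: fun_supp_def g_def split: if_splits)
        moreover have "count m (Suc n) \<le> N"
        proof (rule ccontr)
          assume "\<not> ?thesis"
          then show False using * bound.bound[OF N, of "count m (Suc n)"] by (simp add: C.alg_simps)
        qed
        ultimately show "m \<in> (\<Union>k\<le>N. (\<lambda>m. m + replicate_mset k (Suc n)) ` fun_supp B (y k))"
          using monom_split[of m "Suc n"]
          by (intro UN_I[of "count m (Suc n)"] image_eqI[of _ _ "filter_mset (\<lambda>i. i \<noteq> Suc n) m"])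
            (auto simp: fun_supp_def)
      qed
      then have "finite (fun_supp B (g y))"
        using B.free_carrierD(2)[OF yC[OF y]] by (auto intro: finite_subset)
      moreover have "g y m \<in> carrier B" for m
        using B.free_carrierD(1)[OF yC[OF y]] by (simp add: g_def)
      moreover have "fun_supp B (g y) \<subseteq> carrier (monomials (Suc n))"
        by (auto simp: fun_supp_def carrier_monomials g_def split: if_splits)
      ultimately show "g y \<in> carrier D"
        by (auto simp: D.alg_simps free_carrier_def)
    qed
  qed
qed

lemma frac_closed_step:
  assumes "frac_closed C" "unit_separated C"
  shows "frac_closed D" "unit_separated D"
proof -
  interpret CD: domain C using assms by (simp add: frac_closed_def)
  interpret U: UP_domain C "UP C" by unfold_locales
  obtain N where N: "N \<subseteq> carrier C" "infinite N"
    "\<And>x y. \<lbrakk>x \<in> N; y \<in> N; x \<noteq> y\<rbrakk> \<Longrightarrow> x \<ominus>\<^bsub>C\<^esub> y \<in> Units C"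
    using assms(2) unfolding unit_separated_def by blast
  have U: "frac_closed (UP C)" by (rule U.frac_closed_UP[OF assms(1) N(2,1,3)])
  let ?g = "inv_into (carrier D) split_last"
  have iso: "split_last \<in> ring_iso D (UP C)"
    using split_last_hom split_last_bij by (simp add: ring_iso_def)
  then have g: "?g \<in> ring_hom (UP C) D" "bij_betw ?g (carrier (UP C)) (carrier D)"
    using ring_iso_set_sym[OF DD.ring_axioms iso] by (simp_all add: ring_iso_def)
  show "frac_closed D" by (rule frac_closed_iso[OF U DD.is_cring g])
  interpret g: ring_hom_cring "UP C" D ?g
    by (rule ring_hom_cring_of_hom[OF P.P.is_cring DD.is_cring g(1)])
  \<comment> \<open>The separated points of \<open>C\<close> are carried into \<open>UP C\<close> as
    constants and then along the inverse isomorphism into \<open>D\<close>.\<close>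
  interpret c: ring_hom_cring C "UP C" "\<lambda>a. up_ring.monom (UP C) a 0"
    by (rule ring_hom_cring_of_hom[OF CC.is_cring P.P.is_cring P.const_ring_hom])
  have "inj_on (\<lambda>a. up_ring.monom (UP C) a 0) (carrier C)"
    by (rule P.monom_inj)
  then have "unit_separated (UP C)" by (rule c.unit_separated_hom[OF assms(2)])
  then show "unit_separated D" using g.unit_separated_hom g(2) by (simp add: bij_betw_def)
qed

end

text \<open>The two properties are carried through the induction together, since passing to one more
  variable consumes both. In zero variables \<open>{#}\<close> is the only monomial, and the
  coefficient there identifies the algebra with \<open>B\<close>.\<close>

lemma frac_closed_polys:
  fixes B (structure)
  assumes B: "frac_closed B" "unit_separated B"
  shows "frac_closed (monoid_algebra B (monomials n))"
    and "unit_separated (monoid_algebra B (monomials n))"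
proof -
  interpret B: domain B using B by (simp add: frac_closed_def)
  have "frac_closed (monoid_algebra B (monomials n)) \<and> unit_separated (monoid_algebra B (monomials n))"
  proof (induction n)
    case 0
    interpret C: monoid_alg B "monomials 0" "monoid_algebra B (monomials 0)"
      by (intro monoid_alg.intro B.is_cring monomials_comm_monoid)
    have car: "carrier (monomials 0) = {{#}}" by (auto simp: monomials_def)
    have one: "\<one>\<^bsub>monomials 0\<^esub> = {#}" by (simp add: monomials_def)
    have hom: "free_single B {#} \<in> ring_hom B (monoid_algebra B (monomials 0))"
    proof (rule ring_hom_memI)
      show "free_single B {#} (x \<otimes> y) = free_single B {#} x \<otimes>\<^bsub>monoid_algebra B (monomials 0)\<^esub> free_single B {#} y"
        if "x \<in> carrier B" "y \<in> carrier B" for x y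
        using C.single_mult[of "{#}" "{#}" x y] that by (simp add: car) (simp add: monomials_def)
    qed (auto simp: C.alg_simps car one B.free_single_closed, simp add: free_single_def fun_eq_iff)
    have bij: "bij_betw (free_single B {#}) (carrier B) (carrier (monoid_algebra B (monomials 0)))"
    proof (rule bij_betw_byWitness[of _ "\<lambda>x. x {#}"])
      show "\<forall>x\<in>carrier (monoid_algebra B (monomials 0)). free_single B {#} (x {#}) = x"
      proof
        fix x assume x: "x \<in> carrier (monoid_algebra B (monomials 0))"
        then have "x m = \<zero>" if "m \<noteq> {#}" for m
          using that B.free_carrierD(4)[of x "{{#}}" m] by (simp add: C.alg_simps car)
        then show "free_single B {#} (x {#}) = x" by (auto simp: free_single_def fun_eq_iff)
      qed
    qed (auto simp: C.alg_simps car B.free_carrierD(1) B.free_single_closed, simp add: free_single_def)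
    interpret h: ring_hom_cring B "monoid_algebra B (monomials 0)" "free_single B {#}"
      by (rule ring_hom_cring_of_hom[OF B.is_cring C.alg_cring hom])
    show ?case
      using frac_closed_iso[OF B(1) C.alg_cring hom bij] h.unit_separated_hom[OF B(2)] bij
      by (simp add: bij_betw_def)
  next
    case (Suc n)
    interpret poly_step B n "monoid_algebra B (monomials n)" "monoid_algebra B (monomials (Suc n))"
      by unfold_locales
    show ?case using frac_closed_step Suc by blast
  qed
  then show "frac_closed (monoid_algebra B (monomials n))"
    and "unit_separated (monoid_algebra B (monomials n))" by auto
qed

section \<open>Tensor products of Poisson algebras\<close>


text \<open>Quotients, tensor products and polynomial Poisson algebras are records that copy
  operations from other records. This and the next two lemmas carry the algebraic laws across equal
  fields.\<close>

lemma abelian_group_cong: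
  assumes "carrier G' = carrier G" "add G' = add G" "zero G' = zero G" "abelian_group G"
  shows "abelian_group G'"
proof -
  interpret abelian_group G by fact
  show ?thesis
    by (rule abelian_groupI) (use assms(1-3) in \<open>auto simp: a_ac intro: bexI[of _ "\<ominus>\<^bsub>G\<^esub> _"] l_neg\<close>)
qed

lemma module_cong:
  assumes eq: "carrier M' = carrier M" "add M' = add M" "zero M' = zero M" "smult M' = smult M"
    and M: "module R M"
  shows "module R M'"
proof -
  interpret module R M by fact
  show ?thesis
    by (rule moduleI[OF R.is_cring abelian_group_cong[OF eq(1-3) M.abelian_group_axioms]])
      (simp_all add: eq smult_l_distr smult_r_distr smult_assoc1)
qed

lemma cring_cong:
  assumes eq: "carrier R' = carrier R" "add R' = add R" "zero R' = zero R"
      "mult R' = mult R" "one R' = one R"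
    and R: "cring R"
  shows "cring R'"
proof -
  interpret cring R by fact
  show ?thesis
  proof (rule cringI[OF abelian_group_cong[OF eq(1-3) abelian_group_axioms]])
    show "comm_monoid R'" by (rule comm_monoidI) (auto simp: eq m_ac)
  qed (simp add: eq l_distr)
qed

lemma quot_module_simps:
  "carrier (quot_module M N) = a_rcosets\<^bsub>M\<^esub> N" "add (quot_module M N) = set_add M"
  "zero (quot_module M N) = N" "mult (quot_module M N) = rcoset_mult M N"
  "one (quot_module M N) = N +>\<^bsub>M\<^esub> \<one>\<^bsub>M\<^esub>"
  "c \<odot>\<^bsub>quot_module M N\<^esub> U = (\<Union>x\<in>U. N +>\<^bsub>M\<^esub> (c \<odot>\<^bsub>M\<^esub> x))"
  by (simp_all add: quot_module_def FactRing_def ring.defs module.defs)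

section \<open>Spans and quotient spaces\<close>

context module
begin

lemma submodule_abelian_subgroup: "submodule N R M \<Longrightarrow> abelian_subgroup N M"
  by (intro abelian_subgroupI3 additive_subgroupI M.abelian_group_axioms) (simp add: submodule_def)

lemma lin_span_superset: "S \<subseteq> lin_span R M S"
  by (auto simp: lin_span_def)

lemma lin_span_least: "\<lbrakk>submodule N R M; S \<subseteq> N\<rbrakk> \<Longrightarrow> lin_span R M S \<subseteq> N"
  by (auto simp: lin_span_def)

lemma lin_span_submodule:
  assumes "S \<subseteq> carrier M"
  shows "submodule (lin_span R M S) R M"
proof (rule submoduleI)
  show "lin_span R M S \<subseteq> carrier M" by (rule lin_span_least[OF carrier_is_submodule assms])
  have z: "\<zero>\<^bsub>M\<^esub> \<in> N" if "submodule N R M" for N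
    using abelian_subgroup.axioms(1)[OF submodule_abelian_subgroup[OF that]]
    by (rule additive_subgroup.zero_closed)
  then show "\<zero>\<^bsub>M\<^esub> \<in> lin_span R M S" by (auto simp: lin_span_def)
qed (auto simp: lin_span_def intro: submoduleE)

end

locale quot_by = module R M
  for R :: "('k, 'x) ring_scheme" and M :: "('k, 'a, 'y) module_scheme" + fixes N assumes N: "submodule N R M"
begin

sublocale N: abelian_subgroup N M by (rule submodule_abelian_subgroup[OF N])

abbreviation "Q \<equiv> quot_module M N"

lemma quot_cases:
  assumes "U \<in> carrier Q"
  obtains x where "x \<in> carrier M" "U = N +>\<^bsub>M\<^esub> x"
  using assms by (auto simp: quot_module_simps A_RCOSETS_def' a_r_coset_def')

lemma coset_closed: "x \<in> carrier M \<Longrightarrow> N +>\<^bsub>M\<^esub> x \<in> carrier Q"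
  by (auto simp: quot_module_simps A_RCOSETS_def' a_r_coset_def')

lemma coset_add:
  "\<lbrakk>x \<in> carrier M; y \<in> carrier M\<rbrakk> \<Longrightarrow> (N +>\<^bsub>M\<^esub> x) \<oplus>\<^bsub>Q\<^esub> (N +>\<^bsub>M\<^esub> y) = N +>\<^bsub>M\<^esub> (x \<oplus>\<^bsub>M\<^esub> y)"
  by (simp add: quot_module_simps N.a_rcos_sum)

lemma mem_coset: "y \<in> N +>\<^bsub>M\<^esub> x \<longleftrightarrow> (\<exists>n\<in>N. y = n \<oplus>\<^bsub>M\<^esub> x)"
  by (auto simp: a_r_coset_def')

lemma coset_eq_iff:
  assumes "x \<in> carrier M" "y \<in> carrier M"
  shows "N +>\<^bsub>M\<^esub> x = N +>\<^bsub>M\<^esub> y \<longleftrightarrow> x \<ominus>\<^bsub>M\<^esub> y \<in> N"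
proof
  assume "N +>\<^bsub>M\<^esub> x = N +>\<^bsub>M\<^esub> y"
  then have "x \<in> N +>\<^bsub>M\<^esub> y" using N.a_rcos_self[OF assms(1)] by simp
  then show "x \<ominus>\<^bsub>M\<^esub> y \<in> N" using assms
    by (auto simp: mem_coset M.minus_eq M.a_assoc M.r_neg)
next
  assume n: "x \<ominus>\<^bsub>M\<^esub> y \<in> N"
  have "x = (x \<ominus>\<^bsub>M\<^esub> y) \<oplus>\<^bsub>M\<^esub> y" using assms by (simp add: M.minus_eq M.a_assoc M.l_neg)
  then have "x \<in> N +>\<^bsub>M\<^esub> y" using n by (auto simp: mem_coset)
  then show "N +>\<^bsub>M\<^esub> x = N +>\<^bsub>M\<^esub> y"
    using N.a_repr_independence' assms(2) by blast
qed

lemma coset_zero_iff: "x \<in> carrier M \<Longrightarrow> N +>\<^bsub>M\<^esub> x = N \<longleftrightarrow> x \<in> N"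
  using coset_eq_iff[of x "\<zero>\<^bsub>M\<^esub>"] M.a_coset_add_zero[OF N.a_subset] by (simp add: M.minus_eq M.add.inv_one[folded a_inv_def])

lemma coset_smult:
  assumes "c \<in> carrier R" "x \<in> carrier M"
  shows "c \<odot>\<^bsub>Q\<^esub> (N +>\<^bsub>M\<^esub> x) = N +>\<^bsub>M\<^esub> (c \<odot>\<^bsub>M\<^esub> x)"
proof -
  \<comment> \<open>The scalar action on the quotient is a union over all representatives; the
    cosets in this union are shown to coincide.\<close>
  have "N +>\<^bsub>M\<^esub> (c \<odot>\<^bsub>M\<^esub> y) = N +>\<^bsub>M\<^esub> (c \<odot>\<^bsub>M\<^esub> x)" if y: "y \<in> N +>\<^bsub>M\<^esub> x" for y
  proof -
    obtain n where n: "n \<in> N" "y = n \<oplus>\<^bsub>M\<^esub> x" using y unfolding mem_coset by blast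
    have nM: "n \<in> carrier M" using n by simp
    have "c \<odot>\<^bsub>M\<^esub> y \<ominus>\<^bsub>M\<^esub> c \<odot>\<^bsub>M\<^esub> x = c \<odot>\<^bsub>M\<^esub> n"
      unfolding n(2) using nM assms
      by (simp add: smult_r_distr M.minus_eq M.a_assoc M.r_neg)
    then show ?thesis using assms n nM submoduleE(4)[OF N] by (subst coset_eq_iff) auto
  qed
  moreover have "x \<in> N +>\<^bsub>M\<^esub> x" by (rule N.a_rcos_self[OF assms(2)])
  ultimately show ?thesis unfolding quot_module_simps by blast
qed

lemma quot_is_module: "module R Q"
proof (rule moduleI[OF R.is_cring])
  show "abelian_group Q"
  proof (rule abelian_group_cong)
    show "abelian_group (M Quot N)"
      by (rule comm_group_abelian_groupI)
        (simp add: FactRing_def N.a_factorgroup_is_comm_group[unfolded A_FactGroup_def'])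
  qed (simp_all add: quot_module_simps FactRing_def)
qed (auto elim!: quot_cases simp: coset_closed coset_smult coset_add smult_l_distr smult_r_distr smult_assoc1)

end

section \<open>The tensor product as a vector space\<close>

lemma tensor_simps:
  "carrier (tensor K P Q) = carrier (quot_module (tensor_free K P Q) (tensor_rels K P Q))"
  "add (tensor K P Q) = add (quot_module (tensor_free K P Q) (tensor_rels K P Q))"
  "zero (tensor K P Q) = zero (quot_module (tensor_free K P Q) (tensor_rels K P Q))"
  "mult (tensor K P Q) = mult (quot_module (tensor_free K P Q) (tensor_rels K P Q))"
  "one (tensor K P Q) = one (quot_module (tensor_free K P Q) (tensor_rels K P Q))"
  "smult (tensor K P Q) = smult (quot_module (tensor_free K P Q) (tensor_rels K P Q))"
  "\<lbrace>U, V\<rbrace>\<^bsub>tensor K P Q\<^esub> = (\<Union>x\<in>U. \<Union>y\<in>V.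
      tensor_rels K P Q +>\<^bsub>tensor_free K P Q\<^esub> tensor_free_bracket K P Q x y)"
  by (simp_all add: tensor_def module.defs palg.defs)

locale tensor_pair = K: field K + P: poisson_algebra K P + Q: poisson_algebra K Q
  for K :: "('k, 'x) ring_scheme" and P :: "('k, 'a, 'y) palg_scheme" and Q :: "('k, 'b, 'z) palg_scheme"
begin

abbreviation "F \<equiv> tensor_free K P Q"
abbreviation "N \<equiv> tensor_rels K P Q"
abbreviation "T \<equiv> tensor K P Q"
abbreviation "pure \<equiv> pure_tensor K P Q"
abbreviation "unit a b \<equiv> free_single K (a, b) \<one>\<^bsub>K\<^esub>"

lemma DirProd_comm_monoid: "comm_monoid (P \<times>\<times> Q)"
  by (rule comm_monoidI) (auto simp: P.m_ac Q.m_ac)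

sublocale F: monoid_alg K "P \<times>\<times> Q" F
  unfolding tensor_free_def by (intro monoid_alg.intro K.is_cring DirProd_comm_monoid)

sublocale FA: algebra K F by (rule F.alg_algebra)

lemma unit_closed: "\<lbrakk>a \<in> carrier P; b \<in> carrier Q\<rbrakk> \<Longrightarrow> unit a b \<in> carrier F"
  by (simp add: F.alg_simps K.free_single_closed)

lemma single_eq: "\<lbrakk>a \<in> carrier P; b \<in> carrier Q; c \<in> carrier K\<rbrakk> \<Longrightarrow> free_single K (a, b) c = c \<odot>\<^bsub>F\<^esub> unit a b"
  by (auto simp: F.alg_simps free_single_def)

lemma gens_closed: "tensor_gens K P Q \<subseteq> carrier F"
  by (auto simp: tensor_gens_def Let_def free_unit_eq_single unit_closed)

lemma rels_submodule: "submodule N K F"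
  unfolding tensor_rels_def by (rule FA.lin_span_submodule[OF gens_closed])

sublocale Qm: quot_by K F N
  by (rule quot_by.intro[OF FA.module_axioms quot_by_axioms.intro[OF rels_submodule]])

lemma rels_least:
  "\<lbrakk>submodule N' K F; tensor_gens K P Q \<subseteq> N'\<rbrakk> \<Longrightarrow> N \<subseteq> N'"
  unfolding tensor_rels_def by (rule FA.lin_span_least)

lemma gen_in_rels: "g \<in> tensor_gens K P Q \<Longrightarrow> g \<in> N"
  unfolding tensor_rels_def using FA.lin_span_superset by blast

lemma pure_eq: "pure a b = N +>\<^bsub>F\<^esub> unit a b"
  by (simp add: pure_tensor_def free_unit_eq_single)

sublocale T: module K T
  by (rule module_cong[OF _ _ _ _ Qm.quot_is_module]) (simp_all add: tensor_simps)

lemmas coset_closed = Qm.coset_closed[folded tensor_simps]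
lemmas coset_add = Qm.coset_add[folded tensor_simps]
lemmas coset_smult = Qm.coset_smult[folded tensor_simps]
lemmas tensor_cases = Qm.quot_cases[folded tensor_simps]

lemma tensor_zero: "\<zero>\<^bsub>T\<^esub> = N" by (simp add: tensor_simps quot_module_simps)

lemma pure_closed [simp]: "\<lbrakk>a \<in> carrier P; b \<in> carrier Q\<rbrakk> \<Longrightarrow> pure a b \<in> carrier T"
  by (simp add: pure_eq coset_closed unit_closed)

lemma pure_add_left:
  assumes "a \<in> carrier P" "a' \<in> carrier P" "b \<in> carrier Q"
  shows "pure (a \<oplus>\<^bsub>P\<^esub> a') b = pure a b \<oplus>\<^bsub>T\<^esub> pure a' b"
proof -
  have "unit (a \<oplus>\<^bsub>P\<^esub> a') b \<ominus>\<^bsub>F\<^esub> (unit a b \<oplus>\<^bsub>F\<^esub> unit a' b) \<in> N"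
    using assms by (intro gen_in_rels) (auto simp: tensor_gens_def Let_def free_unit_eq_single)
  then show ?thesis unfolding pure_eq using assms
    by (simp add: coset_add unit_closed Qm.coset_eq_iff)
qed

lemma pure_add_right:
  assumes "a \<in> carrier P" "b \<in> carrier Q" "b' \<in> carrier Q"
  shows "pure a (b \<oplus>\<^bsub>Q\<^esub> b') = pure a b \<oplus>\<^bsub>T\<^esub> pure a b'"
proof -
  have "unit a (b \<oplus>\<^bsub>Q\<^esub> b') \<ominus>\<^bsub>F\<^esub> (unit a b \<oplus>\<^bsub>F\<^esub> unit a b') \<in> N"
    using assms by (intro gen_in_rels) (auto simp: tensor_gens_def Let_def free_unit_eq_single)
  then show ?thesis unfolding pure_eq using assms
    by (simp add: coset_add unit_closed Qm.coset_eq_iff)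
qed

lemma pure_smult_left:
  assumes "c \<in> carrier K" "a \<in> carrier P" "b \<in> carrier Q"
  shows "pure (c \<odot>\<^bsub>P\<^esub> a) b = c \<odot>\<^bsub>T\<^esub> pure a b"
proof -
  have "unit (c \<odot>\<^bsub>P\<^esub> a) b \<ominus>\<^bsub>F\<^esub> (c \<odot>\<^bsub>F\<^esub> unit a b) \<in> N"
    using assms by (intro gen_in_rels) (auto simp: tensor_gens_def Let_def free_unit_eq_single)
  then show ?thesis unfolding pure_eq using assms
    by (simp add: coset_smult unit_closed Qm.coset_eq_iff)
qed

lemma pure_smult_right:
  assumes "c \<in> carrier K" "a \<in> carrier P" "b \<in> carrier Q"
  shows "pure a (c \<odot>\<^bsub>Q\<^esub> b) = c \<odot>\<^bsub>T\<^esub> pure a b"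
proof -
  have "unit a (c \<odot>\<^bsub>Q\<^esub> b) \<ominus>\<^bsub>F\<^esub> (c \<odot>\<^bsub>F\<^esub> unit a b) \<in> N"
    using assms by (intro gen_in_rels) (auto simp: tensor_gens_def Let_def free_unit_eq_single)
  then show ?thesis unfolding pure_eq using assms
    by (simp add: coset_smult unit_closed Qm.coset_eq_iff)
qed

lemma coset_single:
  "\<lbrakk>a \<in> carrier P; b \<in> carrier Q; c \<in> carrier K\<rbrakk> \<Longrightarrow> N +>\<^bsub>F\<^esub> free_single K (a, b) c = pure (c \<odot>\<^bsub>P\<^esub> a) b"
  using single_eq[of a b c] pure_smult_left[of c a b, unfolded pure_eq]
  by (simp add: pure_eq coset_smult unit_closed)

lemma pure_zero_left: "b \<in> carrier Q \<Longrightarrow> pure \<zero>\<^bsub>P\<^esub> b = \<zero>\<^bsub>T\<^esub>"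
  using pure_smult_left[of "\<zero>\<^bsub>K\<^esub>" "\<zero>\<^bsub>P\<^esub>" b]
  by (simp only: P.smult_l_null T.smult_l_null pure_closed P.zero_closed K.zero_closed)

lemma pure_zero_right: "a \<in> carrier P \<Longrightarrow> pure a \<zero>\<^bsub>Q\<^esub> = \<zero>\<^bsub>T\<^esub>"
  using pure_smult_right[of "\<zero>\<^bsub>K\<^esub>" a "\<zero>\<^bsub>Q\<^esub>"]
  by (simp only: Q.smult_l_null T.smult_l_null pure_closed Q.zero_closed K.zero_closed)

text \<open>A scalar can be absorbed into the left factor and zero is itself a pure tensor, so pure
  tensors generate under addition alone.\<close>

lemma tensor_induct [consumes 1, case_names pure add]:
  assumes U: "U \<in> carrier T"
    and pure: "\<And>a b. \<lbrakk>a \<in> carrier P; b \<in> carrier Q\<rbrakk> \<Longrightarrow> Z (pure a b)"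
    and add: "\<And>U V. \<lbrakk>U \<in> carrier T; V \<in> carrier T; Z U; Z V\<rbrakk> \<Longrightarrow> Z (U \<oplus>\<^bsub>T\<^esub> V)"
  shows "Z U"
proof -
  obtain x where x: "x \<in> carrier F" and U': "U = N +>\<^bsub>F\<^esub> x" using U by (rule tensor_cases)
  show ?thesis unfolding U' using x[unfolded F.alg_simps]
  proof (induction rule: K.free_induct)
    case zero
    have "N +>\<^bsub>F\<^esub> (\<lambda>_. \<zero>\<^bsub>K\<^esub>) = \<zero>\<^bsub>T\<^esub>"
      using Qm.coset_zero_iff[of "\<zero>\<^bsub>F\<^esub>"] by (simp add: F.alg_simps[symmetric] tensor_zero)
    then show ?case using pure[of "\<zero>\<^bsub>P\<^esub>" "\<zero>\<^bsub>Q\<^esub>"] pure_zero_left[of "\<zero>\<^bsub>Q\<^esub>"] by simp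
  next
    case (single s c)
    then show ?case using pure by (cases s) (simp add: coset_single)
  next
    case (add x y)
    then have xy: "x \<in> carrier F" "y \<in> carrier F" by (simp_all only: F.alg_simps(1))
    have "N +>\<^bsub>F\<^esub> (\<lambda>s. x s \<oplus>\<^bsub>K\<^esub> y s) = (N +>\<^bsub>F\<^esub> x) \<oplus>\<^bsub>T\<^esub> (N +>\<^bsub>F\<^esub> y)"
      unfolding F.alg_simps(3)[symmetric] by (rule coset_add[OF xy, symmetric])
    then show ?case using assms(3)[OF coset_closed coset_closed] xy add by simp
  qed
qed

end


section \<open>The universal property\<close>

locale tensor_lift = tensor_pair K P Q + W: module K W
  for K :: "('k, 'x) ring_scheme" and P :: "('k, 'a, 'y) palg_scheme" and Q :: "('k, 'b, 'z) palg_scheme"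
    and W :: "('k, 'w, 'v) module_scheme" +
  fixes h :: "'a \<Rightarrow> 'b \<Rightarrow> 'w"
  assumes h_closed: "\<lbrakk>a \<in> carrier P; b \<in> carrier Q\<rbrakk> \<Longrightarrow> h a b \<in> carrier W"
    and h_add_left: "\<lbrakk>a \<in> carrier P; a' \<in> carrier P; b \<in> carrier Q\<rbrakk> \<Longrightarrow> h (a \<oplus>\<^bsub>P\<^esub> a') b = h a b \<oplus>\<^bsub>W\<^esub> h a' b"
    and h_add_right: "\<lbrakk>a \<in> carrier P; b \<in> carrier Q; b' \<in> carrier Q\<rbrakk> \<Longrightarrow> h a (b \<oplus>\<^bsub>Q\<^esub> b') = h a b \<oplus>\<^bsub>W\<^esub> h a b'"
    and h_smult_left: "\<lbrakk>c \<in> carrier K; a \<in> carrier P; b \<in> carrier Q\<rbrakk> \<Longrightarrow> h (c \<odot>\<^bsub>P\<^esub> a) b = c \<odot>\<^bsub>W\<^esub> h a b"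
    and h_smult_right: "\<lbrakk>c \<in> carrier K; a \<in> carrier P; b \<in> carrier Q\<rbrakk> \<Longrightarrow> h a (c \<odot>\<^bsub>Q\<^esub> b) = c \<odot>\<^bsub>W\<^esub> h a b"
begin

definition free_lift :: "('a \<times> 'b \<Rightarrow> 'k) \<Rightarrow> 'w" where
  "free_lift = supp_sum K W (\<lambda>s c. c \<odot>\<^bsub>W\<^esub> h (fst s) (snd s))"

text \<open>On a coset the map \<open>free_lift\<close> is constant because it kills the relations;
  \<open>the_elem\<close> extracts this value from the one-element image.\<close>

definition lift :: "('a \<times> 'b \<Rightarrow> 'k) set \<Rightarrow> 'w" where
  "lift U = the_elem (free_lift ` U)"

lemma free_lift_family: "additive_family K W (carrier P \<times> carrier Q) (\<lambda>s c. c \<odot>\<^bsub>W\<^esub> h (fst s) (snd s))"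
  by unfold_locales (auto simp: h_closed W.smult_l_distr)

lemma free_lift_closed: "x \<in> carrier F \<Longrightarrow> free_lift x \<in> carrier W"
  unfolding free_lift_def by (rule additive_family.supp_sum_closed[OF free_lift_family]) (simp add: F.alg_simps)

lemma free_lift_add: "\<lbrakk>x \<in> carrier F; y \<in> carrier F\<rbrakk> \<Longrightarrow> free_lift (x \<oplus>\<^bsub>F\<^esub> y) = free_lift x \<oplus>\<^bsub>W\<^esub> free_lift y"
  unfolding free_lift_def F.alg_simps(3)
  by (rule additive_family.supp_sum_add[OF free_lift_family]) (simp_all add: F.alg_simps)

lemma free_lift_single:
  "\<lbrakk>a \<in> carrier P; b \<in> carrier Q; c \<in> carrier K\<rbrakk> \<Longrightarrow> free_lift (free_single K (a, b) c) = c \<odot>\<^bsub>W\<^esub> h a b"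
  unfolding free_lift_def by (subst additive_family.supp_sum_single[OF free_lift_family]) auto

lemma free_lift_smult:
  assumes "c \<in> carrier K" "x \<in> carrier F"
  shows "free_lift (c \<odot>\<^bsub>F\<^esub> x) = c \<odot>\<^bsub>W\<^esub> free_lift x"
  unfolding free_lift_def F.alg_simps(4)
  by (rule additive_family.supp_sum_hom[OF free_lift_family])
    (use assms in \<open>auto simp: F.alg_simps W.smult_r_distr h_closed W.smult_assoc1\<close>)

lemma free_lift_unit: "\<lbrakk>a \<in> carrier P; b \<in> carrier Q\<rbrakk> \<Longrightarrow> free_lift (unit a b) = h a b"
  by (simp add: free_lift_single h_closed)

lemma free_lift_uminus:
  assumes "x \<in> carrier F" shows "free_lift (\<ominus>\<^bsub>F\<^esub> x) = \<ominus>\<^bsub>W\<^esub> free_lift x"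
proof -
  have "\<ominus>\<^bsub>F\<^esub> x = (\<ominus>\<^bsub>K\<^esub> \<one>\<^bsub>K\<^esub>) \<odot>\<^bsub>F\<^esub> x" using assms by (simp add: FA.smult_l_minus)
  then show ?thesis using assms by (simp add: free_lift_smult W.smult_l_minus free_lift_closed)
qed

text \<open>The kernel of \<open>free_lift\<close> is a subspace. Bilinearity of \<open>h\<close>
  puts the generators of the relations into it, hence also their span.\<close>

lemma free_lift_rels: assumes "x \<in> N" shows "free_lift x = \<zero>\<^bsub>W\<^esub>"
proof -
  let ?N = "{x \<in> carrier F. free_lift x = \<zero>\<^bsub>W\<^esub>}"
  have z: "free_lift \<zero>\<^bsub>F\<^esub> = \<zero>\<^bsub>W\<^esub>"
    using free_lift_smult[of "\<zero>\<^bsub>K\<^esub>" "\<zero>\<^bsub>F\<^esub>"] free_lift_closed[of "\<zero>\<^bsub>F\<^esub>"]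
    by (simp only: FA.smult_l_null W.smult_l_null FA.zero_closed K.zero_closed)
  have "submodule ?N K F"
    by (rule FA.submoduleI)
      (auto simp: z free_lift_add free_lift_smult free_lift_uminus W.add.inv_one[folded a_inv_def])
  moreover have "tensor_gens K P Q \<subseteq> ?N"
    using gens_closed
    by (auto simp: tensor_gens_def Let_def free_unit_eq_single a_minus_def free_lift_add
        free_lift_uminus free_lift_smult free_lift_unit unit_closed
        h_add_left h_add_right h_smult_left h_smult_right h_closed W.r_neg)
  ultimately show ?thesis using rels_least assms by blast
qed

lemma lift_coset: assumes x: "x \<in> carrier F" shows "lift (N +>\<^bsub>F\<^esub> x) = free_lift x"
proof -
  have "free_lift y = free_lift x" if y: "y \<in> N +>\<^bsub>F\<^esub> x" for y
  proof -
    obtain n where n: "n \<in> N" "y = n \<oplus>\<^bsub>F\<^esub> x" using y unfolding Qm.mem_coset by blast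
    then have "n \<in> carrier F" using Qm.N.a_subset by blast
    then show ?thesis using n x by (simp add: free_lift_add free_lift_rels free_lift_closed)
  qed
  moreover have "x \<in> N +>\<^bsub>F\<^esub> x" by (rule Qm.N.a_rcos_self[OF x])
  ultimately have "free_lift ` (N +>\<^bsub>F\<^esub> x) = {free_lift x}" by blast
  then show ?thesis by (simp add: lift_def)
qed

lemma lift_closed: "U \<in> carrier T \<Longrightarrow> lift U \<in> carrier W"
  by (erule tensor_cases) (simp add: lift_coset free_lift_closed)

lemma lift_add: "\<lbrakk>U \<in> carrier T; V \<in> carrier T\<rbrakk> \<Longrightarrow> lift (U \<oplus>\<^bsub>T\<^esub> V) = lift U \<oplus>\<^bsub>W\<^esub> lift V"
  by (elim tensor_cases) (simp add: coset_add lift_coset free_lift_add)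

lemma lift_smult: "\<lbrakk>c \<in> carrier K; U \<in> carrier T\<rbrakk> \<Longrightarrow> lift (c \<odot>\<^bsub>T\<^esub> U) = c \<odot>\<^bsub>W\<^esub> lift U"
  by (elim tensor_cases) (simp add: coset_smult lift_coset free_lift_smult)

lemma lift_pure: "\<lbrakk>a \<in> carrier P; b \<in> carrier Q\<rbrakk> \<Longrightarrow> lift (pure a b) = h a b"
  unfolding pure_eq by (simp add: lift_coset unit_closed free_lift_unit)

text \<open>Serves to recognise a concretely given additive map on the free space as the lift of a
  bilinear map. Such a map then vanishes on the relations, which is how product and bracket are
  shown to descend to the quotient.\<close>

lemma free_lift_unique:
  assumes x: "x \<in> carrier F"
    and closed: "\<And>x. x \<in> carrier F \<Longrightarrow> g x \<in> carrier W"
    and add: "\<And>x y. \<lbrakk>x \<in> carrier F; y \<in> carrier F\<rbrakk> \<Longrightarrow> g (x \<oplus>\<^bsub>F\<^esub> y) = g x \<oplus>\<^bsub>W\<^esub> g y"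
    and single: "\<And>a b c. \<lbrakk>a \<in> carrier P; b \<in> carrier Q; c \<in> carrier K\<rbrakk> \<Longrightarrow>
      g (free_single K (a, b) c) = c \<odot>\<^bsub>W\<^esub> h a b"
  shows "g x = free_lift x"
  using x[unfolded F.alg_simps(1)]
proof (induction rule: K.free_induct)
  case zero
  have "g' \<zero>\<^bsub>F\<^esub> = \<zero>\<^bsub>W\<^esub>" if "g' (\<zero>\<^bsub>F\<^esub> \<oplus>\<^bsub>F\<^esub> \<zero>\<^bsub>F\<^esub>) = g' \<zero>\<^bsub>F\<^esub> \<oplus>\<^bsub>W\<^esub> g' \<zero>\<^bsub>F\<^esub>" "g' \<zero>\<^bsub>F\<^esub> \<in> carrier W" for g'
    using that by (metis FA.M.l_zero FA.M.zero_closed W.add.r_cancel_one')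
  then have "g \<zero>\<^bsub>F\<^esub> = free_lift \<zero>\<^bsub>F\<^esub>"
    using add[of "\<zero>\<^bsub>F\<^esub>" "\<zero>\<^bsub>F\<^esub>"] closed[of "\<zero>\<^bsub>F\<^esub>"] free_lift_add[of "\<zero>\<^bsub>F\<^esub>" "\<zero>\<^bsub>F\<^esub>"]
      free_lift_closed[of "\<zero>\<^bsub>F\<^esub>"] FA.M.zero_closed by metis
  then show ?case by (simp only: F.alg_simps(2))
next
  case (single s c)
  then show ?case by (cases s) (simp add: assms(4) free_lift_single)
next
  case (add x y)
  then have xy: "x \<in> carrier F" "y \<in> carrier F" by (simp_all only: F.alg_simps(1))
  show ?case unfolding F.alg_simps(3)[symmetric]
    using add assms(3)[OF xy] free_lift_add[OF xy] by simp
qed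

end

section \<open>Product and bracket on the tensor product\<close>

lemma (in poisson_algebra) bracket_simps:
  assumes "x \<in> carrier P" "y \<in> carrier P" "z \<in> carrier P"
  shows "\<lbrace>x, y \<oplus>\<^bsub>P\<^esub> z\<rbrace>\<^bsub>P\<^esub> = \<lbrace>x, y\<rbrace>\<^bsub>P\<^esub> \<oplus>\<^bsub>P\<^esub> \<lbrace>x, z\<rbrace>\<^bsub>P\<^esub>"
    and "c \<in> carrier K \<Longrightarrow> \<lbrace>x, c \<odot>\<^bsub>P\<^esub> y\<rbrace>\<^bsub>P\<^esub> = c \<odot>\<^bsub>P\<^esub> \<lbrace>x, y\<rbrace>\<^bsub>P\<^esub>"
    and "\<lbrace>x, y \<otimes>\<^bsub>P\<^esub> z\<rbrace>\<^bsub>P\<^esub> = y \<otimes>\<^bsub>P\<^esub> \<lbrace>x, z\<rbrace>\<^bsub>P\<^esub> \<oplus>\<^bsub>P\<^esub> \<lbrace>x, y\<rbrace>\<^bsub>P\<^esub> \<otimes>\<^bsub>P\<^esub> z"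
proof -
  have *: "\<lbrace>x, w\<rbrace>\<^bsub>P\<^esub> = \<ominus>\<^bsub>P\<^esub> \<lbrace>w, x\<rbrace>\<^bsub>P\<^esub>" if "w \<in> carrier P" for w
    using bracket_antisym[OF that assms(1)] .
  show "\<lbrace>x, y \<oplus>\<^bsub>P\<^esub> z\<rbrace>\<^bsub>P\<^esub> = \<lbrace>x, y\<rbrace>\<^bsub>P\<^esub> \<oplus>\<^bsub>P\<^esub> \<lbrace>x, z\<rbrace>\<^bsub>P\<^esub>"
    using assms by (simp add: * bracket_add bracket_closed minus_add)
  show "c \<in> carrier K \<Longrightarrow> \<lbrace>x, c \<odot>\<^bsub>P\<^esub> y\<rbrace>\<^bsub>P\<^esub> = c \<odot>\<^bsub>P\<^esub> \<lbrace>x, y\<rbrace>\<^bsub>P\<^esub>"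
    using assms by (simp add: * bracket_smult bracket_closed smult_r_minus)
  show "\<lbrace>x, y \<otimes>\<^bsub>P\<^esub> z\<rbrace>\<^bsub>P\<^esub> = y \<otimes>\<^bsub>P\<^esub> \<lbrace>x, z\<rbrace>\<^bsub>P\<^esub> \<oplus>\<^bsub>P\<^esub> \<lbrace>x, y\<rbrace>\<^bsub>P\<^esub> \<otimes>\<^bsub>P\<^esub> z"
    using assms by (simp add: * bracket_leibniz bracket_closed minus_add r_minus l_minus)
qed

context tensor_pair
begin

lemmas pure_bilinear = pure_add_left pure_add_right pure_smult_left pure_smult_right

lemma unit_mult:
  "\<lbrakk>a \<in> carrier P; b \<in> carrier Q; a' \<in> carrier P; b' \<in> carrier Q; c \<in> carrier K\<rbrakk> \<Longrightarrow>
    free_single K (a, b) c \<otimes>\<^bsub>F\<^esub> unit a' b' = free_single K (a \<otimes>\<^bsub>P\<^esub> a', b \<otimes>\<^bsub>Q\<^esub> b') c"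
  by (simp add: F.single_mult)

text \<open>Multiplication by a basis element followed by the projection to cosets is the lift of
  the bilinear map in the interpretation of \<open>h\<close>, and lifts kill the relations.\<close>

lemma rels_mult_unit:
  assumes x: "x \<in> N" and ab: "a0 \<in> carrier P" "b0 \<in> carrier Q"
  shows "x \<otimes>\<^bsub>F\<^esub> unit a0 b0 \<in> N"
proof -
  interpret h: tensor_lift K P Q T "\<lambda>a b. pure (a \<otimes>\<^bsub>P\<^esub> a0) (b \<otimes>\<^bsub>Q\<^esub> b0)"
    by unfold_locales (use ab in \<open>simp_all add: pure_bilinear P.l_distr Q.l_distr P.smult_assoc2 Q.smult_assoc2\<close>)
  note u = unit_closed[OF ab]
  have xF: "x \<in> carrier F" using x Qm.N.a_subset by blast
  have "N +>\<^bsub>F\<^esub> (x \<otimes>\<^bsub>F\<^esub> unit a0 b0) = h.free_lift x"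
    by (rule h.free_lift_unique[OF xF])
      (use ab u in \<open>auto simp: FA.l_distr coset_add coset_closed unit_mult coset_single pure_smult_left\<close>)
  then show ?thesis using h.free_lift_rels[OF x] u xF Qm.coset_zero_iff by (simp add: tensor_zero)
qed

lemma free_generated:
  assumes "y \<in> carrier F"
    and "\<And>a b. \<lbrakk>a \<in> carrier P; b \<in> carrier Q\<rbrakk> \<Longrightarrow> G (unit a b)"
    and "\<And>c y. \<lbrakk>c \<in> carrier K; y \<in> carrier F; G y\<rbrakk> \<Longrightarrow> G (c \<odot>\<^bsub>F\<^esub> y)"
    and "\<And>x y. \<lbrakk>x \<in> carrier F; y \<in> carrier F; G x; G y\<rbrakk> \<Longrightarrow> G (x \<oplus>\<^bsub>F\<^esub> y)"
  shows "G y"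
  using assms(1)[unfolded F.alg_simps(1)]
proof (induction rule: K.free_induct)
  case zero
  have u: "unit \<zero>\<^bsub>P\<^esub> \<zero>\<^bsub>Q\<^esub> \<in> carrier F" "G (unit \<zero>\<^bsub>P\<^esub> \<zero>\<^bsub>Q\<^esub>)" by (auto intro: unit_closed assms(2))
  have "G (\<zero>\<^bsub>K\<^esub> \<odot>\<^bsub>F\<^esub> unit \<zero>\<^bsub>P\<^esub> \<zero>\<^bsub>Q\<^esub>)" by (rule assms(3)[OF _ u]) simp
  then have "G \<zero>\<^bsub>F\<^esub>" using u(1) by (simp only: FA.smult_l_null)
  then show ?case by (simp only: F.alg_simps(2))
next
  case (single s c)
  obtain a b where s: "s = (a, b)" "a \<in> carrier P" "b \<in> carrier Q" using single by auto
  have "G (c \<odot>\<^bsub>F\<^esub> unit a b)" using assms(2,3) s single unit_closed by blast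
  then show ?case unfolding s using single_eq[OF s(2,3) single(2)] by simp
next
  case (add x y)
  then have xy: "x \<in> carrier F" "y \<in> carrier F" by (simp_all only: F.alg_simps(1))
  show ?case unfolding F.alg_simps(3)[symmetric] by (rule assms(4)[OF xy]) (use add in auto)
qed

lemma rels_mult:
  assumes x: "x \<in> N" and y: "y \<in> carrier F"
  shows "x \<otimes>\<^bsub>F\<^esub> y \<in> N"
proof -
  have xF: "x \<in> carrier F" using x Qm.N.a_subset by blast
  show ?thesis using y
  proof (rule free_generated)
    show "x \<otimes>\<^bsub>F\<^esub> (c \<odot>\<^bsub>F\<^esub> y) \<in> N" if "c \<in> carrier K" "y \<in> carrier F" "x \<otimes>\<^bsub>F\<^esub> y \<in> N" for c y
    proof -
      have "x \<otimes>\<^bsub>F\<^esub> (c \<odot>\<^bsub>F\<^esub> y) = c \<odot>\<^bsub>F\<^esub> (x \<otimes>\<^bsub>F\<^esub> y)"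
        using that xF FA.smult_assoc2[of c y x] by (simp add: FA.m_comm)
      then show ?thesis using that FA.submoduleE(4)[OF rels_submodule] by simp
    qed
  qed (use x xF in \<open>auto simp: FA.r_distr rels_mult_unit intro: Qm.N.a_closed\<close>)
qed

lemma rels_ideal: "ideal N F"
proof (rule idealI)
  show "subgroup N (add_monoid F)" using rels_submodule by (simp add: submodule_def)
  show "a \<in> N \<Longrightarrow> x \<in> carrier F \<Longrightarrow> x \<otimes>\<^bsub>F\<^esub> a \<in> N" for a x
    using rels_mult Qm.N.a_subset by (auto simp: FA.m_comm subset_iff)
qed (auto intro: rels_mult FA.ring_axioms)

lemma tensor_cring: "cring T"
  by (rule cring_cong[OF _ _ _ _ _ ideal.quotient_is_cring[OF rels_ideal F.alg_cring]])
    (simp_all add: tensor_simps quot_module_simps FactRing_def)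

lemma coset_mult:
  "\<lbrakk>x \<in> carrier F; y \<in> carrier F\<rbrakk> \<Longrightarrow> (N +>\<^bsub>F\<^esub> x) \<otimes>\<^bsub>T\<^esub> (N +>\<^bsub>F\<^esub> y) = N +>\<^bsub>F\<^esub> (x \<otimes>\<^bsub>F\<^esub> y)"
  using ideal.rcoset_mult_add[OF rels_ideal] by (simp add: tensor_simps quot_module_simps)

sublocale TR: algebra K T
proof (rule algebraI[OF K.is_cring tensor_cring])
  show "(c \<odot>\<^bsub>T\<^esub> U) \<otimes>\<^bsub>T\<^esub> V = c \<odot>\<^bsub>T\<^esub> (U \<otimes>\<^bsub>T\<^esub> V)"
    if "c \<in> carrier K" "U \<in> carrier T" "V \<in> carrier T" for c U V
    using that by (elim tensor_cases) (simp add: coset_smult coset_mult FA.smult_assoc2)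
qed (simp_all add: T.smult_l_distr T.smult_r_distr T.smult_assoc1)

lemma pure_mult:
  "\<lbrakk>a \<in> carrier P; b \<in> carrier Q; a' \<in> carrier P; b' \<in> carrier Q\<rbrakk> \<Longrightarrow>
    pure a b \<otimes>\<^bsub>T\<^esub> pure a' b' = pure (a \<otimes>\<^bsub>P\<^esub> a') (b \<otimes>\<^bsub>Q\<^esub> b')"
  unfolding pure_eq by (simp add: coset_mult unit_closed unit_mult)

lemma pure_one: "\<one>\<^bsub>T\<^esub> = pure \<one>\<^bsub>P\<^esub> \<one>\<^bsub>Q\<^esub>"
  by (simp add: tensor_simps quot_module_simps pure_eq F.alg_simps)

lemma pure_minus_left: "\<lbrakk>a \<in> carrier P; b \<in> carrier Q\<rbrakk> \<Longrightarrow> pure (\<ominus>\<^bsub>P\<^esub> a) b = \<ominus>\<^bsub>T\<^esub> pure a b"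
  using pure_smult_left[of "\<ominus>\<^bsub>K\<^esub> \<one>\<^bsub>K\<^esub>" a b] by (simp add: P.smult_l_minus T.smult_l_minus)

lemma pure_minus_right: "\<lbrakk>a \<in> carrier P; b \<in> carrier Q\<rbrakk> \<Longrightarrow> pure a (\<ominus>\<^bsub>Q\<^esub> b) = \<ominus>\<^bsub>T\<^esub> pure a b"
  using pure_smult_right[of "\<ominus>\<^bsub>K\<^esub> \<one>\<^bsub>K\<^esub>" a b] by (simp add: Q.smult_l_minus T.smult_l_minus)

abbreviation "bracket_unit \<equiv> (\<lambda>(a, b) (a', b').
     free_unit K (\<lbrace>a, a'\<rbrace>\<^bsub>P\<^esub>, b \<otimes>\<^bsub>Q\<^esub> b') \<oplus>\<^bsub>F\<^esub> free_unit K (a \<otimes>\<^bsub>P\<^esub> a', \<lbrace>b, b'\<rbrace>\<^bsub>Q\<^esub>))"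

sublocale br: bilinear_family K "carrier P \<times> carrier Q" "carrier P \<times> carrier Q" bracket_unit
proof unfold_locales
  fix s t assume "s \<in> carrier P \<times> carrier Q" "t \<in> carrier P \<times> carrier Q"
  then have "bracket_unit s t \<in> carrier F"
    by (cases s; cases t) (auto simp: free_unit_eq_single unit_closed P.bracket_closed Q.bracket_closed)
  then show "bracket_unit s t \<in> free_carrier K (carrier P \<times> carrier Q)" by (simp add: F.alg_simps)
qed

abbreviation "fbr \<equiv> tensor_free_bracket K P Q"

lemma fbr_closed: "\<lbrakk>x \<in> carrier F; y \<in> carrier F\<rbrakk> \<Longrightarrow> fbr x y \<in> carrier F"
  using br.bilin_ext_closed by (simp add: tensor_free_bracket_def F.alg_simps)

lemma fbr_add:
  assumes "x \<in> carrier F" "y \<in> carrier F" "z \<in> carrier F"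
  shows "fbr (x \<oplus>\<^bsub>F\<^esub> y) z = fbr x z \<oplus>\<^bsub>F\<^esub> fbr y z" "fbr z (x \<oplus>\<^bsub>F\<^esub> y) = fbr z x \<oplus>\<^bsub>F\<^esub> fbr z y"
  using assms br.bilin_ext_add_left[of x y z] br.bilin_ext_add_right[of x y z]
  by (simp_all add: tensor_free_bracket_def F.alg_simps)

lemma fbr_single:
  assumes "a \<in> carrier P" "b \<in> carrier Q" "a' \<in> carrier P" "b' \<in> carrier Q" "c \<in> carrier K" "d \<in> carrier K"
  shows "N +>\<^bsub>F\<^esub> fbr (free_single K (a, b) c) (free_single K (a', b') d) =
    (c \<otimes>\<^bsub>K\<^esub> d) \<odot>\<^bsub>T\<^esub> (pure \<lbrace>a, a'\<rbrace>\<^bsub>P\<^esub> (b \<otimes>\<^bsub>Q\<^esub> b') \<oplus>\<^bsub>T\<^esub> pure (a \<otimes>\<^bsub>P\<^esub> a') \<lbrace>b, b'\<rbrace>\<^bsub>Q\<^esub>)"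
proof -
  have "fbr (free_single K (a, b) c) (free_single K (a', b') d) =
      (c \<otimes>\<^bsub>K\<^esub> d) \<odot>\<^bsub>F\<^esub> (unit \<lbrace>a, a'\<rbrace>\<^bsub>P\<^esub> (b \<otimes>\<^bsub>Q\<^esub> b') \<oplus>\<^bsub>F\<^esub> unit (a \<otimes>\<^bsub>P\<^esub> a') \<lbrace>b, b'\<rbrace>\<^bsub>Q\<^esub>)"
    using assms br.bilin_ext_single[of "(a, b)" "(a', b')" c d]
    by (simp add: tensor_free_bracket_def F.alg_simps(4) free_unit_eq_single)
  then show ?thesis
    using assms unfolding pure_eq
    by (simp add: coset_smult coset_add unit_closed P.bracket_closed Q.bracket_closed)
qed

text \<open>The same device as for the product: with the second argument a multiple of a basis
  element, the bracket formula is bilinear in \<open>(a, b)\<close> once it is read in the quotient,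
  so it factors through a lift.\<close>

lemma fbr_rels_left:
  assumes x: "x \<in> N" and y: "y \<in> carrier F" shows "fbr x y \<in> N"
proof -
  have xF: "x \<in> carrier F" using x Qm.N.a_subset by blast
  show ?thesis using y[unfolded F.alg_simps(1)]
  proof (induction rule: K.free_induct)
    case zero
    have "fbr x (\<lambda>_. \<zero>\<^bsub>K\<^esub>) = \<zero>\<^bsub>F\<^esub>" using br.bilin_ext_zero by (simp add: tensor_free_bracket_def F.alg_simps)
    then show ?case by simp
  next
    case (single s d)
    obtain a0 b0 where s: "s = (a0, b0)" "a0 \<in> carrier P" "b0 \<in> carrier Q" using single by auto
    interpret h: tensor_lift K P Q T "\<lambda>a b. d \<odot>\<^bsub>T\<^esub> (pure \<lbrace>a, a0\<rbrace>\<^bsub>P\<^esub> (b \<otimes>\<^bsub>Q\<^esub> b0) \<oplus>\<^bsub>T\<^esub> pure (a \<otimes>\<^bsub>P\<^esub> a0) \<lbrace>b, b0\<rbrace>\<^bsub>Q\<^esub>)"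
      by unfold_locales
        (use s single in \<open>simp_all add: pure_bilinear P.l_distr Q.l_distr P.smult_assoc2 Q.smult_assoc2
          P.bracket_closed Q.bracket_closed P.bracket_add Q.bracket_add P.bracket_smult Q.bracket_smult
          T.smult_r_distr T.a_ac T.smult_assoc1[symmetric] K.m_comm\<close>)
    have sF: "free_single K s d \<in> carrier F" using single by (simp add: F.alg_simps K.free_single_closed)
    have "N +>\<^bsub>F\<^esub> fbr x (free_single K s d) = h.free_lift x"
      by (rule h.free_lift_unique[OF xF])
        (use s single sF in \<open>auto simp: fbr_add fbr_closed coset_add coset_closed fbr_single
          T.smult_assoc1 P.bracket_closed Q.bracket_closed\<close>)
    then show ?case using h.free_lift_rels[OF x] sF xF Qm.coset_zero_iff fbr_closed by (simp add: tensor_zero)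
  next
    case (add y z)
    then have "y \<in> carrier F" "z \<in> carrier F" by (simp_all only: F.alg_simps(1))
    then show ?case unfolding F.alg_simps(3)[symmetric] using add xF by (simp add: fbr_add Qm.N.a_closed)
  qed
qed

text \<open>This does not reduce to the first argument by antisymmetry: the basis element of a
  negated pair is not the negative of a basis element in the free space, so antisymmetry appears
  only in the quotient. Hence a bilinear map of its own.\<close>

lemma fbr_rels_right:
  assumes x: "x \<in> N" and y: "y \<in> carrier F" shows "fbr y x \<in> N"
proof -
  have xF: "x \<in> carrier F" using x Qm.N.a_subset by blast
  show ?thesis using y[unfolded F.alg_simps(1)]
  proof (induction rule: K.free_induct)
    case zero
    have "fbr (\<lambda>_. \<zero>\<^bsub>K\<^esub>) x = \<zero>\<^bsub>F\<^esub>" using br.bilin_ext_zero by (simp add: tensor_free_bracket_def F.alg_simps)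
    then show ?case by simp
  next
    case (single s d)
    obtain a0 b0 where s: "s = (a0, b0)" "a0 \<in> carrier P" "b0 \<in> carrier Q" using single by auto
    interpret h: tensor_lift K P Q T "\<lambda>a b. d \<odot>\<^bsub>T\<^esub> (pure \<lbrace>a0, a\<rbrace>\<^bsub>P\<^esub> (b0 \<otimes>\<^bsub>Q\<^esub> b) \<oplus>\<^bsub>T\<^esub> pure (a0 \<otimes>\<^bsub>P\<^esub> a) \<lbrace>b0, b\<rbrace>\<^bsub>Q\<^esub>)"
      by unfold_locales
        (use s single in \<open>simp_all add: pure_bilinear P.m_comm[of a0] Q.m_comm[of b0]
          P.l_distr Q.l_distr P.smult_assoc2 Q.smult_assoc2
          P.bracket_closed Q.bracket_closed P.bracket_simps Q.bracket_simps
          T.smult_r_distr T.a_ac T.smult_assoc1[symmetric] K.m_comm\<close>)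
    have sF: "free_single K s d \<in> carrier F" using single by (simp add: F.alg_simps K.free_single_closed)
    have "N +>\<^bsub>F\<^esub> fbr (free_single K s d) x = h.free_lift x"
      by (rule h.free_lift_unique[OF xF])
        (use s single sF in \<open>auto simp: fbr_add fbr_closed coset_add coset_closed fbr_single
          T.smult_assoc1[symmetric] K.m_comm P.bracket_closed Q.bracket_closed\<close>)
    then show ?case using h.free_lift_rels[OF x] sF xF Qm.coset_zero_iff fbr_closed by (simp add: tensor_zero)
  next
    case (add y z)
    then have "y \<in> carrier F" "z \<in> carrier F" by (simp_all only: F.alg_simps(1))
    then show ?case unfolding F.alg_simps(3)[symmetric] using add xF by (simp add: fbr_add Qm.N.a_closed)
  qed
qed

lemma coset_bracket:
  assumes x: "x \<in> carrier F" and y: "y \<in> carrier F"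
  shows "\<lbrace>N +>\<^bsub>F\<^esub> x, N +>\<^bsub>F\<^esub> y\<rbrace>\<^bsub>T\<^esub> = N +>\<^bsub>F\<^esub> fbr x y"
proof -
  have "N +>\<^bsub>F\<^esub> fbr x' y' = N +>\<^bsub>F\<^esub> fbr x y" if x': "x' \<in> N +>\<^bsub>F\<^esub> x" and y': "y' \<in> N +>\<^bsub>F\<^esub> y" for x' y'
  proof -
    obtain n where n: "n \<in> N" "x' = n \<oplus>\<^bsub>F\<^esub> x" using x' unfolding Qm.mem_coset by blast
    obtain m where m: "m \<in> N" "y' = m \<oplus>\<^bsub>F\<^esub> y" using y' unfolding Qm.mem_coset by blast
    have nm: "n \<in> carrier F" "m \<in> carrier F" using n m Qm.N.a_subset by auto
    \<comment> \<open>Expanding by biadditivity leaves three terms with an argument in the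
      relations; they account for the whole change of representatives.\<close>
    have "fbr x' y' = (fbr n m \<oplus>\<^bsub>F\<^esub> fbr n y \<oplus>\<^bsub>F\<^esub> fbr x m) \<oplus>\<^bsub>F\<^esub> fbr x y"
      using n m nm x y by (simp add: fbr_add fbr_closed FA.a_ac)
    moreover have "fbr n m \<oplus>\<^bsub>F\<^esub> fbr n y \<oplus>\<^bsub>F\<^esub> fbr x m \<in> N"
      using n m nm x y by (simp add: fbr_rels_left fbr_rels_right Qm.N.a_closed)
    ultimately have "fbr x' y' \<in> N +>\<^bsub>F\<^esub> fbr x y" unfolding Qm.mem_coset by blast
    then show ?thesis using Qm.N.a_repr_independence' fbr_closed[OF x y] by blast
  qed
  moreover have "x \<in> N +>\<^bsub>F\<^esub> x" "y \<in> N +>\<^bsub>F\<^esub> y" using x y Qm.N.a_rcos_self by auto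
  ultimately show ?thesis unfolding tensor_simps(7) by blast
qed

lemma bracket_closed: "\<lbrakk>U \<in> carrier T; V \<in> carrier T\<rbrakk> \<Longrightarrow> \<lbrace>U, V\<rbrace>\<^bsub>T\<^esub> \<in> carrier T"
  by (elim tensor_cases) (simp add: coset_bracket coset_closed fbr_closed)

lemma bracket_add:
  assumes "U \<in> carrier T" "V \<in> carrier T" "Z \<in> carrier T"
  shows "\<lbrace>U \<oplus>\<^bsub>T\<^esub> V, Z\<rbrace>\<^bsub>T\<^esub> = \<lbrace>U, Z\<rbrace>\<^bsub>T\<^esub> \<oplus>\<^bsub>T\<^esub> \<lbrace>V, Z\<rbrace>\<^bsub>T\<^esub>" "\<lbrace>Z, U \<oplus>\<^bsub>T\<^esub> V\<rbrace>\<^bsub>T\<^esub> = \<lbrace>Z, U\<rbrace>\<^bsub>T\<^esub> \<oplus>\<^bsub>T\<^esub> \<lbrace>Z, V\<rbrace>\<^bsub>T\<^esub>"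
  using assms by (elim tensor_cases; simp add: coset_bracket coset_add fbr_closed fbr_add)+

lemma bracket_pure:
  "\<lbrakk>a \<in> carrier P; b \<in> carrier Q; a' \<in> carrier P; b' \<in> carrier Q\<rbrakk> \<Longrightarrow>
    \<lbrace>pure a b, pure a' b'\<rbrace>\<^bsub>T\<^esub> = pure \<lbrace>a, a'\<rbrace>\<^bsub>P\<^esub> (b \<otimes>\<^bsub>Q\<^esub> b') \<oplus>\<^bsub>T\<^esub> pure (a \<otimes>\<^bsub>P\<^esub> a') \<lbrace>b, b'\<rbrace>\<^bsub>Q\<^esub>"
  using fbr_single[of a b a' b' "\<one>\<^bsub>K\<^esub>" "\<one>\<^bsub>K\<^esub>"]
  by (simp add: coset_bracket unit_closed pure_eq[of a b] pure_eq[of a' b'] P.bracket_closed Q.bracket_closed)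

lemma bracket_antisym:
  assumes "U \<in> carrier T" "V \<in> carrier T"
  shows "\<lbrace>V, U\<rbrace>\<^bsub>T\<^esub> = \<ominus>\<^bsub>T\<^esub> \<lbrace>U, V\<rbrace>\<^bsub>T\<^esub>"
  using assms(1)
proof (induction rule: tensor_induct)
  case (pure a b)
  show ?case using assms(2)
  proof (induction rule: tensor_induct)
    case (pure a' b')
    then show ?case using \<open>a \<in> carrier P\<close> \<open>b \<in> carrier Q\<close>
        P.bracket_antisym[of a a'] Q.bracket_antisym[of b b']
      by (simp add: bracket_pure P.bracket_closed Q.bracket_closed pure_minus_left pure_minus_right
          P.m_comm Q.m_comm T.minus_add)
  qed (use \<open>a \<in> carrier P\<close> \<open>b \<in> carrier Q\<close> in \<open>simp add: bracket_add bracket_closed T.minus_add\<close>)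
qed (use assms(2) in \<open>simp add: bracket_add bracket_closed T.minus_add\<close>)

lemma bracket_leibniz:
  assumes "U \<in> carrier T" "V \<in> carrier T" "Z \<in> carrier T"
  shows "\<lbrace>U \<otimes>\<^bsub>T\<^esub> V, Z\<rbrace>\<^bsub>T\<^esub> = U \<otimes>\<^bsub>T\<^esub> \<lbrace>V, Z\<rbrace>\<^bsub>T\<^esub> \<oplus>\<^bsub>T\<^esub> \<lbrace>U, Z\<rbrace>\<^bsub>T\<^esub> \<otimes>\<^bsub>T\<^esub> V"
  using assms(1)
proof (induction rule: tensor_induct)
  case (pure a b)
  note ab = pure
  show ?case using assms(2)
  proof (induction rule: tensor_induct)
    case (pure a' b')
    note ab' = pure
    show ?case using assms(3)
    proof (induction rule: tensor_induct)
      case (pure c d)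
      then show ?case using ab ab'
        by (simp add: bracket_pure pure_mult P.bracket_closed Q.bracket_closed P.bracket_leibniz
            Q.bracket_leibniz pure_add_left pure_add_right TR.r_distr TR.l_distr P.m_ac Q.m_ac T.a_ac)
    qed (use ab ab' in \<open>simp add: bracket_add bracket_closed TR.r_distr TR.l_distr T.a_ac\<close>)
  qed (use ab assms in \<open>simp add: bracket_add bracket_closed TR.r_distr TR.l_distr T.a_ac\<close>)
qed (use assms in \<open>simp add: bracket_add bracket_closed TR.r_distr TR.l_distr T.a_ac\<close>)

end


section \<open>Functoriality of the tensor product\<close>

definition lin_map ::
    "('k, 'x) ring_scheme \<Rightarrow> ('k, 'a, 'y) module_scheme \<Rightarrow> ('k, 'b, 'z) module_scheme \<Rightarrow> ('a \<Rightarrow> 'b) \<Rightarrow> bool" where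
  "lin_map K M M' f \<longleftrightarrow> (\<forall>x\<in>carrier M. f x \<in> carrier M') \<and>
     (\<forall>x\<in>carrier M. \<forall>y\<in>carrier M. f (x \<oplus>\<^bsub>M\<^esub> y) = f x \<oplus>\<^bsub>M'\<^esub> f y) \<and>
     (\<forall>c\<in>carrier K. \<forall>x\<in>carrier M. f (c \<odot>\<^bsub>M\<^esub> x) = c \<odot>\<^bsub>M'\<^esub> f x)"

lemma lin_mapD:
  assumes "lin_map K M M' f"
  shows "x \<in> carrier M \<Longrightarrow> f x \<in> carrier M'"
    "\<lbrakk>x \<in> carrier M; y \<in> carrier M\<rbrakk> \<Longrightarrow> f (x \<oplus>\<^bsub>M\<^esub> y) = f x \<oplus>\<^bsub>M'\<^esub> f y"
    "\<lbrakk>c \<in> carrier K; x \<in> carrier M\<rbrakk> \<Longrightarrow> f (c \<odot>\<^bsub>M\<^esub> x) = c \<odot>\<^bsub>M'\<^esub> f x"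
  using assms by (auto simp: lin_map_def)

lemma poisson_homD:
  assumes "f \<in> poisson_hom K P Q"
  shows "x \<in> carrier P \<Longrightarrow> f x \<in> carrier Q"
    "\<lbrakk>x \<in> carrier P; y \<in> carrier P\<rbrakk> \<Longrightarrow> f (x \<oplus>\<^bsub>P\<^esub> y) = f x \<oplus>\<^bsub>Q\<^esub> f y"
    "\<lbrakk>x \<in> carrier P; y \<in> carrier P\<rbrakk> \<Longrightarrow> f (x \<otimes>\<^bsub>P\<^esub> y) = f x \<otimes>\<^bsub>Q\<^esub> f y"
    "f \<one>\<^bsub>P\<^esub> = \<one>\<^bsub>Q\<^esub>"
    "\<lbrakk>c \<in> carrier K; x \<in> carrier P\<rbrakk> \<Longrightarrow> f (c \<odot>\<^bsub>P\<^esub> x) = c \<odot>\<^bsub>Q\<^esub> f x"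
    "\<lbrakk>x \<in> carrier P; y \<in> carrier P\<rbrakk> \<Longrightarrow> f \<lbrace>x, y\<rbrace>\<^bsub>P\<^esub> = \<lbrace>f x, f y\<rbrace>\<^bsub>Q\<^esub>"
  using assms by (auto simp: poisson_hom_def ring_hom_def)

lemma poisson_homI:
  assumes "\<And>x. x \<in> carrier P \<Longrightarrow> f x \<in> carrier Q"
    "\<And>x y. \<lbrakk>x \<in> carrier P; y \<in> carrier P\<rbrakk> \<Longrightarrow> f (x \<oplus>\<^bsub>P\<^esub> y) = f x \<oplus>\<^bsub>Q\<^esub> f y"
    "\<And>x y. \<lbrakk>x \<in> carrier P; y \<in> carrier P\<rbrakk> \<Longrightarrow> f (x \<otimes>\<^bsub>P\<^esub> y) = f x \<otimes>\<^bsub>Q\<^esub> f y"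
    "f \<one>\<^bsub>P\<^esub> = \<one>\<^bsub>Q\<^esub>"
    "\<And>c x. \<lbrakk>c \<in> carrier K; x \<in> carrier P\<rbrakk> \<Longrightarrow> f (c \<odot>\<^bsub>P\<^esub> x) = c \<odot>\<^bsub>Q\<^esub> f x"
    "\<And>x y. \<lbrakk>x \<in> carrier P; y \<in> carrier P\<rbrakk> \<Longrightarrow> f \<lbrace>x, y\<rbrace>\<^bsub>P\<^esub> = \<lbrace>f x, f y\<rbrace>\<^bsub>Q\<^esub>"
  shows "f \<in> poisson_hom K P Q"
  using assms by (simp add: poisson_hom_def ring_hom_memI)

lemma poisson_hom_lin_map: "f \<in> poisson_hom K P Q \<Longrightarrow> lin_map K P Q f"
  using poisson_homD[of f K P Q] unfolding lin_map_def by blast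

context cring
begin

lemma lin_ext_apply: "lin_ext R \<beta> x u = supp_sum R R (\<lambda>s c. c \<otimes> \<beta> s u) x"
  by (simp add: lin_ext_def supp_sum_def)

lemma lin_ext_family:
  assumes "\<And>s. s \<in> S \<Longrightarrow> \<beta> s \<in> free_carrier R S'"
  shows "additive_family R R S (\<lambda>s c. c \<otimes> \<beta> s u)"
proof -
  have "\<beta> s u \<in> carrier R" if "s \<in> S" for s using free_carrierD(1)[OF assms[OF that]] .
  then show ?thesis by unfold_locales (auto simp: l_distr)
qed

lemma lin_ext_add:
  assumes "\<And>s. s \<in> S \<Longrightarrow> \<beta> s \<in> free_carrier R S'" "x \<in> free_carrier R S" "y \<in> free_carrier R S"
  shows "lin_ext R \<beta> (\<lambda>s. x s \<oplus> y s) = (\<lambda>u. lin_ext R \<beta> x u \<oplus> lin_ext R \<beta> y u)"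
  by (rule ext) (simp add: lin_ext_apply additive_family.supp_sum_add[OF lin_ext_family[of S \<beta> S']] assms)

lemma lin_ext_single:
  assumes "\<And>s. s \<in> S \<Longrightarrow> \<beta> s \<in> free_carrier R S'" "s \<in> S" "c \<in> carrier R"
  shows "lin_ext R \<beta> (free_single R s c) = (\<lambda>u. c \<otimes> \<beta> s u)"
  by (rule ext) (simp add: lin_ext_apply additive_family.supp_sum_single[OF lin_ext_family[of S \<beta> S']] assms)

lemma lin_ext_closed:
  assumes \<beta>: "\<And>s. s \<in> S \<Longrightarrow> \<beta> s \<in> free_carrier R S'" and x: "x \<in> free_carrier R S"
  shows "lin_ext R \<beta> x \<in> free_carrier R S'"
  using x
proof (induction rule: free_induct)
  case zero
  then show ?case by (simp add: lin_ext_def fun_supp_def free_zero_closed)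
next
  case (single s c)
  then show ?case
    by (simp add: lin_ext_single[OF \<beta>] free_map_closed[OF \<beta>, of s "\<lambda>k. c \<otimes> k"])
next
  case (add x y)
  then show ?case by (simp add: lin_ext_add[OF \<beta>] free_add_closed)
qed

end

text \<open>Stated for linear maps, so that it covers the linear retraction of B onto A, which need
  not be multiplicative. Morphisms of Poisson algebras are treated afterwards as a special
  case.\<close>

locale tensor_mapping = A: tensor_pair K P Q + A': tensor_pair K P' Q'
  for K :: "('k, 'x) ring_scheme" and P :: "('k, 'a, 'y) palg_scheme" and Q :: "('k, 'b, 'z) palg_scheme"
    and P' :: "('k, 'c, 'v) palg_scheme" and Q' :: "('k, 'd, 'w) palg_scheme" +
  fixes f g
  assumes f: "lin_map K P P' f" and g: "lin_map K Q Q' g"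
begin

sublocale h: tensor_lift K P Q A'.T "\<lambda>a b. A'.pure (f a) (g b)"
  by unfold_locales (use f g in \<open>simp_all add: A'.pure_bilinear lin_mapD\<close>)

abbreviation "tm \<equiv> tensor_map K P' Q' f g"

text \<open>\<open>tensor_map\<close> is a union over all representatives of a coset. By uniqueness
  of the lift every representative contributes the same coset, so the union is this single
  value.\<close>

lemma tensor_map_eq_lift:
  assumes U: "U \<in> carrier A.T"
  shows "tm U = h.lift U"
proof -
  let ?\<beta> = "\<lambda>(a, b). free_unit K (f a, g b)"
  have \<beta>: "?\<beta> s \<in> free_carrier K (carrier P' \<times> carrier Q')" if "s \<in> carrier P \<times> carrier Q" for s
    using that f g by (auto simp: free_unit_eq_single lin_mapD intro!: A.K.free_single_closed)
  have l: "A'.N +>\<^bsub>A'.F\<^esub> lin_ext K ?\<beta> x = h.free_lift x" if x: "x \<in> carrier A.F" for x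
  proof (rule h.free_lift_unique[OF x])
    have cl: "lin_ext K ?\<beta> x \<in> carrier A'.F" if "x \<in> carrier A.F" for x
      using that A.K.lin_ext_closed[OF \<beta>] by (simp add: A.F.alg_simps A'.F.alg_simps)
    then show "A'.N +>\<^bsub>A'.F\<^esub> lin_ext K ?\<beta> x \<in> carrier A'.T" if "x \<in> carrier A.F" for x
      using that by (simp add: A'.coset_closed)
    fix x y assume xy: "x \<in> carrier A.F" "y \<in> carrier A.F"
    have "lin_ext K ?\<beta> (x \<oplus>\<^bsub>A.F\<^esub> y) = lin_ext K ?\<beta> x \<oplus>\<^bsub>A'.F\<^esub> lin_ext K ?\<beta> y"
      using xy A.K.lin_ext_add[OF \<beta>] by (simp add: A.F.alg_simps A'.F.alg_simps)
    then show "A'.N +>\<^bsub>A'.F\<^esub> lin_ext K ?\<beta> (x \<oplus>\<^bsub>A.F\<^esub> y) =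
        (A'.N +>\<^bsub>A'.F\<^esub> lin_ext K ?\<beta> x) \<oplus>\<^bsub>A'.T\<^esub> (A'.N +>\<^bsub>A'.F\<^esub> lin_ext K ?\<beta> y)"
      using cl xy by (simp add: A'.coset_add)
  next
    fix a b c assume abc: "a \<in> carrier P" "b \<in> carrier Q" "c \<in> carrier K"
    then have "lin_ext K ?\<beta> (free_single K (a, b) c) = c \<odot>\<^bsub>A'.F\<^esub> A'.unit (f a) (g b)"
      using A.K.lin_ext_single[OF \<beta>, where s = "(a, b)" and c = c] by (simp add: A'.F.alg_simps free_unit_eq_single)
    then show "A'.N +>\<^bsub>A'.F\<^esub> lin_ext K ?\<beta> (free_single K (a, b) c) = c \<odot>\<^bsub>A'.T\<^esub> A'.pure (f a) (g b)"
      using abc lin_mapD(1)[OF f] lin_mapD(1)[OF g]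
      by (simp add: A'.pure_eq A'.coset_smult A'.unit_closed)
  qed
  obtain x where x: "x \<in> carrier A.F" "U = A.N +>\<^bsub>A.F\<^esub> x" using U by (rule A.tensor_cases)
  have const: "A'.N +>\<^bsub>A'.F\<^esub> lin_ext K ?\<beta> y = h.lift U" if y: "y \<in> U" for y
  proof -
    have "y \<in> carrier A.F" using y x A.Qm.N.a_elemrcos_carrier[of x y] by auto
    moreover have "U = A.N +>\<^bsub>A.F\<^esub> y" using x y A.Qm.N.a_repr_independence' by blast
    ultimately show ?thesis by (simp only: l h.lift_coset)
  qed
  have "U \<noteq> {}" using x A.Qm.N.a_rcos_self by blast
  then show ?thesis unfolding tensor_map_def using const by (rule SUP_eq_const)
qed

lemma map_pure: "\<lbrakk>a \<in> carrier P; b \<in> carrier Q\<rbrakk> \<Longrightarrow> tm (A.pure a b) = A'.pure (f a) (g b)"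
  by (simp add: tensor_map_eq_lift h.lift_pure)

lemma map_closed: "U \<in> carrier A.T \<Longrightarrow> tm U \<in> carrier A'.T"
  by (simp add: tensor_map_eq_lift h.lift_closed)

lemma map_add: "\<lbrakk>U \<in> carrier A.T; V \<in> carrier A.T\<rbrakk> \<Longrightarrow> tm (U \<oplus>\<^bsub>A.T\<^esub> V) = tm U \<oplus>\<^bsub>A'.T\<^esub> tm V"
  by (simp add: tensor_map_eq_lift h.lift_add)

lemma map_smult: "\<lbrakk>c \<in> carrier K; U \<in> carrier A.T\<rbrakk> \<Longrightarrow> tm (c \<odot>\<^bsub>A.T\<^esub> U) = c \<odot>\<^bsub>A'.T\<^esub> tm U"
  by (simp add: tensor_map_eq_lift h.lift_smult)

lemma tensor_map_poisson_hom:
  assumes f': "f \<in> poisson_hom K P P'" and g': "g \<in> poisson_hom K Q Q'"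
  shows "tm \<in> poisson_hom K A.T A'.T"
proof (rule poisson_homI)
  note fg = poisson_homD[OF f'] poisson_homD[OF g']
  show "tm \<one>\<^bsub>A.T\<^esub> = \<one>\<^bsub>A'.T\<^esub>" by (simp add: A.pure_one A'.pure_one map_pure fg)
  fix U V assume U: "U \<in> carrier A.T" and V: "V \<in> carrier A.T"
  show "tm (U \<otimes>\<^bsub>A.T\<^esub> V) = tm U \<otimes>\<^bsub>A'.T\<^esub> tm V"
    using U
  proof (induction rule: A.tensor_induct)
    case (pure a b)
    show ?case using V
    proof (induction rule: A.tensor_induct)
      case (pure a' b')
      then show ?case using \<open>a \<in> carrier P\<close> \<open>b \<in> carrier Q\<close>
        by (simp add: A.pure_mult A'.pure_mult map_pure fg)
    qed (use \<open>a \<in> carrier P\<close> \<open>b \<in> carrier Q\<close> in \<open>simp add: A.TR.r_distr A'.TR.r_distr map_add map_closed\<close>)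
  qed (use V in \<open>simp add: A.TR.l_distr A'.TR.l_distr map_add map_closed\<close>)
  show "tm \<lbrace>U, V\<rbrace>\<^bsub>A.T\<^esub> = \<lbrace>tm U, tm V\<rbrace>\<^bsub>A'.T\<^esub>"
    using U
  proof (induction rule: A.tensor_induct)
    case (pure a b)
    show ?case using V
    proof (induction rule: A.tensor_induct)
      case (pure a' b')
      then show ?case using \<open>a \<in> carrier P\<close> \<open>b \<in> carrier Q\<close>
        by (simp add: A.bracket_pure A'.bracket_pure map_pure map_add fg
            A.P.bracket_closed A.Q.bracket_closed)
    qed (use \<open>a \<in> carrier P\<close> \<open>b \<in> carrier Q\<close> in
        \<open>simp add: A.bracket_add A'.bracket_add A.bracket_closed map_add map_closed\<close>)
  qed (use V in \<open>simp add: A.bracket_add A'.bracket_add A.bracket_closed map_add map_closed\<close>)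
qed (simp_all add: map_closed map_add map_smult)

end

section \<open>Subspaces of finite codimension\<close>


definition adjoin ::
    "('k, 'x) ring_scheme \<Rightarrow> ('k, 'a, 'y) module_scheme \<Rightarrow> 'a set \<Rightarrow> 'a \<Rightarrow> 'a set" where
  "adjoin K M N x = {y \<oplus>\<^bsub>M\<^esub> c \<odot>\<^bsub>M\<^esub> x | y c. y \<in> N \<and> c \<in> carrier K}"

text \<open>The space \<open>N + K v\<^sub>0 + ... + K v\<^sub>d\<^sub>-\<^sub>1\<close>. If it
  contains \<open>v d\<close>, then \<open>v d\<close> depends on its predecessors modulo
  \<open>N\<close>.\<close>

primrec seq_span ::
    "('k, 'x) ring_scheme \<Rightarrow> ('k, 'a, 'y) module_scheme \<Rightarrow> 'a set \<Rightarrow> (nat \<Rightarrow> 'a) \<Rightarrow> nat \<Rightarrow> 'a set" where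
  "seq_span K M N v 0 = N"
| "seq_span K M N v (Suc d) = adjoin K M (seq_span K M N v d) (v d)"

lemma adjoin_mono: "N \<subseteq> N' \<Longrightarrow> adjoin K M N x \<subseteq> adjoin K M N' x"
  by (auto simp: adjoin_def)

lemma foldl_adjoin_mono: "N \<subseteq> N' \<Longrightarrow> foldl (adjoin K M) N xs \<subseteq> foldl (adjoin K M) N' xs"
  by (induction xs arbitrary: N N') (simp_all add: adjoin_mono)

lemma seq_span_shift:
  "seq_span K M (adjoin K M N (v 0)) (\<lambda>i. v (Suc i)) d = seq_span K M N v (Suc d)"
  by (induction d) simp_all

section \<open>Exchange and dependence modulo a subspace\<close>

locale vector_space_over = K: field K + module K M
  for K :: "('k, 'x) ring_scheme" and M :: "('k, 'a, 'y) module_scheme" (structure)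
begin

lemma minus_eq_zero_iff:
  assumes "a \<in> carrier M" "b \<in> carrier M"
  shows "a \<ominus> b = \<zero> \<longleftrightarrow> a = b"
proof
  assume "a \<ominus> b = \<zero>"
  then have "(a \<ominus> b) \<oplus> b = b" using assms by simp
  then show "a = b" using assms by (simp add: M.minus_eq M.a_assoc M.l_neg)
qed (use assms in \<open>simp add: M.minus_eq M.r_neg\<close>)

lemma adjoin_submodule:
  assumes N: "submodule N K M" and x: "x \<in> carrier M"
  shows "submodule (adjoin K M N x) K M" "N \<subseteq> adjoin K M N x" "x \<in> adjoin K M N x"
proof -
  note sub = submoduleE[OF N]
  have z: "\<zero> \<in> N" using additive_subgroup.zero_closed[OF abelian_subgroup.axioms(1)[OF submodule_abelian_subgroup[OF N]]] .
  have "y = y \<oplus> \<zero>\<^bsub>K\<^esub> \<odot> x" if "y \<in> N" for y using that sub(1) x by auto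
  then show 1: "N \<subseteq> adjoin K M N x" unfolding adjoin_def by fast
  have "x = \<zero> \<oplus> \<one>\<^bsub>K\<^esub> \<odot> x" using x by simp
  then show "x \<in> adjoin K M N x" unfolding adjoin_def using z by blast
  show "submodule (adjoin K M N x) K M"
  proof (rule submoduleI)
    show "adjoin K M N x \<subseteq> carrier M" using sub(1) x by (auto simp: adjoin_def)
    show "\<zero> \<in> adjoin K M N x" using 1 z by blast
  next
    fix a assume "a \<in> adjoin K M N x"
    then obtain y c where yc: "y \<in> N" "c \<in> carrier K" "a = y \<oplus> c \<odot> x" by (auto simp: adjoin_def)
    then have "\<ominus> a = \<ominus> y \<oplus> (\<ominus>\<^bsub>K\<^esub> c) \<odot> x"
      using sub(1) x by (simp add: subset_iff smult_l_minus M.minus_add)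
    then show "\<ominus> a \<in> adjoin K M N x" unfolding adjoin_def using yc sub(3) K.a_inv_closed by blast
  next
    fix a b assume "a \<in> adjoin K M N x" "b \<in> adjoin K M N x"
    then obtain y c z d where yc: "y \<in> N" "c \<in> carrier K" "a = y \<oplus> c \<odot> x"
      "z \<in> N" "d \<in> carrier K" "b = z \<oplus> d \<odot> x" by (auto simp: adjoin_def)
    then have "a \<oplus> b = (y \<oplus> z) \<oplus> (c \<oplus>\<^bsub>K\<^esub> d) \<odot> x"
      using sub(1) x by (simp add: subset_iff smult_l_distr M.a_ac)
    then show "a \<oplus> b \<in> adjoin K M N x" unfolding adjoin_def using yc sub(5) K.a_closed by blast
  next
    fix e a assume e: "e \<in> carrier K" and "a \<in> adjoin K M N x"
    then obtain y c where yc: "y \<in> N" "c \<in> carrier K" "a = y \<oplus> c \<odot> x" by (auto simp: adjoin_def)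
    then have "e \<odot> a = e \<odot> y \<oplus> (e \<otimes>\<^bsub>K\<^esub> c) \<odot> x"
      using sub(1) x e by (simp add: subset_iff smult_r_distr smult_assoc1)
    then show "e \<odot> a \<in> adjoin K M N x" unfolding adjoin_def using yc e sub(4) K.m_closed by blast
  qed
qed

text \<open>The coefficient of \<open>s\<close> in \<open>v\<close> is nonzero because
  \<open>v\<close> lies outside \<open>N\<close>, so the equation can be solved for
  \<open>s\<close>.\<close>

lemma adjoin_exchange:
  assumes N: "submodule N K M" and s: "s \<in> carrier M" and v: "v \<in> adjoin K M N s" "v \<notin> N"
  shows "s \<in> adjoin K M N v"
proof -
  note sub = submoduleE[OF N]
  obtain y c where yc: "y \<in> N" "c \<in> carrier K" "v = y \<oplus> c \<odot> s" using v by (auto simp: adjoin_def)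
  have yM: "y \<in> carrier M" using yc sub(1) by blast
  have "c \<noteq> \<zero>\<^bsub>K\<^esub>" using v(2) yc s yM by auto
  then have c: "c \<in> Units K" using yc K.field_Units by blast
  have "(inv\<^bsub>K\<^esub> c) \<odot> v = (inv\<^bsub>K\<^esub> c) \<odot> y \<oplus> s"
    using yc yM s c by (simp add: smult_r_distr smult_assoc1[symmetric])
  then have "s = \<ominus> ((inv\<^bsub>K\<^esub> c) \<odot> y) \<oplus> (inv\<^bsub>K\<^esub> c) \<odot> v"
    using yM s c by (simp add: M.a_assoc[symmetric] M.l_neg)
  moreover have "\<ominus> ((inv\<^bsub>K\<^esub> c) \<odot> y) \<in> N" using sub(3,4) yc c by simp
  ultimately show ?thesis unfolding adjoin_def using c K.Units_inv_closed by blast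
qed

lemma adjoin_least:
  assumes N: "submodule N K M" "submodule N' K M" and "N \<subseteq> N'" "x \<in> N'"
  shows "adjoin K M N x \<subseteq> N'"
  using submoduleE(4,5)[OF N(2)] assms(3,4) by (auto simp: adjoin_def)

lemma adjoin_commute:
  assumes N: "submodule N K M" and "s \<in> carrier M" "v \<in> carrier M"
  shows "adjoin K M (adjoin K M N s) v = adjoin K M (adjoin K M N v) s"
proof -
  have "adjoin K M (adjoin K M N s) v \<subseteq> adjoin K M (adjoin K M N v) s"
    if "s \<in> carrier M" "v \<in> carrier M" for s v
  proof -
    note Nv = adjoin_submodule[OF N that(2)]
    note Nvs = adjoin_submodule[OF Nv(1) that(1)]
    have "adjoin K M N s \<subseteq> adjoin K M (adjoin K M N v) s"
      using Nv(2) Nvs(2,3) by (intro adjoin_least[OF N Nvs(1)]) auto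
    then show ?thesis
      using Nv(3) Nvs(2) by (intro adjoin_least[OF adjoin_submodule(1)[OF N that(1)] Nvs(1)]) auto
  qed
  then show ?thesis using assms by blast
qed

lemma foldl_adjoin_submodule:
  "\<lbrakk>submodule N K M; set xs \<subseteq> carrier M\<rbrakk> \<Longrightarrow>
    submodule (foldl (adjoin K M) N xs) K M \<and> N \<subseteq> foldl (adjoin K M) N xs \<and> set xs \<subseteq> foldl (adjoin K M) N xs"
proof (induction xs arbitrary: N)
  case (Cons x xs)
  have x: "x \<in> carrier M" using Cons.prems by simp
  show ?case using Cons.IH[OF adjoin_submodule(1)[OF Cons.prems(1) x]] adjoin_submodule[OF Cons.prems(1) x] Cons.prems
    by auto
qed auto

text \<open>The list is absorbed into \<open>N\<close> until \<open>v\<close> first falls into the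
  span. At that entry \<open>v\<close> and \<open>s\<close> are interchangeable modulo what came
  before, and \<open>s\<close> is dropped; all other entries are kept.\<close>

lemma steinitz_exchange:
  assumes "submodule N K M" "set S \<subseteq> carrier M" "foldl (adjoin K M) N S = carrier M"
    "v \<in> carrier M" "v \<notin> N"
  shows "\<exists>S'. length S = Suc (length S') \<and> set S' \<subseteq> carrier M \<and>
    foldl (adjoin K M) (adjoin K M N v) S' = carrier M"
  using assms(1-3,5)
proof (induction S arbitrary: N)
  case Nil
  then show ?case using assms(4) by simp
next
  case (Cons s S)
  have s: "s \<in> carrier M" using Cons.prems by simp
  note Ns = adjoin_submodule[OF Cons.prems(1) s]
  note Nv = adjoin_submodule[OF Cons.prems(1) assms(4)]
  show ?case
  proof (cases "v \<in> adjoin K M N s")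
    case True
    have "adjoin K M N s \<subseteq> adjoin K M N v"
      by (rule adjoin_least[OF Cons.prems(1) Nv(1,2) adjoin_exchange[OF Cons.prems(1) s True Cons.prems(4)]])
    then have "carrier M \<subseteq> foldl (adjoin K M) (adjoin K M N v) S"
      using foldl_adjoin_mono Cons.prems(3) by fastforce
    moreover have "foldl (adjoin K M) (adjoin K M N v) S \<subseteq> carrier M"
      using foldl_adjoin_submodule[OF Nv(1), of S] Cons.prems(2) submoduleE(1) by auto
    ultimately show ?thesis using Cons.prems(2) by (intro exI[of _ S]) auto
  next
    case False
    then obtain S' where S': "length S = Suc (length S')" "set S' \<subseteq> carrier M"
      "foldl (adjoin K M) (adjoin K M (adjoin K M N s) v) S' = carrier M"
      using Cons.IH[OF Ns(1)] Cons.prems by auto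
    then show ?thesis using adjoin_commute[OF Cons.prems(1) s assms(4)] s
      by (intro exI[of _ "s # S'"]) auto
  qed
qed

text \<open>Each member of the sequence that is independent of the preceding ones shortens the
  spanning list by one. When the list is empty, \<open>N\<close> is the whole space and the next
  member is trivially dependent.\<close>

lemma seq_dependent:
  assumes "submodule N K M" "set S \<subseteq> carrier M" "foldl (adjoin K M) N S = carrier M"
    "\<And>i. v i \<in> carrier M"
  shows "\<exists>d. v d \<in> seq_span K M N v d"
  using assms
proof (induction "length S" arbitrary: S N v)
  case 0
  then show ?case by (intro exI[of _ 0]) simp
next
  case (Suc n)
  show ?case
  proof (cases "v 0 \<in> N")
    case True
    then show ?thesis by (intro exI[of _ 0]) simp
  next
    case False
    obtain S' where S': "length S = Suc (length S')" "set S' \<subseteq> carrier M"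
      "foldl (adjoin K M) (adjoin K M N (v 0)) S' = carrier M"
      using steinitz_exchange[OF Suc.prems(1-3) Suc.prems(4) False] by blast
    have "\<exists>d. v (Suc d) \<in> seq_span K M (adjoin K M N (v 0)) (\<lambda>i. v (Suc i)) d"
      using Suc.hyps(1)[of S' "adjoin K M N (v 0)" "\<lambda>i. v (Suc i)"] Suc.hyps(2) S' Suc.prems
        adjoin_submodule(1) by auto
    then show ?thesis unfolding seq_span_shift by blast
  qed
qed

text \<open>Representatives of a finite spanning set of cosets. The image in the quotient of what
  they span together with \<open>N\<close> is a subspace containing the spanning set, hence
  everything.\<close>

lemma finite_codim_list:
  assumes N: "submodule N K M" and fin: "finite_dimensional K (quot_module M N)"
  obtains S where "set S \<subseteq> carrier M" "foldl (adjoin K M) N S = carrier M"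
proof -
  interpret q: quot_by K M N by (rule quot_by.intro[OF module_axioms quot_by_axioms.intro[OF N]])
  interpret qm: module K q.Q by (rule q.quot_is_module)
  obtain S where S: "finite S" "S \<subseteq> carrier q.Q" "lin_span K q.Q S = carrier q.Q"
    using fin by (auto simp: finite_dimensional_def)
  obtain Us where Us: "set Us = S" using S(1) finite_list by blast
  define r where "r U = (SOME x. x \<in> carrier M \<and> U = N +> x)" for U
  have r: "r U \<in> carrier M" "U = N +> r U" if "U \<in> S" for U
  proof -
    have "\<exists>x. x \<in> carrier M \<and> U = N +> x" using that S(2) q.quot_cases by (metis subsetD)
    from someI_ex[OF this] show "r U \<in> carrier M" "U = N +> r U" by (simp_all add: r_def)
  qed
  let ?xs = "map r Us"
  have xs: "set ?xs \<subseteq> carrier M" using r Us by auto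
  define N' where "N' = foldl (adjoin K M) N ?xs"
  have N': "submodule N' K M" "N \<subseteq> N'" "set ?xs \<subseteq> N'"
    using foldl_adjoin_submodule[OF N xs] by (auto simp: N'_def)
  note N'c = submoduleE(1)[OF N'(1)]
  let ?Q = "(\<lambda>x. N +> x) ` N'"
  have "submodule ?Q K q.Q"
  proof (rule qm.submoduleI)
    have sm: "c \<odot>\<^bsub>q.Q\<^esub> a \<in> ?Q" if c: "c \<in> carrier K" and a: "a \<in> ?Q" for c a
    proof -
      obtain x where x: "x \<in> N'" "a = N +> x" using a by blast
      then show ?thesis using c N'c submoduleE(4)[OF N'(1)] q.coset_smult by (auto simp: subset_iff)
    qed
    then show "c \<odot>\<^bsub>q.Q\<^esub> a \<in> ?Q" if "c \<in> carrier K" "a \<in> ?Q" for c a using that by blast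
    show sub: "?Q \<subseteq> carrier q.Q" using N'c q.coset_closed by blast
    have "N +> \<zero> = N" by (rule M.a_coset_add_zero[OF q.N.a_subset])
    moreover have "\<zero> \<in> N'" using N'(2) q.N.zero_closed by blast
    ultimately show "\<zero>\<^bsub>q.Q\<^esub> \<in> ?Q" unfolding quot_module_simps by force
    show "\<ominus>\<^bsub>q.Q\<^esub> a \<in> ?Q" if a: "a \<in> ?Q" for a
    proof -
      have "\<ominus>\<^bsub>q.Q\<^esub> a = (\<ominus>\<^bsub>K\<^esub> \<one>\<^bsub>K\<^esub>) \<odot>\<^bsub>q.Q\<^esub> a" using a sub by (simp add: qm.smult_l_minus subset_iff)
      then show ?thesis using sm[OF _ a] by simp
    qed
    show "a \<oplus>\<^bsub>q.Q\<^esub> b \<in> ?Q" if ab: "a \<in> ?Q" "b \<in> ?Q" for a b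
    proof -
      obtain x y where "x \<in> N'" "a = N +> x" "y \<in> N'" "b = N +> y" using ab by blast
      then show ?thesis using N'c submoduleE(5)[OF N'(1)] q.coset_add by (auto simp: subset_iff)
    qed
  qed
  moreover have "S \<subseteq> ?Q"
  proof
    fix U assume "U \<in> S"
    then show "U \<in> ?Q" using r(2)[of U] N'(3) Us by auto
  qed
  ultimately have all: "carrier q.Q \<subseteq> ?Q" using qm.lin_span_least S(3) by blast
  have "carrier M \<subseteq> N'"
  proof
    fix x assume x: "x \<in> carrier M"
    then obtain y where y: "y \<in> N'" "N +> x = N +> y" using all q.coset_closed by blast
    then have "x \<ominus> y \<in> N'" using q.coset_eq_iff[of x y] x N'(2) N'c by blast
    then have "(x \<ominus> y) \<oplus> y \<in> N'" using submoduleE(5)[OF N'(1)] y by blast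
    moreover have "(x \<ominus> y) \<oplus> y = x" using x y N'c by (simp add: M.minus_eq M.a_assoc M.l_neg subset_iff)
    ultimately show "x \<in> N'" by simp
  qed
  then show ?thesis using that[of ?xs] xs N'c by (auto simp: N'_def)
qed

text \<open>Zorn's lemma yields a maximal \<open>C\<close> that meets \<open>N\<close> only in zero.
  For \<open>x\<close> outside \<open>C\<close>, adjoining \<open>x\<close> produces a nonzero
  \<open>n\<close> in \<open>N\<close>; as \<open>n\<close> is not in \<open>C\<close>, exchange
  expresses \<open>x\<close> through \<open>C\<close> and \<open>n\<close>.\<close>

lemma submodule_complement:
  assumes N: "submodule N K M"
  obtains C where "submodule C K M" "C \<inter> N = {\<zero>}" "\<And>x. x \<in> carrier M \<Longrightarrow> \<exists>n\<in>N. x \<ominus> n \<in> C"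
proof -
  have z: "\<zero> \<in> N" if "submodule N K M" for N
    using additive_subgroup.zero_closed[OF abelian_subgroup.axioms(1)[OF submodule_abelian_subgroup[OF that]]] .
  define A where "A = {C. submodule C K M \<and> C \<inter> N = {\<zero>}}"
  have "submodule {\<zero>} K M"
    by (rule submoduleI) (auto simp: M.add.inv_one[folded a_inv_def])
  then have "A \<noteq> {}" using z[OF N] by (auto simp: A_def)
  moreover have "\<Union>\<C> \<in> A" if ne: "\<C> \<noteq> {}" and ch: "subset.chain A \<C>" for \<C>
  proof -
    have sub: "submodule C K M" "C \<inter> N = {\<zero>}" if "C \<in> \<C>" for C
      using that ch by (auto simp: subset.chain_def A_def)
    have two: "\<exists>C\<in>\<C>. a \<in> C \<and> b \<in> C" if ab: "a \<in> \<Union>\<C>" "b \<in> \<Union>\<C>" for a b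
    proof -
      obtain C D where CD: "C \<in> \<C>" "a \<in> C" "D \<in> \<C>" "b \<in> D" using ab by blast
      then have "C \<subseteq> D \<or> D \<subseteq> C" using ch by (auto simp: subset.chain_def)
      then show ?thesis using CD by blast
    qed
    have "submodule (\<Union>\<C>) K M"
    proof (rule submoduleI)
      show "\<Union>\<C> \<subseteq> carrier M" using sub(1) submoduleE(1) by blast
      show "\<zero> \<in> \<Union>\<C>" using ne sub(1) z by blast
      show "\<ominus> a \<in> \<Union>\<C>" if "a \<in> \<Union>\<C>" for a using that sub(1) submoduleE(3) by blast
      show "c \<odot> a \<in> \<Union>\<C>" if "c \<in> carrier K" "a \<in> \<Union>\<C>" for c a using that sub(1) submoduleE(4) by blast
      show "a \<oplus> b \<in> \<Union>\<C>" if "a \<in> \<Union>\<C>" "b \<in> \<Union>\<C>" for a b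
        using two[OF that] sub(1) submoduleE(5) by blast
    qed
    moreover have "\<Union>\<C> \<inter> N = {\<zero>}" using ne sub(2) by blast
    ultimately show ?thesis by (simp add: A_def)
  qed
  ultimately obtain C where C: "C \<in> A" and max: "\<And>Z. \<lbrakk>Z \<in> A; C \<subseteq> Z\<rbrakk> \<Longrightarrow> Z = C"
    using subset_Zorn_nonempty[of A] by blast
  have Cs: "submodule C K M" "C \<inter> N = {\<zero>}" using C by (auto simp: A_def)
  note NM = submoduleE(1)[OF N] and CM = submoduleE(1)[OF Cs(1)]
  have "\<exists>n\<in>N. x \<ominus> n \<in> C" if x: "x \<in> carrier M" for x
  proof (cases "x \<in> C")
    case True
    then show ?thesis using z[OF N] x by (intro bexI[of _ "\<zero>"]) (simp_all add: M.minus_eq M.add.inv_one[folded a_inv_def])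
  next
    case False
    note ad = adjoin_submodule[OF Cs(1) x]
    have "adjoin K M C x \<notin> A" using max[of "adjoin K M C x"] ad False by blast
    then obtain n where n: "n \<in> adjoin K M C x" "n \<in> N" "n \<noteq> \<zero>"
      using ad(1) z[OF ad(1)] z[OF N] by (auto simp: A_def)
    then have "n \<notin> C" using Cs(2) by blast
    then have "x \<in> adjoin K M C n" by (rule adjoin_exchange[OF Cs(1) x n(1)])
    then obtain y c where yc: "y \<in> C" "c \<in> carrier K" "x = y \<oplus> c \<odot> n" by (auto simp: adjoin_def)
    then have "x \<ominus> c \<odot> n = y" using n NM CM by (simp add: M.minus_eq M.a_assoc M.r_neg subset_iff)
    then show ?thesis using yc n submoduleE(4)[OF N] by (intro bexI[of _ "c \<odot> n"]) simp_all
  qed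
  then show ?thesis using that Cs by blast
qed

text \<open>The projection along a complement. It is chosen pointwise, and linear because the
  component in \<open>N\<close> is unique. Applied to A in B it gives a left inverse of the map A
  \<otimes> R -> B \<otimes> R.\<close>

lemma linear_retraction:
  assumes N: "submodule N K M"
  obtains \<rho> where "lin_map K M (M\<lparr>carrier := N\<rparr>) \<rho>" "\<And>x. x \<in> N \<Longrightarrow> \<rho> x = x"
proof -
  obtain C where C: "submodule C K M" "C \<inter> N = {\<zero>}"
    and ex: "\<And>x. x \<in> carrier M \<Longrightarrow> \<exists>n\<in>N. x \<ominus> n \<in> C"
    using submodule_complement[OF N] by blast
  note NM = submoduleE(1)[OF N] and CM = submoduleE(1)[OF C(1)]
  define \<rho> where "\<rho> x = (SOME n. n \<in> N \<and> x \<ominus> n \<in> C)" for x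
  have \<rho>: "\<rho> x \<in> N" "x \<ominus> \<rho> x \<in> C" if "x \<in> carrier M" for x
    using someI_ex[of "\<lambda>n. n \<in> N \<and> x \<ominus> n \<in> C"] ex[OF that] by (auto simp: \<rho>_def)
  have uniq: "\<rho> x = n" if x: "x \<in> carrier M" and n: "n \<in> N" "x \<ominus> n \<in> C" for x n
  proof -
    have c: "\<rho> x \<in> carrier M" "n \<in> carrier M" using \<rho>[OF x] n NM by auto
    have "(x \<ominus> n) \<oplus> \<ominus> (x \<ominus> \<rho> x) \<in> C"
      using \<rho>[OF x] n submoduleE(3,5)[OF C(1)] by blast
    also have "(x \<ominus> n) \<oplus> \<ominus> (x \<ominus> \<rho> x) = \<rho> x \<ominus> n"
    proof -
      have "(x \<ominus> n) \<oplus> \<ominus> (x \<ominus> \<rho> x) = (x \<oplus> \<ominus> x) \<oplus> (\<rho> x \<ominus> n)"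
        using x c by (simp add: M.minus_eq M.minus_add M.a_ac)
      then show ?thesis using x c by (simp add: M.r_neg)
    qed
    finally have "\<rho> x \<ominus> n \<in> C \<inter> N"
      using \<rho>(1)[OF x] n(1) submoduleE(3,5)[OF N] by (simp add: M.minus_eq)
    then show ?thesis using C(2) c by (auto simp: minus_eq_zero_iff)
  qed
  have "lin_map K M (M\<lparr>carrier := N\<rparr>) \<rho>"
    unfolding lin_map_def
  proof (intro conjI ballI)
    fix x assume x: "x \<in> carrier M"
    note rx = \<rho>[OF x]
    have rxM: "\<rho> x \<in> carrier M" using rx NM by blast
    show "\<rho> x \<in> carrier (M\<lparr>carrier := N\<rparr>)" using rx by simp
    fix y assume y: "y \<in> carrier M"
    note ry = \<rho>[OF y]
    have ryM: "\<rho> y \<in> carrier M" using ry NM by blast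
    have "(x \<oplus> y) \<ominus> (\<rho> x \<oplus> \<rho> y) = (x \<ominus> \<rho> x) \<oplus> (y \<ominus> \<rho> y)"
      using x y rxM ryM by (simp add: M.minus_eq M.minus_add M.a_ac)
    then show "\<rho> (x \<oplus> y) = \<rho> x \<oplus>\<^bsub>M\<lparr>carrier := N\<rparr>\<^esub> \<rho> y"
      using x y rx ry submoduleE(5)[OF N] submoduleE(5)[OF C(1)] by (auto intro!: uniq)
  next
    fix c x assume c: "c \<in> carrier K" and x: "x \<in> carrier M"
    note rx = \<rho>[OF x]
    have rxM: "\<rho> x \<in> carrier M" using rx NM by blast
    have "c \<odot> x \<ominus> c \<odot> \<rho> x = c \<odot> (x \<ominus> \<rho> x)"
      using x c rxM by (simp add: M.minus_eq smult_r_distr smult_r_minus)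
    then show "\<rho> (c \<odot> x) = c \<odot>\<^bsub>M\<lparr>carrier := N\<rparr>\<^esub> \<rho> x"
      using x c rx submoduleE(4)[OF N] submoduleE(4)[OF C(1)] by (auto intro!: uniq)
  qed
  moreover have "\<rho> x = x" if "x \<in> N" for x
  proof -
    have "\<zero> \<in> C" using C(2) by blast
    moreover have "x \<ominus> x = \<zero>" using that NM by (simp add: minus_eq_zero_iff subset_iff)
    ultimately show ?thesis using that NM by (intro uniq) auto
  qed
  ultimately show ?thesis using that by blast
qed

text \<open>Retract onto the line through \<open>v\<close> and read off the coordinate. The case of
  the unit of R is used to slice tensors.\<close>

lemma linear_functional:
  assumes v: "v \<in> carrier M" "v \<noteq> \<zero>"
  obtains l where "\<And>x. x \<in> carrier M \<Longrightarrow> l x \<in> carrier K"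
    "\<And>x y. \<lbrakk>x \<in> carrier M; y \<in> carrier M\<rbrakk> \<Longrightarrow> l (x \<oplus> y) = l x \<oplus>\<^bsub>K\<^esub> l y"
    "\<And>c x. \<lbrakk>c \<in> carrier K; x \<in> carrier M\<rbrakk> \<Longrightarrow> l (c \<odot> x) = c \<otimes>\<^bsub>K\<^esub> l x"
    "l v = \<one>\<^bsub>K\<^esub>"
proof -
  have "submodule {\<zero>} K M"
    by (rule submoduleI) (auto simp: M.add.inv_one[folded a_inv_def])
  note ad = adjoin_submodule[OF this v(1)]
  let ?L = "adjoin K M {\<zero>} v"
  obtain \<rho> where \<rho>: "lin_map K M (M\<lparr>carrier := ?L\<rparr>) \<rho>" "\<And>x. x \<in> ?L \<Longrightarrow> \<rho> x = x"
    using linear_retraction[OF ad(1)] by blast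
  have inj: "c = d" if cd: "c \<in> carrier K" "d \<in> carrier K" "c \<odot> v = d \<odot> v" for c d
  proof (rule ccontr)
    assume "c \<noteq> d"
    then have "c \<ominus>\<^bsub>K\<^esub> d \<noteq> \<zero>\<^bsub>K\<^esub>" using cd K.r_right_minus_eq by blast
    then have u: "c \<ominus>\<^bsub>K\<^esub> d \<in> Units K" using cd K.field_Units by blast
    have "(c \<ominus>\<^bsub>K\<^esub> d) \<odot> v = \<zero>"
      using cd v by (simp add: K.minus_eq smult_l_distr smult_l_minus M.r_neg)
    then have "inv\<^bsub>K\<^esub> (c \<ominus>\<^bsub>K\<^esub> d) \<odot> ((c \<ominus>\<^bsub>K\<^esub> d) \<odot> v) = \<zero>"
      using u by simp
    moreover have "inv\<^bsub>K\<^esub> (c \<ominus>\<^bsub>K\<^esub> d) \<odot> ((c \<ominus>\<^bsub>K\<^esub> d) \<odot> v) = v"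
      using u v smult_assoc1[OF K.Units_inv_closed[OF u] K.Units_closed[OF u] v(1)] by simp
    ultimately show False using v by simp
  qed
  define l where "l x = (SOME c. c \<in> carrier K \<and> \<rho> x = c \<odot> v)" for x
  have l: "l x \<in> carrier K" "\<rho> x = l x \<odot> v" if "x \<in> carrier M" for x
  proof -
    have "\<rho> x \<in> ?L" using lin_mapD(1)[OF \<rho>(1) that] by simp
    then have "\<exists>c. c \<in> carrier K \<and> \<rho> x = c \<odot> v" using v by (auto simp: adjoin_def)
    from someI_ex[OF this] show "l x \<in> carrier K" "\<rho> x = l x \<odot> v" by (simp_all add: l_def)
  qed
  show ?thesis
  proof (rule that[of l])
    show "l (x \<oplus> y) = l x \<oplus>\<^bsub>K\<^esub> l y" if "x \<in> carrier M" "y \<in> carrier M" for x y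
      using that l lin_mapD(2)[OF \<rho>(1)] v by (intro inj) (auto simp: smult_l_distr simp flip: l(2))
    show "l (c \<odot> x) = c \<otimes>\<^bsub>K\<^esub> l x" if "c \<in> carrier K" "x \<in> carrier M" for c x
      using that l lin_mapD(3)[OF \<rho>(1)] v by (intro inj) (auto simp: smult_assoc1 simp flip: l(2))
    show "l v = \<one>\<^bsub>K\<^esub>" using v l(1)[of v] l(2)[of v] \<rho>(2)[OF ad(3)] by (intro inj) auto
  qed (rule l(1))
qed

end

section \<open>Extension of Poisson morphisms to the integral closure\<close>


lemma (in poisson_algebra) subalgebra_poisson:
  assumes H: "poisson_subalgebra K H P"
  shows "poisson_algebra K (P\<lparr>carrier := H\<rparr>)"
proof -
  let ?A = "P\<lparr>carrier := H\<rparr>"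
  have sub: "subring H P" and sm: "submodule H K P"
    and br: "\<And>x y. \<lbrakk>x \<in> H; y \<in> H\<rbrakk> \<Longrightarrow> \<lbrace>x, y\<rbrace>\<^bsub>P\<^esub> \<in> H"
    using H by (auto simp: poisson_subalgebra_def)
  have HP: "x \<in> H \<Longrightarrow> x \<in> carrier P" for x using subringE(1)[OF sub] by blast
  have mod: "module K ?A" by (rule submodule.submodule_is_module[OF sm module_axioms])
  interpret A: ring ?A by (rule subring_is_ring[OF sub])
  have cr: "cring ?A"
  proof (rule cring.intro)
    show "ring ?A" by unfold_locales
    show "comm_monoid ?A"
      by (rule comm_monoidI) (use HP subringE[OF sub] in \<open>auto simp: m_ac\<close>)
  qed
  have alg: "algebra K ?A"
    using mod cr HP by (auto simp: algebra_def algebra_axioms_def smult_assoc2)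
  \<comment> \<open>Negation in the restricted record is defined by inverses within
    \<open>H\<close>, so its agreement with negation in \<open>P\<close> has to be checked.\<close>
  have neg: "\<ominus>\<^bsub>?A\<^esub> x = \<ominus>\<^bsub>P\<^esub> x" if "x \<in> H" for x
  proof -
    have "\<ominus>\<^bsub>P\<^esub> x \<in> H" by (rule subringE(5)[OF sub that])
    then show ?thesis using that HP
      by (intro A.minus_equality) (auto simp: l_neg)
  qed
  show ?thesis
  proof (intro poisson_algebra.intro poisson_algebra_axioms.intro alg K.field_axioms)
    fix x y assume "x \<in> carrier ?A" "y \<in> carrier ?A"
    then show "\<lbrace>y, x\<rbrace>\<^bsub>?A\<^esub> = \<ominus>\<^bsub>?A\<^esub> \<lbrace>x, y\<rbrace>\<^bsub>?A\<^esub>"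
      using HP br bracket_antisym[of x y] by (simp add: neg)
  qed (use HP br in \<open>simp_all add: bracket_add bracket_smult bracket_self bracket_jacobi bracket_leibniz\<close>)
qed

section \<open>Subalgebras of finite codimension with the same fractions\<close>

locale codim_pair = poisson_domain K B
  for K :: "('k, 'x) ring_scheme" and B :: "('k, 'b, 'y) palg_scheme" (structure) +
  fixes H :: "'b set"
  assumes H: "poisson_subalgebra K H B"
    and fracs: "frac_embed B ` carrier B \<subseteq> sub_fracs B H"
    and fin: "finite_dimensional K (quot_module B H)"
begin

abbreviation "A \<equiv> B\<lparr>carrier := H\<rparr>"

sublocale V: vector_space_over K B by unfold_locales

lemma sub: "subring H B" and sm: "submodule H K B"
  and br_H: "\<And>x y. \<lbrakk>x \<in> H; y \<in> H\<rbrakk> \<Longrightarrow> \<lbrace>x, y\<rbrace> \<in> H"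
  using H by (auto simp: poisson_subalgebra_def)

lemma H_carrier: "x \<in> H \<Longrightarrow> x \<in> carrier B" using subringE(1)[OF sub] by blast

lemmas H_closed = subringE(2,3,5,6,7)[OF sub] submoduleE(4)[OF sm] br_H

lemma denominator:
  assumes b: "b \<in> carrier B"
  obtains a where "a \<in> H" "a \<noteq> \<zero>" "a \<otimes> b \<in> H"
proof -
  have "frac_embed B b \<in> sub_fracs B H" using fracs b by blast
  then obtain a c where ac: "frac B b \<one> = frac B a c" "a \<in> H" "c \<in> H" "c \<noteq> \<zero>"
    by (auto simp: sub_fracs_def frac_embed_def)
  then have "b \<otimes> c = a \<otimes> \<one>"
    using b H_carrier[of a] H_carrier[of c] frac_eq_iff[of b "\<one>" a c] by simp
  then have "c \<otimes> b = a" using ac b H_carrier by (simp add: m_comm)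
  then show ?thesis using that ac by blast
qed

lemma dependent_mod_H:
  assumes "\<And>i. v i \<in> carrier B"
  obtains d where "v d \<in> seq_span K B H v d"
proof -
  obtain S where S: "set S \<subseteq> carrier B" "foldl (adjoin K B) H S = carrier B"
    using V.finite_codim_list[OF sm fin] by blast
  show ?thesis using V.seq_dependent[OF sm S, of v] assms that by blast
qed

text \<open>For a surjection this is injectivity of the induced endomorphism of \<open>B / H\<close>. A
  backward orbit of \<open>b\<close> is linearly dependent modulo \<open>H\<close>; a power of \<open>g\<close> moves the dependency
  forward to one that expresses \<open>b\<close> through elements of \<open>H\<close>.\<close>

lemma preimage_subset:
  assumes g: "lin_map K B B g" "g ` carrier B = carrier B" and gH: "\<And>x. x \<in> H \<Longrightarrow> g x \<in> H"
    and b: "b \<in> carrier B" "g b \<in> H"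
  shows "b \<in> H"
proof -
  define v where "v i = (inv_into (carrier B) g ^^ i) b" for i
  have inv: "inv_into (carrier B) g x \<in> carrier B" "g (inv_into (carrier B) g x) = x" if "x \<in> carrier B" for x
    using that g(2) by (simp_all add: inv_into_into f_inv_into_f)
  have v: "v i \<in> carrier B" for i by (induction i) (simp_all add: v_def b inv)
  have vS: "g (v (Suc i)) = v i" for i using inv(2)[OF v[of i]] by (simp add: v_def)
  have gv: "(g ^^ (i + j)) (v i) = (g ^^ j) b" for i j
  proof (induction i)
    case (Suc i)
    have "(g ^^ (Suc i + j)) (v (Suc i)) = (g ^^ (i + j)) (g (v (Suc i)))"
      by (simp add: funpow_swap1)
    then show ?case using Suc by (simp add: vS)
  qed (simp add: v_def)
  have pow: "(g ^^ n) x \<in> carrier B" if "x \<in> carrier B" for n x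
    using that lin_mapD(1)[OF g(1)] by (induction n) auto
  have powH: "(g ^^ n) x \<in> H" if "x \<in> H" for n x using that gH by (induction n) auto
  have lin: "(g ^^ n) (x \<oplus> c \<odot> y) = (g ^^ n) x \<oplus> c \<odot> (g ^^ n) y"
    if "x \<in> carrier B" "y \<in> carrier B" "c \<in> carrier K" for n x y c
    using that lin_mapD[OF g(1)] pow by (induction n) auto
  obtain d where d: "v d \<in> seq_span K B H v d" using dependent_mod_H[of v] v by blast
  \<comment> \<open>Every \<open>v e\<close> with \<open>e < d\<close> is sent by the
    \<open>d\<close>-th power of \<open>g\<close> to a forward image of \<open>g b\<close>, which
    lies in \<open>H\<close>, whereas \<open>v d\<close> is sent to \<open>b\<close> itself.\<close>
  have "x \<in> carrier B \<and> (g ^^ d) x \<in> H" if "x \<in> seq_span K B H v e" "e \<le> d" for x e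
    using that
  proof (induction e arbitrary: x)
    case 0
    then show ?case using powH H_carrier by simp
  next
    case (Suc e)
    then obtain y c where yc: "y \<in> seq_span K B H v e" "c \<in> carrier K" "x = y \<oplus> c \<odot> v e"
      by (auto simp: adjoin_def)
    have y: "y \<in> carrier B" "(g ^^ d) y \<in> H" using Suc.IH[OF yc(1)] Suc.prems by auto
    obtain m where m: "d = e + Suc m" using Suc.prems(2) less_imp_Suc_add[of e d] by auto
    have "(g ^^ d) (v e) = (g ^^ m) (g b)" unfolding m gv by (simp add: funpow_swap1)
    then have "(g ^^ d) (v e) \<in> H" using powH[OF b(2)] by simp
    then show ?case using yc y v lin H_closed by simp
  qed
  then have "(g ^^ d) (v d) \<in> H" using d by blast
  then show ?thesis using gv[of d 0] by simp
qed

end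

text \<open>Arranged to serve both targets, B itself and B \<otimes> R: of the bracket on
  \<open>T\<close> it asks for the laws that were proved for tensor products.\<close>

locale poisson_extension = codim_pair K B H + T: algebra K T
  for K :: "('k, 'x) ring_scheme" and B :: "('k, 'b, 'y) palg_scheme" (structure) and H
    and T :: "('k, 't, 'z) palg_scheme" +
  fixes f :: "'b \<Rightarrow> 't"
  assumes T: "frac_closed T"
    and T_br: "\<lbrakk>x \<in> carrier T; y \<in> carrier T\<rbrakk> \<Longrightarrow> \<lbrace>x, y\<rbrace>\<^bsub>T\<^esub> \<in> carrier T"
    and T_leibniz: "\<lbrakk>x \<in> carrier T; y \<in> carrier T; z \<in> carrier T\<rbrakk> \<Longrightarrow>
      \<lbrace>x \<otimes>\<^bsub>T\<^esub> y, z\<rbrace>\<^bsub>T\<^esub> = x \<otimes>\<^bsub>T\<^esub> \<lbrace>y, z\<rbrace>\<^bsub>T\<^esub> \<oplus>\<^bsub>T\<^esub> \<lbrace>x, z\<rbrace>\<^bsub>T\<^esub> \<otimes>\<^bsub>T\<^esub> y"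
    and T_antisym: "\<lbrakk>x \<in> carrier T; y \<in> carrier T\<rbrakk> \<Longrightarrow> \<lbrace>y, x\<rbrace>\<^bsub>T\<^esub> = \<ominus>\<^bsub>T\<^esub> \<lbrace>x, y\<rbrace>\<^bsub>T\<^esub>"
    and f: "f \<in> poisson_hom K (B\<lparr>carrier := H\<rparr>) T" and f_inj: "inj_on f H"
begin

lemma T_domain: "domain T" using T by (simp add: frac_closed_def)

lemma T_leibniz_right:
  assumes "x \<in> carrier T" "y \<in> carrier T" "z \<in> carrier T"
  shows "\<lbrace>x, y \<otimes>\<^bsub>T\<^esub> z\<rbrace>\<^bsub>T\<^esub> = y \<otimes>\<^bsub>T\<^esub> \<lbrace>x, z\<rbrace>\<^bsub>T\<^esub> \<oplus>\<^bsub>T\<^esub> \<lbrace>x, y\<rbrace>\<^bsub>T\<^esub> \<otimes>\<^bsub>T\<^esub> z"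
proof -
  have *: "\<lbrace>x, w\<rbrace>\<^bsub>T\<^esub> = \<ominus>\<^bsub>T\<^esub> \<lbrace>w, x\<rbrace>\<^bsub>T\<^esub>" if "w \<in> carrier T" for w
    using T_antisym[OF that assms(1)] .
  show ?thesis using assms by (simp add: * T_leibniz T_br T.minus_add T.r_minus T.l_minus)
qed

lemma T_cancel:
  "\<lbrakk>a \<in> carrier T; x \<in> carrier T; y \<in> carrier T; a \<noteq> \<zero>\<^bsub>T\<^esub>; a \<otimes>\<^bsub>T\<^esub> x = a \<otimes>\<^bsub>T\<^esub> y\<rbrakk> \<Longrightarrow> x = y"
  using domain.m_lcancel[OF T_domain] by blast

lemma f_simps:
  "x \<in> H \<Longrightarrow> f x \<in> carrier T"
  "\<lbrakk>x \<in> H; y \<in> H\<rbrakk> \<Longrightarrow> f (x \<oplus> y) = f x \<oplus>\<^bsub>T\<^esub> f y"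
  "\<lbrakk>x \<in> H; y \<in> H\<rbrakk> \<Longrightarrow> f (x \<otimes> y) = f x \<otimes>\<^bsub>T\<^esub> f y"
  "f \<one> = \<one>\<^bsub>T\<^esub>"
  "\<lbrakk>c \<in> carrier K; x \<in> H\<rbrakk> \<Longrightarrow> f (c \<odot> x) = c \<odot>\<^bsub>T\<^esub> f x"
  "\<lbrakk>x \<in> H; y \<in> H\<rbrakk> \<Longrightarrow> f \<lbrace>x, y\<rbrace> = \<lbrace>f x, f y\<rbrace>\<^bsub>T\<^esub>"
  using poisson_homD[OF f] by simp_all

lemma f_zero: "f \<zero> = \<zero>\<^bsub>T\<^esub>"
  using f_simps(5)[of "\<zero>\<^bsub>K\<^esub>" "\<zero>"] f_simps(1)[of "\<zero>"] H_closed(1) by simp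

lemma f_nonzero: "\<lbrakk>a \<in> H; a \<noteq> \<zero>\<rbrakk> \<Longrightarrow> f a \<noteq> \<zero>\<^bsub>T\<^esub>"
  using f_inj f_zero H_closed(1) by (metis inj_onD)

lemma f_pow: "a \<in> H \<Longrightarrow> a [^] (n::nat) \<in> H \<and> f (a [^] n) = f a [^]\<^bsub>T\<^esub> n"
  by (induction n) (auto simp: f_simps H_closed)

text \<open>Multiplied by the power \<open>d + 1\<close> of \<open>a\<close>, each power of
  \<open>b\<close> up to the \<open>d\<close>-th becomes a power of \<open>a \<otimes> b\<close>
  times at least one factor \<open>a\<close>, which is why the image is a lower form. The sequence
  starts at \<open>b\<close> and not at the unit, since the unit already lies in
  \<open>H\<close>.\<close>

lemma lower_forms_of_span:
  assumes a: "a \<in> H" and b: "b \<in> carrier B" and ab: "a \<otimes> b \<in> H"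
    and x: "x \<in> seq_span K B H (\<lambda>i. b [^] Suc i) d"
  shows "x \<in> carrier B \<and> a [^] Suc d \<otimes> x \<in> H \<and>
    f (a [^] Suc d \<otimes> x) \<in> lower_forms T (f (a \<otimes> b)) (f a) (Suc d)"
  using x
proof (induction d arbitrary: x)
  case 0
  then have x: "x \<in> H" by simp
  \<comment> \<open>An element of \<open>H\<close> supplies the constant coefficient of the
    equation, which is why the form has degree one more than the number of powers of
    \<open>b\<close>.\<close>
  have "f (a \<otimes> x) = f a \<otimes>\<^bsub>T\<^esub> (\<zero>\<^bsub>T\<^esub> \<oplus>\<^bsub>T\<^esub> f x \<otimes>\<^bsub>T\<^esub> f (a \<otimes> b) [^]\<^bsub>T\<^esub> (0::nat))"
    using a x by (simp add: f_simps)
  then have "\<exists>u c. f (a \<otimes> x) = f a \<otimes>\<^bsub>T\<^esub> (u \<oplus>\<^bsub>T\<^esub> c \<otimes>\<^bsub>T\<^esub> f (a \<otimes> b) [^]\<^bsub>T\<^esub> (0::nat)) \<and>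
      u \<in> {\<zero>\<^bsub>T\<^esub>} \<and> c \<in> carrier T"
    using f_simps(1)[OF x] by blast
  then show ?case using a x H_carrier[of a] H_carrier[of x] H_closed(4) by simp
next
  case (Suc d)
  then obtain y c where yc: "y \<in> seq_span K B H (\<lambda>i. b [^] Suc i) d" "c \<in> carrier K"
    and x: "x = y \<oplus> c \<odot> b [^] Suc d" by (auto simp: adjoin_def simp del: nat_pow_Suc)
  note IH = Suc.IH[OF yc(1)]
  let ?p = "a [^] Suc d" and ?q = "b [^] Suc d" and ?s = "a \<otimes> b"
  have aB: "a \<in> carrier B" using a H_carrier by blast
  have cl: "?p \<in> carrier B" "?q \<in> carrier B" "y \<in> carrier B" using aB b IH by auto
  have pq: "?p \<otimes> ?q = ?s [^] Suc d"
    by (rule pow_mult_distrib[OF m_comm[OF aB b] aB b, symmetric])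
  have "a [^] Suc (Suc d) \<otimes> x = a \<otimes> (?p \<otimes> x)"
    using aB cl yc(2) unfolding x nat_pow_Suc[of a "Suc d"] by (simp add: m_ac del: nat_pow_Suc)
  also have "?p \<otimes> x = ?p \<otimes> y \<oplus> c \<odot> (?s [^] Suc d)"
  proof -
    have "?p \<otimes> (c \<odot> ?q) = (c \<odot> ?q) \<otimes> ?p"
      by (rule m_comm) (use cl yc(2) in \<open>simp_all del: nat_pow_Suc\<close>)
    also have "\<dots> = c \<odot> (?q \<otimes> ?p)" by (rule smult_assoc2[OF yc(2) cl(2,1)])
    also have "?q \<otimes> ?p = ?p \<otimes> ?q" by (rule m_comm[OF cl(2,1)])
    finally show ?thesis unfolding x pq[symmetric] using cl yc(2) by (simp add: r_distr del: nat_pow_Suc)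
  qed
  finally have eq: "a [^] Suc (Suc d) \<otimes> x = a \<otimes> (?p \<otimes> y \<oplus> c \<odot> (?s [^] Suc d))" .
  note sp = f_pow[OF ab, of "Suc d"]
  have in_H: "?p \<otimes> y \<oplus> c \<odot> (?s [^] Suc d) \<in> H" using IH sp yc(2) by (simp add: H_closed del: nat_pow_Suc)
  \<comment> \<open>A scalar of the field enters the form as a multiple of the unit of
    \<open>T\<close>, since lower forms take their coefficients from the ring.\<close>
  have cT: "c \<odot>\<^bsub>T\<^esub> f ?s [^]\<^bsub>T\<^esub> Suc d = (c \<odot>\<^bsub>T\<^esub> \<one>\<^bsub>T\<^esub>) \<otimes>\<^bsub>T\<^esub> f ?s [^]\<^bsub>T\<^esub> Suc d"
    using yc(2) f_simps(1)[OF ab] by (simp add: T.smult_assoc2 del: T.nat_pow_Suc)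
  have "f (a [^] Suc (Suc d) \<otimes> x) =
      f a \<otimes>\<^bsub>T\<^esub> (f (?p \<otimes> y) \<oplus>\<^bsub>T\<^esub> (c \<odot>\<^bsub>T\<^esub> \<one>\<^bsub>T\<^esub>) \<otimes>\<^bsub>T\<^esub> f ?s [^]\<^bsub>T\<^esub> Suc d)"
    unfolding eq cT[symmetric] using a in_H IH sp yc(2) H_closed(6)
    by (simp add: f_simps del: nat_pow_Suc T.nat_pow_Suc)
  then have "f (a [^] Suc (Suc d) \<otimes> x) \<in> lower_forms T (f ?s) (f a) (Suc (Suc d))"
    unfolding lower_forms.simps(2)[of _ _ _ "Suc d"] using IH yc(2) by blast
  moreover have "x \<in> carrier B" unfolding x using cl yc(2) by (simp del: nat_pow_Suc)
  moreover have "a [^] Suc (Suc d) \<otimes> x \<in> H" unfolding eq using a in_H by (rule H_closed(4))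
  ultimately show ?case by blast
qed

lemma quotient_exists:
  assumes a: "a \<in> H" "a \<noteq> \<zero>" and b: "b \<in> carrier B" and ab: "a \<otimes> b \<in> H"
  obtains w where "w \<in> carrier T" "f a \<otimes>\<^bsub>T\<^esub> w = f (a \<otimes> b)"
proof -
  obtain d where d: "b [^] Suc d \<in> seq_span K B H (\<lambda>i. b [^] Suc i) d"
    using dependent_mod_H[of "\<lambda>i. b [^] Suc i"] b by blast
  have aB: "a \<in> carrier B" using a H_carrier by blast
  have "a [^] Suc d \<otimes> b [^] Suc d = (a \<otimes> b) [^] Suc d"
    by (rule pow_mult_distrib[OF m_comm[OF aB b] aB b, symmetric])
  then have "f (a \<otimes> b) [^]\<^bsub>T\<^esub> Suc d \<in> lower_forms T (f (a \<otimes> b)) (f a) (Suc d)"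
    using lower_forms_of_span[OF a(1) b ab d] f_pow[OF ab, of "Suc d"] by metis
  then obtain w where "w \<in> carrier T" "f (a \<otimes> b) = w \<otimes>\<^bsub>T\<^esub> f a"
    using frac_closedD[OF T f_simps(1)[OF ab] f_simps(1)[OF a(1)] f_nonzero[OF a]] by blast
  then show ?thesis using that f_simps(1)[OF a(1)] T.m_comm by metis
qed

text \<open>The value must fit all denominators at once, so any convenient one may be used later. A
  nonzero denominator exists for every \<open>b\<close> and determines the value.\<close>

definition ext :: "'b \<Rightarrow> 't" where
  "ext b = (SOME w. w \<in> carrier T \<and> (\<forall>a\<in>H. a \<otimes> b \<in> H \<longrightarrow> f a \<otimes>\<^bsub>T\<^esub> w = f (a \<otimes> b)))"

lemma ext_props:
  assumes b: "b \<in> carrier B"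
  shows "ext b \<in> carrier T" "\<lbrakk>a \<in> H; a \<otimes> b \<in> H\<rbrakk> \<Longrightarrow> f a \<otimes>\<^bsub>T\<^esub> ext b = f (a \<otimes> b)"
proof -
  obtain c where c: "c \<in> H" "c \<noteq> \<zero>" "c \<otimes> b \<in> H" using denominator[OF b] .
  obtain w where w: "w \<in> carrier T" "f c \<otimes>\<^bsub>T\<^esub> w = f (c \<otimes> b)" using quotient_exists[OF c(1,2) b c(3)] .
  \<comment> \<open>A quotient found with one denominator \<open>c\<close> fits every other
    \<open>a\<close>: multiply by the nonzero \<open>f c\<close> and interchange the two
    factors.\<close>
  have "f a \<otimes>\<^bsub>T\<^esub> w = f (a \<otimes> b)" if a: "a \<in> H" "a \<otimes> b \<in> H" for a
  proof (rule T_cancel[OF f_simps(1)[OF c(1)] _ _ f_nonzero[OF c(1,2)]])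
    have "f c \<otimes>\<^bsub>T\<^esub> (f a \<otimes>\<^bsub>T\<^esub> w) = f a \<otimes>\<^bsub>T\<^esub> f (c \<otimes> b)"
      using a c w f_simps(1) by (simp add: w(2)[symmetric] T.m_lcomm)
    also have "\<dots> = f (a \<otimes> (c \<otimes> b))" using a c by (simp add: f_simps)
    also have "a \<otimes> (c \<otimes> b) = c \<otimes> (a \<otimes> b)" using a c b H_carrier by (simp add: m_lcomm)
    also have "f \<dots> = f c \<otimes>\<^bsub>T\<^esub> f (a \<otimes> b)" using a c by (simp add: f_simps)
    finally show "f c \<otimes>\<^bsub>T\<^esub> (f a \<otimes>\<^bsub>T\<^esub> w) = f c \<otimes>\<^bsub>T\<^esub> f (a \<otimes> b)" .
  qed (use a w f_simps(1) in auto)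
  then have "\<exists>w. w \<in> carrier T \<and> (\<forall>a\<in>H. a \<otimes> b \<in> H \<longrightarrow> f a \<otimes>\<^bsub>T\<^esub> w = f (a \<otimes> b))" using w by blast
  from someI_ex[OF this]
  show "ext b \<in> carrier T" "\<lbrakk>a \<in> H; a \<otimes> b \<in> H\<rbrakk> \<Longrightarrow> f a \<otimes>\<^bsub>T\<^esub> ext b = f (a \<otimes> b)"
    unfolding ext_def by blast+
qed

lemma ext_eqI:
  assumes "b \<in> carrier B" "a \<in> H" "a \<noteq> \<zero>" "a \<otimes> b \<in> H" "w \<in> carrier T" "f a \<otimes>\<^bsub>T\<^esub> w = f (a \<otimes> b)"
  shows "ext b = w"
  using T_cancel[OF f_simps(1)[OF assms(2)] ext_props(1)[OF assms(1)] assms(5) f_nonzero[OF assms(2,3)]]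
    ext_props(2)[OF assms(1,2,4)] assms(6) by simp

lemma ext_extends: assumes "a \<in> H" shows "ext a = f a"
  using assms H_closed(2) H_carrier f_simps(1,4)
  by (intro ext_eqI[of a "\<one>"]) auto

lemma ext_add:
  assumes x: "x \<in> carrier B" and y: "y \<in> carrier B" shows "ext (x \<oplus> y) = ext x \<oplus>\<^bsub>T\<^esub> ext y"
proof -
  obtain a where a: "a \<in> H" "a \<noteq> \<zero>" "a \<otimes> x \<in> H" using denominator[OF x] .
  obtain c where c: "c \<in> H" "c \<noteq> \<zero>" "c \<otimes> y \<in> H" using denominator[OF y] .
  note AB = H_carrier[OF a(1)] H_carrier[OF c(1)]
  have x': "(a \<otimes> c) \<otimes> x = c \<otimes> (a \<otimes> x)" and y': "(a \<otimes> c) \<otimes> y = a \<otimes> (c \<otimes> y)"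
    using AB x y by (simp_all add: m_ac)
  have h: "(a \<otimes> c) \<otimes> x \<in> H" "(a \<otimes> c) \<otimes> y \<in> H" "a \<otimes> c \<in> H"
    unfolding x' y' using a c H_closed by auto
  show ?thesis
  proof (rule ext_eqI[of _ "a \<otimes> c"])
    show "a \<otimes> c \<noteq> \<zero>" using a c AB integral by blast
    have e: "(a \<otimes> c) \<otimes> (x \<oplus> y) = (a \<otimes> c) \<otimes> x \<oplus> (a \<otimes> c) \<otimes> y"
      using AB x y by (simp add: r_distr)
    show "(a \<otimes> c) \<otimes> (x \<oplus> y) \<in> H" unfolding e using h by (simp add: H_closed)
    show "f (a \<otimes> c) \<otimes>\<^bsub>T\<^esub> (ext x \<oplus>\<^bsub>T\<^esub> ext y) = f ((a \<otimes> c) \<otimes> (x \<oplus> y))"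
      unfolding e f_simps(2)[OF h(1,2)] ext_props(2)[OF x h(3,1), symmetric] ext_props(2)[OF y h(3,2), symmetric]
      using f_simps(1)[OF h(3)] ext_props(1) x y by (simp add: T.r_distr)
  qed (use x y h ext_props(1) in auto)
qed

lemma ext_mult:
  assumes x: "x \<in> carrier B" and y: "y \<in> carrier B" shows "ext (x \<otimes> y) = ext x \<otimes>\<^bsub>T\<^esub> ext y"
proof -
  obtain a where a: "a \<in> H" "a \<noteq> \<zero>" "a \<otimes> x \<in> H" using denominator[OF x] .
  obtain c where c: "c \<in> H" "c \<noteq> \<zero>" "c \<otimes> y \<in> H" using denominator[OF y] .
  note AB = H_carrier[OF a(1)] H_carrier[OF c(1)]
  show ?thesis
  proof (rule ext_eqI[of _ "a \<otimes> c"])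
    show "a \<otimes> c \<noteq> \<zero>" using a c AB integral by blast
    have e: "(a \<otimes> c) \<otimes> (x \<otimes> y) = (a \<otimes> x) \<otimes> (c \<otimes> y)"
      using AB x y by (simp add: m_ac)
    show "(a \<otimes> c) \<otimes> (x \<otimes> y) \<in> H" unfolding e using a c by (simp add: H_closed)
    show "f (a \<otimes> c) \<otimes>\<^bsub>T\<^esub> (ext x \<otimes>\<^bsub>T\<^esub> ext y) = f ((a \<otimes> c) \<otimes> (x \<otimes> y))"
      unfolding e f_simps(3)[OF a(3) c(3)] f_simps(3)[OF a(1) c(1)]
        ext_props(2)[OF x a(1,3), symmetric] ext_props(2)[OF y c(1,3), symmetric]
      using f_simps(1)[OF a(1)] f_simps(1)[OF c(1)] ext_props(1) x y by (simp add: T.m_ac)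
  qed (use x y a c H_closed ext_props(1) in auto)
qed

lemma ext_smult:
  assumes k: "k \<in> carrier K" and x: "x \<in> carrier B" shows "ext (k \<odot> x) = k \<odot>\<^bsub>T\<^esub> ext x"
proof -
  have "k \<odot> x = (k \<odot> \<one>) \<otimes> x" using k x by (simp add: smult_assoc2)
  moreover have "k \<odot> \<one> \<in> H" using k by (simp add: H_closed)
  ultimately have "ext (k \<odot> x) = f (k \<odot> \<one>) \<otimes>\<^bsub>T\<^esub> ext x"
    using x H_carrier by (simp add: ext_mult ext_extends)
  then show ?thesis using k ext_props(1)[OF x] H_closed(2) by (simp add: f_simps T.smult_assoc2)
qed

text \<open>Denominators are cleared in one argument at a time. The Leibniz rule for
  \<open>a \<otimes> x\<close> isolates the bracket with \<open>x\<close> multiplied by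
  \<open>a\<close>; the other term contains the bracket of two elements of \<open>H\<close>, on
  which \<open>f\<close> is already a Poisson morphism.\<close>

lemma ext_bracket_H:
  assumes x: "x \<in> carrier B" and z: "z \<in> H" shows "ext \<lbrace>x, z\<rbrace> = \<lbrace>ext x, f z\<rbrace>\<^bsub>T\<^esub>"
proof -
  obtain a where a: "a \<in> H" "a \<noteq> \<zero>" "a \<otimes> x \<in> H" using denominator[OF x] .
  note c = H_carrier[OF a(1)] H_carrier[OF z] ext_props(1)[OF x] f_simps(1)[OF a(1)] f_simps(1)[OF z]
  have az: "\<lbrace>a, z\<rbrace> \<in> H" using a z by (simp add: H_closed)
  have "f a \<otimes>\<^bsub>T\<^esub> \<lbrace>ext x, f z\<rbrace>\<^bsub>T\<^esub> \<oplus>\<^bsub>T\<^esub> \<lbrace>f a, f z\<rbrace>\<^bsub>T\<^esub> \<otimes>\<^bsub>T\<^esub> ext x = \<lbrace>f a \<otimes>\<^bsub>T\<^esub> ext x, f z\<rbrace>\<^bsub>T\<^esub>"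
    using c by (simp add: T_leibniz)
  also have "\<dots> = f \<lbrace>a \<otimes> x, z\<rbrace>" using a z by (simp add: ext_props(2)[OF x] f_simps)
  also have "\<dots> = ext (a \<otimes> \<lbrace>x, z\<rbrace> \<oplus> \<lbrace>a, z\<rbrace> \<otimes> x)"
    using a z c x br_H by (simp add: ext_extends bracket_leibniz[symmetric])
  also have "\<dots> = f a \<otimes>\<^bsub>T\<^esub> ext \<lbrace>x, z\<rbrace> \<oplus>\<^bsub>T\<^esub> \<lbrace>f a, f z\<rbrace>\<^bsub>T\<^esub> \<otimes>\<^bsub>T\<^esub> ext x"
    using a z c x az by (simp add: ext_add ext_mult ext_extends bracket_closed f_simps)
  finally have "f a \<otimes>\<^bsub>T\<^esub> \<lbrace>ext x, f z\<rbrace>\<^bsub>T\<^esub> = f a \<otimes>\<^bsub>T\<^esub> ext \<lbrace>x, z\<rbrace>"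
    using c x by (simp add: T_br bracket_closed ext_props(1))
  then show ?thesis
    using T_cancel[OF c(4) _ _ f_nonzero[OF a(1,2)]] c x by (metis T_br bracket_closed ext_props(1))
qed

text \<open>Clearing the denominator of \<open>y\<close> reduces both brackets that occur to the
  case of a second argument in \<open>H\<close>.\<close>

lemma ext_bracket:
  assumes x: "x \<in> carrier B" and y: "y \<in> carrier B" shows "ext \<lbrace>x, y\<rbrace> = \<lbrace>ext x, ext y\<rbrace>\<^bsub>T\<^esub>"
proof -
  obtain a where a: "a \<in> H" "a \<noteq> \<zero>" "a \<otimes> y \<in> H" using denominator[OF y] .
  note c = H_carrier[OF a(1)] ext_props(1)[OF x] ext_props(1)[OF y] f_simps(1)[OF a(1)]
  have "f a \<otimes>\<^bsub>T\<^esub> \<lbrace>ext x, ext y\<rbrace>\<^bsub>T\<^esub> \<oplus>\<^bsub>T\<^esub> \<lbrace>ext x, f a\<rbrace>\<^bsub>T\<^esub> \<otimes>\<^bsub>T\<^esub> ext y = \<lbrace>ext x, f a \<otimes>\<^bsub>T\<^esub> ext y\<rbrace>\<^bsub>T\<^esub>"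
    using c by (simp add: T_leibniz_right)
  also have "\<dots> = ext \<lbrace>x, a \<otimes> y\<rbrace>" using a x by (simp add: ext_props(2)[OF y] ext_bracket_H)
  also have "\<dots> = ext (a \<otimes> \<lbrace>x, y\<rbrace> \<oplus> \<lbrace>x, a\<rbrace> \<otimes> y)"
    using c x y by (simp add: bracket_simps(3))
  also have "\<dots> = f a \<otimes>\<^bsub>T\<^esub> ext \<lbrace>x, y\<rbrace> \<oplus>\<^bsub>T\<^esub> \<lbrace>ext x, f a\<rbrace>\<^bsub>T\<^esub> \<otimes>\<^bsub>T\<^esub> ext y"
    using a c x y by (simp add: ext_add ext_mult ext_extends bracket_closed ext_bracket_H)
  finally have "f a \<otimes>\<^bsub>T\<^esub> \<lbrace>ext x, ext y\<rbrace>\<^bsub>T\<^esub> = f a \<otimes>\<^bsub>T\<^esub> ext \<lbrace>x, y\<rbrace>"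
    using c x y by (simp add: T_br bracket_closed ext_props(1))
  then show ?thesis
    using T_cancel[OF c(4) _ _ f_nonzero[OF a(1,2)]] c x y by (metis T_br bracket_closed ext_props(1))
qed

lemma ext_poisson_hom: "ext \<in> poisson_hom K B T"
  using ext_extends[OF H_closed(2)] f_simps(4)
  by (intro poisson_homI) (simp_all add: ext_props(1) ext_add ext_mult ext_smult ext_bracket)

lemma ext_inj: "inj_on ext (carrier B)"
proof (rule inj_onI)
  fix x y assume xy: "x \<in> carrier B" "y \<in> carrier B" "ext x = ext y"
  obtain a where a: "a \<in> H" "a \<noteq> \<zero>" "a \<otimes> x \<in> H" using denominator[OF xy(1)] .
  obtain c where c: "c \<in> H" "c \<noteq> \<zero>" "c \<otimes> y \<in> H" using denominator[OF xy(2)] .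
  have "f (c \<otimes> (a \<otimes> x)) = f (a \<otimes> (c \<otimes> y))"
    using a c xy f_simps(1)[OF a(1)] f_simps(1)[OF c(1)] ext_props(1)[OF xy(2)]
    by (simp add: f_simps ext_props(2)[symmetric] T.m_lcomm)
  then have "c \<otimes> (a \<otimes> x) = a \<otimes> (c \<otimes> y)"
    using f_inj a c H_closed by (meson inj_onD)
  then have "c \<otimes> (a \<otimes> x) = c \<otimes> (a \<otimes> y)"
    using H_carrier[OF a(1)] H_carrier[OF c(1)] xy by (simp add: m_lcomm)
  then show "x = y" using H_carrier[OF a(1)] H_carrier[OF c(1)] xy a c by (simp add: m_lcancel)
qed

end

section \<open>Tensor products with polynomial algebras\<close>


lemma frac_closed_iso_sym:
  assumes "frac_closed S" "cring R" "h \<in> ring_hom R S" "bij_betw h (carrier R) (carrier S)"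
  shows "frac_closed R"
proof -
  interpret R: cring R by fact
  have "h \<in> ring_iso R S" using assms by (simp add: ring_iso_def)
  then have "inv_into (carrier R) h \<in> ring_iso S R" by (rule ring_iso_set_sym[OF R.ring_axioms])
  then show ?thesis using frac_closed_iso[OF assms(1,2)] unfolding ring_iso_def by blast
qed

lemma base_palg_poisson:
  assumes "field K" shows "poisson_algebra K (base_palg K)"
proof -
  interpret field K by fact
  have cr: "cring (base_palg K)"
    by (rule cring_cong[OF _ _ _ _ _ is_cring]) (simp_all add: base_palg_def)
  have "algebra K (base_palg K)"
    by (rule algebraI[OF is_cring cr]) (simp_all add: base_palg_def l_distr r_distr m_assoc)
  moreover have "\<ominus>\<^bsub>base_palg K\<^esub> \<zero>\<^bsub>base_palg K\<^esub> = \<zero>\<^bsub>base_palg K\<^esub>"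
    using cring.cring_simprules(22)[OF cr] ring.minus_zero[OF cring.axioms(1)[OF cr]] by simp
  ultimately show ?thesis
    by (intro poisson_algebra.intro poisson_algebra_axioms.intro field_axioms)
      (simp_all add: base_palg_def)
qed

lemma poly_palg_simps:
  "carrier (poly_palg K n) = carrier (monoid_algebra K (monomials n))"
  "add (poly_palg K n) = add (monoid_algebra K (monomials n))"
  "zero (poly_palg K n) = zero (monoid_algebra K (monomials n))"
  "mult (poly_palg K n) = mult (monoid_algebra K (monomials n))"
  "one (poly_palg K n) = one (monoid_algebra K (monomials n))"
  "smult (poly_palg K n) = smult (monoid_algebra K (monomials n))"
  "\<lbrace>p, q\<rbrace>\<^bsub>poly_palg K n\<^esub> = \<zero>\<^bsub>monoid_algebra K (monomials n)\<^esub>"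
  by (simp_all add: poly_palg_def module.defs palg.defs)

lemma poly_palg_poisson:
  assumes "field K" shows "poisson_algebra K (poly_palg K n)"
proof -
  interpret field K by fact
  interpret M: monoid_alg K "monomials n" "monoid_algebra K (monomials n)"
    by (intro monoid_alg.intro is_cring monomials_comm_monoid)
  interpret C: algebra K "monoid_algebra K (monomials n)" by (rule M.alg_algebra)
  have cr: "cring (poly_palg K n)"
    by (rule cring_cong[OF _ _ _ _ _ M.alg_cring]) (simp_all add: poly_palg_simps)
  interpret Q: cring "poly_palg K n" by (rule cr)
  have "algebra K (poly_palg K n)"
    by (rule algebraI[OF is_cring cr])
      (simp_all add: poly_palg_simps C.smult_l_distr C.smult_r_distr C.smult_assoc1 C.smult_assoc2)
  moreover have "\<ominus>\<^bsub>poly_palg K n\<^esub> \<zero>\<^bsub>poly_palg K n\<^esub> = \<zero>\<^bsub>poly_palg K n\<^esub>" by (rule Q.minus_zero)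
  ultimately show ?thesis
    by (intro poisson_algebra.intro poisson_algebra_axioms.intro field_axioms)
      (simp_all add: poly_palg_simps)
qed

text \<open>In characteristic zero the natural multiples of the unit are pairwise distinct, and
  nonzero differences in a field are units.\<close>

lemma field_unit_separated:
  assumes "field K" "char_zero K"
  shows "unit_separated K"
proof -
  interpret field K by fact
  have lt: "add_pow K m \<one>\<^bsub>K\<^esub> \<noteq> add_pow K n \<one>\<^bsub>K\<^esub>" if "m < n" for m n :: nat
  proof
    assume eq: "add_pow K m \<one>\<^bsub>K\<^esub> = add_pow K n \<one>\<^bsub>K\<^esub>"
    have "add_pow K n \<one>\<^bsub>K\<^esub> = add_pow K m \<one>\<^bsub>K\<^esub> \<oplus>\<^bsub>K\<^esub> add_pow K (n - m) \<one>\<^bsub>K\<^esub>"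
      using that by (simp add: add.nat_pow_mult)
    then have "add_pow K (n - m) \<one>\<^bsub>K\<^esub> = \<zero>\<^bsub>K\<^esub>"
      using eq by (metis add.r_cancel_one' add.nat_pow_closed a_comm one_closed)
    then show False using assms(2) that by (simp add: char_zero_def)
  qed
  have "inj (\<lambda>m::nat. add_pow K m \<one>\<^bsub>K\<^esub>)"
    by (rule linorder_injI) (use lt in blast)
  then have "infinite (range (\<lambda>m::nat. add_pow K m \<one>\<^bsub>K\<^esub>))" by (rule range_inj_infinite)
  moreover have "range (\<lambda>m::nat. add_pow K m \<one>\<^bsub>K\<^esub>) \<subseteq> carrier K" by auto
  moreover have "x \<ominus>\<^bsub>K\<^esub> y \<in> Units K" if "x \<in> carrier K" "y \<in> carrier K" "x \<noteq> y" for x y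
    using that field_Units r_right_minus_eq by auto
  ultimately show ?thesis unfolding unit_separated_def by (meson subsetD)
qed

lemma poisson_domain_unit_separated:
  assumes "poisson_domain K B" "char_zero K"
  shows "unit_separated B"
proof -
  interpret poisson_domain K B by fact
  have h: "(\<lambda>c. c \<odot>\<^bsub>B\<^esub> \<one>\<^bsub>B\<^esub>) \<in> ring_hom K B"
    by (rule ring_hom_memI) (simp_all add: smult_l_distr smult_assoc1 smult_assoc2)
  interpret h: ring_hom_cring K B "\<lambda>c. c \<odot>\<^bsub>B\<^esub> \<one>\<^bsub>B\<^esub>"
    by (rule ring_hom_cring_of_hom[OF K.is_cring M_cring h])
  have "inj_on (\<lambda>c. c \<odot>\<^bsub>B\<^esub> \<one>\<^bsub>B\<^esub>) (carrier K)"
  proof (rule inj_onI, rule ccontr)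
    fix c d assume cd: "c \<in> carrier K" "d \<in> carrier K" "c \<odot>\<^bsub>B\<^esub> \<one>\<^bsub>B\<^esub> = d \<odot>\<^bsub>B\<^esub> \<one>\<^bsub>B\<^esub>" "c \<noteq> d"
    have u: "c \<ominus>\<^bsub>K\<^esub> d \<in> Units K" using cd K.field_Units K.r_right_minus_eq by auto
    have "(c \<ominus>\<^bsub>K\<^esub> d) \<odot>\<^bsub>B\<^esub> \<one>\<^bsub>B\<^esub> = \<zero>\<^bsub>B\<^esub>"
      using cd by (simp add: K.minus_eq smult_l_distr smult_l_minus r_neg)
    then have "inv\<^bsub>K\<^esub> (c \<ominus>\<^bsub>K\<^esub> d) \<odot>\<^bsub>B\<^esub> ((c \<ominus>\<^bsub>K\<^esub> d) \<odot>\<^bsub>B\<^esub> \<one>\<^bsub>B\<^esub>) = \<zero>\<^bsub>B\<^esub>" using u by simp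
    then show False
      using u smult_assoc1[OF K.Units_inv_closed[OF u] K.Units_closed[OF u] one_closed] by simp
  qed
  then show ?thesis
    using h.unit_separated_hom[OF field_unit_separated[OF K.field_axioms assms(2)]] by blast
qed

section \<open>The isomorphism of B \<otimes> K[x] with B[x]\<close>

locale poly_tensor = poisson_domain K B
  for K :: "('k, 'x) ring_scheme" and B :: "('k, 'b, 'y) palg_scheme" +
  fixes n :: nat
begin

abbreviation "Rn \<equiv> poly_palg K n"
abbreviation "C \<equiv> monoid_algebra B (monomials n)"

sublocale t: tensor_pair K B Rn
  by (intro tensor_pair.intro poisson_algebra_axioms K.field_axioms poly_palg_poisson)

sublocale KM: monoid_alg K "monomials n" "monoid_algebra K (monomials n)"
  by (intro monoid_alg.intro K.is_cring monomials_comm_monoid)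

sublocale CM: monoid_alg B "monomials n" C
  by (intro monoid_alg.intro M_cring monomials_comm_monoid)

sublocale CC: cring C by (rule CM.alg_cring)

text \<open>The polynomial algebra over \<open>B\<close> with scalars restricted to the ground
  field, because lifts from the tensor product take values in a \<open>K\<close>-module.\<close>

definition CK :: "('k, nat multiset \<Rightarrow> 'b) module" where
  "CK = \<lparr>carrier = carrier C, mult = mult C, one = one C, zero = zero C, add = add C,
     smult = (\<lambda>c q m. c \<odot>\<^bsub>B\<^esub> q m)\<rparr>"

text \<open>The product \<open>b p\<close> in B[x], which is to be the image of b \<otimes>
  p.\<close>

definition scal :: "'b \<Rightarrow> (nat multiset \<Rightarrow> 'k) \<Rightarrow> nat multiset \<Rightarrow> 'b" where
  "scal b p = (\<lambda>m. p m \<odot>\<^bsub>B\<^esub> b)"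

lemma CK_module: "module K CK"
proof (rule moduleI[OF K.is_cring])
  show "abelian_group CK" by (rule abelian_group_cong[OF _ _ _ CC.abelian_group_axioms]) (simp_all add: CK_def)
  show "c \<odot>\<^bsub>CK\<^esub> q \<in> carrier CK" if "c \<in> carrier K" "q \<in> carrier CK" for c q
    using that free_map_closed[of q _ "\<lambda>x. c \<odot>\<^bsub>B\<^esub> x"] by (simp add: CK_def CM.alg_simps)
qed (auto simp: CK_def CM.alg_simps fun_eq_iff free_carrierD(1) smult_l_distr smult_r_distr smult_assoc1)

lemma Rn_carrier: "p \<in> carrier Rn \<longleftrightarrow> p \<in> free_carrier K (carrier (monomials n))"
  by (simp add: poly_palg_simps KM.alg_simps)

lemma scal_closed:
  assumes b: "b \<in> carrier B" and p: "p \<in> carrier Rn"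
  shows "scal b p \<in> carrier C"
proof -
  note p' = p[unfolded Rn_carrier]
  have "fun_supp B (scal b p) \<subseteq> fun_supp K p" using b by (auto simp: fun_supp_def scal_def)
  then show ?thesis using K.free_carrierD[OF p'] b
    by (auto simp: CM.alg_simps free_carrier_def scal_def intro: finite_subset)
qed

sublocale l: tensor_lift K B Rn CK scal
proof (intro tensor_lift.intro tensor_lift_axioms.intro t.tensor_pair_axioms CK_module)
  note p = K.free_carrierD(1)[OF Rn_carrier[THEN iffD1]]
  show "scal a b \<in> carrier CK" if "a \<in> carrier B" "b \<in> carrier Rn" for a b
    using scal_closed[OF that] by (simp add: CK_def)
  show "scal (a \<oplus>\<^bsub>B\<^esub> a') b = scal a b \<oplus>\<^bsub>CK\<^esub> scal a' b"
    if "a \<in> carrier B" "a' \<in> carrier B" "b \<in> carrier Rn" for a a' b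
    using that p by (simp add: scal_def CK_def CM.alg_simps smult_r_distr)
  show "scal a (b \<oplus>\<^bsub>Rn\<^esub> b') = scal a b \<oplus>\<^bsub>CK\<^esub> scal a b'"
    if "a \<in> carrier B" "b \<in> carrier Rn" "b' \<in> carrier Rn" for a b b'
    using that p by (simp add: scal_def CK_def CM.alg_simps poly_palg_simps(2) KM.alg_simps smult_l_distr)
  show "scal (c \<odot>\<^bsub>B\<^esub> a) b = c \<odot>\<^bsub>CK\<^esub> scal a b"
    if "c \<in> carrier K" "a \<in> carrier B" "b \<in> carrier Rn" for c a b
    using that p by (simp add: scal_def CK_def smult_assoc1[symmetric] K.m_comm)
  show "scal a (c \<odot>\<^bsub>Rn\<^esub> b) = c \<odot>\<^bsub>CK\<^esub> scal a b"
    if "c \<in> carrier K" "a \<in> carrier B" "b \<in> carrier Rn" for c a b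
    using that p by (simp add: scal_def CK_def poly_palg_simps(6) KM.alg_simps smult_assoc1)
qed

lemma scal_single: "\<lbrakk>b \<in> carrier B\<rbrakk> \<Longrightarrow> scal b (free_single K m c) = free_single B m (c \<odot>\<^bsub>B\<^esub> b)"
  by (auto simp: scal_def free_single_def)

lemma Rn_add: "(\<lambda>s. x s \<oplus>\<^bsub>K\<^esub> y s) = x \<oplus>\<^bsub>Rn\<^esub> y"
  by (simp add: poly_palg_simps KM.alg_simps)

lemma Rn_single: "\<lbrakk>m \<in> carrier (monomials n); c \<in> carrier K\<rbrakk> \<Longrightarrow> free_single K m c \<in> carrier Rn"
  by (simp add: Rn_carrier K.free_single_closed)

lemma Rn_zero: "(\<lambda>_. \<zero>\<^bsub>K\<^esub>) = \<zero>\<^bsub>Rn\<^esub>"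
  by (simp add: poly_palg_simps KM.alg_simps)

lemma scal_zero: "b \<in> carrier B \<Longrightarrow> scal b \<zero>\<^bsub>Rn\<^esub> = \<zero>\<^bsub>C\<^esub>"
  by (simp add: scal_def Rn_zero[symmetric] CM.alg_simps)

lemma scal_add: "\<lbrakk>b \<in> carrier B; p \<in> carrier Rn; q \<in> carrier Rn\<rbrakk> \<Longrightarrow> scal b (p \<oplus>\<^bsub>Rn\<^esub> q) = scal b p \<oplus>\<^bsub>C\<^esub> scal b q"
  using l.h_add_right by (simp add: CK_def)

lemma scal_mult:
  assumes b: "b \<in> carrier B" "b' \<in> carrier B" and p: "p \<in> carrier Rn" and q: "q \<in> carrier Rn"
  shows "scal (b \<otimes>\<^bsub>B\<^esub> b') (p \<otimes>\<^bsub>Rn\<^esub> q) = scal b p \<otimes>\<^bsub>C\<^esub> scal b' q"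
  using p[unfolded Rn_carrier]
proof (induction rule: K.free_induct)
  case zero
  then show ?case using b q by (simp add: Rn_zero scal_zero scal_closed)
next
  case (single s c)
  note s = single
  show ?case using q[unfolded Rn_carrier]
  proof (induction rule: K.free_induct)
    case zero
    then show ?case using b s Rn_single by (simp add: Rn_zero scal_zero scal_closed)
  next
    case (single t d)
    have e: "(c \<otimes>\<^bsub>K\<^esub> d) \<odot>\<^bsub>B\<^esub> (b \<otimes>\<^bsub>B\<^esub> b') = (c \<odot>\<^bsub>B\<^esub> b) \<otimes>\<^bsub>B\<^esub> (d \<odot>\<^bsub>B\<^esub> b')"
    proof -
      have "(c \<odot>\<^bsub>B\<^esub> b) \<otimes>\<^bsub>B\<^esub> (d \<odot>\<^bsub>B\<^esub> b') = c \<odot>\<^bsub>B\<^esub> (b \<otimes>\<^bsub>B\<^esub> (d \<odot>\<^bsub>B\<^esub> b'))"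
        using b s single by (intro smult_assoc2) auto
      also have "b \<otimes>\<^bsub>B\<^esub> (d \<odot>\<^bsub>B\<^esub> b') = (d \<odot>\<^bsub>B\<^esub> b') \<otimes>\<^bsub>B\<^esub> b" using b single by (intro m_comm) auto
      also have "\<dots> = d \<odot>\<^bsub>B\<^esub> (b' \<otimes>\<^bsub>B\<^esub> b)" using b single by (intro smult_assoc2) auto
      finally show ?thesis using b s single by (simp add: smult_assoc1 m_comm)
    qed
    have st: "s \<otimes>\<^bsub>monomials n\<^esub> t \<in> carrier (monomials n)" using s single by (auto simp: monomials_def)
    show ?case using b s single st
      by (simp add: poly_palg_simps(4) KM.single_mult scal_single CM.single_mult e)
  next
    case (add x y)
    then have "x \<in> carrier Rn" "y \<in> carrier Rn" by (simp_all add: Rn_carrier)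
    then show ?case using add b s Rn_single
      by (simp add: Rn_add scal_add scal_closed t.Q.r_distr CC.r_distr)
  qed
next
  case (add x y)
  then have "x \<in> carrier Rn" "y \<in> carrier Rn" by (simp_all add: Rn_carrier)
  then show ?case using add b q
    by (simp add: Rn_add scal_add scal_closed t.Q.l_distr CC.l_distr)
qed

lemma theta_hom: "l.lift \<in> ring_hom t.T C"
proof (rule ring_hom_memI)
  show cl: "l.lift U \<in> carrier C" if "U \<in> carrier t.T" for U
    using l.lift_closed[OF that] by (simp add: CK_def)
  show ad: "l.lift (U \<oplus>\<^bsub>t.T\<^esub> V) = l.lift U \<oplus>\<^bsub>C\<^esub> l.lift V" if "U \<in> carrier t.T" "V \<in> carrier t.T" for U V
    using l.lift_add[OF that] by (simp add: CK_def)
  have "scal \<one>\<^bsub>B\<^esub> \<one>\<^bsub>Rn\<^esub> = \<one>\<^bsub>C\<^esub>"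
    by (simp add: poly_palg_simps(5) KM.alg_simps CM.alg_simps scal_single)
  then show "l.lift \<one>\<^bsub>t.T\<^esub> = \<one>\<^bsub>C\<^esub>" by (simp add: t.pure_one l.lift_pure)
  fix U V assume U: "U \<in> carrier t.T" and V: "V \<in> carrier t.T"
  show "l.lift (U \<otimes>\<^bsub>t.T\<^esub> V) = l.lift U \<otimes>\<^bsub>C\<^esub> l.lift V"
    using U
  proof (induction rule: t.tensor_induct)
    case (pure a b)
    show ?case using V
    proof (induction rule: t.tensor_induct)
      case (pure a' b')
      then show ?case using \<open>a \<in> _\<close> \<open>b \<in> _\<close> by (simp add: t.pure_mult l.lift_pure scal_mult)
    qed (use \<open>a \<in> _\<close> \<open>b \<in> _\<close> in \<open>simp add: t.TR.r_distr CC.r_distr ad cl\<close>)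
  qed (use V in \<open>simp add: t.TR.l_distr CC.l_distr ad cl\<close>)
qed

text \<open>The inverse of the lifted map: a polynomial over \<open>B\<close> goes to the sum of its
  coefficients, each tensored with its monomial.\<close>

definition sigma where
  "sigma = supp_sum B t.T (\<lambda>m b. t.pure b (free_single K m \<one>\<^bsub>K\<^esub>))"

lemma sigma_family:
  "additive_family B t.T (carrier (monomials n)) (\<lambda>m b. t.pure b (free_single K m \<one>\<^bsub>K\<^esub>))"
  by unfold_locales (simp_all add: Rn_single t.pure_add_left)

lemma sigma_scal:
  assumes b: "b \<in> carrier B" and p: "p \<in> carrier Rn"
  shows "sigma (scal b p) = t.pure b p"
  using p[unfolded Rn_carrier]
proof (induction rule: K.free_induct)
  case zero
  have "sigma (scal b \<zero>\<^bsub>Rn\<^esub>) = \<zero>\<^bsub>t.T\<^esub>"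
    using b by (simp add: scal_zero sigma_def supp_sum_def fun_supp_def CM.alg_simps)
  then show ?case using b by (simp add: Rn_zero t.pure_zero_right)
next
  case (single m c)
  have "free_single K m c = c \<odot>\<^bsub>Rn\<^esub> free_single K m \<one>\<^bsub>K\<^esub>"
    using single by (auto simp: poly_palg_simps(6) KM.alg_simps free_single_def)
  then have "t.pure b (free_single K m c) = t.pure (c \<odot>\<^bsub>B\<^esub> b) (free_single K m \<one>\<^bsub>K\<^esub>)"
    using b single t.pure_smult_right[of c b "free_single K m \<one>\<^bsub>K\<^esub>"]
    by (simp add: t.pure_smult_left Rn_single)
  then show ?case using b single
    by (simp add: scal_single additive_family.supp_sum_single[OF sigma_family, folded sigma_def])
next
  case (add x y)
  then have xy: "x \<in> carrier Rn" "y \<in> carrier Rn" by (simp_all add: Rn_carrier)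
  note sc = scal_closed[OF b xy(1), unfolded CM.alg_simps] scal_closed[OF b xy(2), unfolded CM.alg_simps]
  show ?case unfolding Rn_add scal_add[OF b xy] unfolding CM.alg_simps(3)
    using additive_family.supp_sum_add[OF sigma_family sc, folded sigma_def] add b xy by (simp add: t.pure_add_right)
qed

text \<open>\<open>sigma\<close> undoes the lift on pure tensors, hence everywhere by additivity.
  The image is closed under addition and contains each single term, as the image of a coefficient
  tensored with a monomial.\<close>

lemma theta_bij: "bij_betw l.lift (carrier t.T) (carrier C)"
  unfolding bij_betw_def
proof
  have cl: "l.lift U \<in> carrier C" if "U \<in> carrier t.T" for U
    using l.lift_closed[OF that] by (simp add: CK_def)
  have ad: "l.lift (U \<oplus>\<^bsub>t.T\<^esub> V) = l.lift U \<oplus>\<^bsub>C\<^esub> l.lift V" if "U \<in> carrier t.T" "V \<in> carrier t.T" for U V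
    using l.lift_add[OF that] by (simp add: CK_def)
  have "sigma (l.lift U) = U" if "U \<in> carrier t.T" for U
    using that
  proof (induction rule: t.tensor_induct)
    case (pure a b)
    then show ?case by (simp add: l.lift_pure sigma_scal)
  next
    case (add U V)
    show ?case unfolding ad[OF add(1,2)] CM.alg_simps(3)
      using additive_family.supp_sum_add[OF sigma_family cl[OF add(1), unfolded CM.alg_simps]
          cl[OF add(2), unfolded CM.alg_simps], folded sigma_def] add by simp
  qed
  then show "inj_on l.lift (carrier t.T)" by (rule inj_on_inverseI[of _ sigma])
  have "q \<in> l.lift ` carrier t.T" if "q \<in> free_carrier B (carrier (monomials n))" for q
    using that
  proof (induction rule: free_induct)
    case zero
    have "l.lift (t.pure \<zero>\<^bsub>B\<^esub> \<zero>\<^bsub>Rn\<^esub>) = (\<lambda>_. \<zero>\<^bsub>B\<^esub>)"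
      by (simp add: l.lift_pure scal_zero CM.alg_simps)
    then show ?case by (intro image_eqI[of _ _ "t.pure \<zero>\<^bsub>B\<^esub> \<zero>\<^bsub>Rn\<^esub>"]) auto
  next
    case (single m b)
    then have "l.lift (t.pure b (free_single K m \<one>\<^bsub>K\<^esub>)) = free_single B m b"
      by (simp add: l.lift_pure Rn_single scal_single)
    then show ?case using single
      by (intro image_eqI[of _ _ "t.pure b (free_single K m \<one>\<^bsub>K\<^esub>)"]) (simp_all add: Rn_single)
  next
    case (add x y)
    then obtain U V where "U \<in> carrier t.T" "x = l.lift U" "V \<in> carrier t.T" "y = l.lift V" by blast
    then show ?case using ad[of U V]
      by (intro image_eqI[of _ _ "U \<oplus>\<^bsub>t.T\<^esub> V"]) (simp_all add: CM.alg_simps)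
  qed
  then show "l.lift ` carrier t.T = carrier C" using cl by (auto simp: CM.alg_simps)
qed

lemma frac_closed_poly_tensor:
  assumes "frac_closed B" "char_zero K"
  shows "frac_closed t.T"
  by (rule frac_closed_iso_sym[OF _ t.tensor_cring theta_hom theta_bij])
    (rule frac_closed_polys(1)[OF assms(1) poisson_domain_unit_separated[OF poisson_domain_axioms assms(2)]])

end

section \<open>Dixmier properties of subalgebras\<close>


lemma poisson_hom_comp:
  assumes f: "f \<in> poisson_hom K P Q" and g: "g \<in> poisson_hom K Q R"
  shows "g \<circ> f \<in> poisson_hom K P R"
  by (rule poisson_homI) (simp_all add: poisson_homD[OF f] poisson_homD[OF g])

lemma poisson_hom_id: "id \<in> poisson_hom K P P"
  by (rule poisson_homI) simp_all

context codim_pair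
begin

lemma A_poisson: "poisson_algebra K A" by (rule subalgebra_poisson[OF H])

lemma incl_poisson_hom: "id \<in> poisson_hom K A B"
  by (rule poisson_homI) (simp_all add: H_carrier)

lemma dixmier_subalgebra:
  assumes B: "frac_closed B" "dixmier K B"
  shows "dixmier K A"
  unfolding dixmier_def
proof (intro ballI impI)
  fix f assume f: "f \<in> poisson_hom K A A" and inj: "inj_on f (carrier A)"
  have fH: "f x \<in> H" if "x \<in> H" for x using poisson_homD(1)[OF f] that by simp
  have f': "f \<in> poisson_hom K A B"
    using poisson_hom_comp[OF f incl_poisson_hom] by (simp add: id_def comp_def)
  interpret e: poisson_extension K B H B f
  proof (intro poisson_extension.intro codim_pair_axioms algebra_axioms poisson_extension_axioms.intro)
    show "\<lbrace>y, x\<rbrace>\<^bsub>B\<^esub> = \<ominus>\<^bsub>B\<^esub> \<lbrace>x, y\<rbrace>\<^bsub>B\<^esub>" if "x \<in> carrier B" "y \<in> carrier B" for x y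
      using bracket_antisym that .
  qed (use B f' inj bracket_closed bracket_leibniz in simp_all)
  have surj: "e.ext ` carrier B = carrier B"
    using B(2) e.ext_poisson_hom e.ext_inj unfolding dixmier_def bij_betw_def by blast
  have "H \<subseteq> f ` H"
  proof
    fix b assume b: "b \<in> H"
    then obtain x where x: "x \<in> carrier B" "e.ext x = b" using surj H_carrier by (metis imageE)
    \<comment> \<open>The preimage of \<open>b\<close> is known only to lie in B; finite codimension
      is what brings it back into \<open>H\<close>.\<close>
    have "x \<in> H"
      by (rule preimage_subset[OF poisson_hom_lin_map[OF e.ext_poisson_hom] surj])
        (use x b fH in \<open>auto simp: e.ext_extends\<close>)
    then show "b \<in> f ` H" using x e.ext_extends by auto
  qed
  then show "bij_betw f (carrier A) (carrier A)" using inj fH by (auto simp: bij_betw_def)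
qed

end

section \<open>Morphisms into tensor products\<close>

locale codim_tensor = codim_pair K B H + R: poisson_algebra K R
  for K :: "('k, 'x) ring_scheme" and B :: "('k, 'b, 'y) palg_scheme" and H
    and R :: "('k, 'r, 'z) palg_scheme" +
  assumes T_closed: "frac_closed (tensor K B R)"
begin

sublocale TB: tensor_pair K B R
  by (intro tensor_pair.intro K.field_axioms poisson_algebra_axioms R.poisson_algebra_axioms)
sublocale TA: tensor_pair K A R
  by (intro tensor_pair.intro K.field_axioms A_poisson R.poisson_algebra_axioms)

sublocale \<iota>: tensor_mapping K A R B R id id
  by (intro tensor_mapping.intro tensor_mapping_axioms.intro TA.tensor_pair_axioms TB.tensor_pair_axioms
      poisson_hom_lin_map incl_poisson_hom poisson_hom_id)

abbreviation "incl \<equiv> tensor_map K B R id id"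

lemma incl_hom: "incl \<in> poisson_hom K TA.T TB.T"
  by (rule \<iota>.tensor_map_poisson_hom[OF incl_poisson_hom poisson_hom_id])

lemma incl_pure: "\<lbrakk>a \<in> H; r \<in> carrier R\<rbrakk> \<Longrightarrow> incl (TA.pure a r) = TB.pure a r"
  using \<iota>.map_pure[of a r] by simp

text \<open>A linear retraction of B onto A, tensored with the identity of R, is a left
  inverse.\<close>

lemma incl_inj: "inj_on incl (carrier TA.T)"
proof -
  obtain \<rho> where \<rho>: "lin_map K B A \<rho>" "\<And>x. x \<in> H \<Longrightarrow> \<rho> x = x"
    using V.linear_retraction[OF sm] by blast
  interpret r: tensor_mapping K B R A R \<rho> id
    by (intro tensor_mapping.intro tensor_mapping_axioms.intro TA.tensor_pair_axioms TB.tensor_pair_axioms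
        \<rho>(1) poisson_hom_lin_map[OF poisson_hom_id])
  have "r.tm (incl U) = U" if "U \<in> carrier TA.T" for U
    using that
  proof (induction rule: TA.tensor_induct)
    case (pure a b)
    then have incl: "incl (TA.pure a b) = TB.pure a b" by (simp add: incl_pure)
    from pure have "r.tm (TB.pure a b) = TA.pure a b"
      using H_carrier[of a] \<rho>(2)[of a] r.map_pure[of a b] by simp
    then show ?case by (simp only: incl)
  next
    case (add U V)
    then show ?case by (simp only: \<iota>.map_add \<iota>.map_closed r.map_add)
  qed
  then show ?thesis by (rule inj_on_inverseI[of _ r.tm])
qed

text \<open>Provides the nonzero vector for the linear form in \<open>slice\<close>. In (4) the
  algebra R is not given as a domain, so the fact is taken from B \<otimes> R being one.\<close>

lemma one_not_zero_R: "\<one>\<^bsub>R\<^esub> \<noteq> \<zero>\<^bsub>R\<^esub>"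
proof
  interpret domain "tensor K B R" using T_closed by (simp add: frac_closed_def)
  assume "\<one>\<^bsub>R\<^esub> = \<zero>\<^bsub>R\<^esub>"
  then have "\<one>\<^bsub>TB.T\<^esub> = \<zero>\<^bsub>TB.T\<^esub>" by (simp add: TB.pure_one TB.pure_zero_right)
  then show False using one_not_zero by simp
qed

text \<open>\<open>E\<close> is id \<otimes> l for a linear form l on R that is one at the unit. It
  maps A \<otimes> R into A because \<open>H\<close> is a subspace. Hence b \<otimes> 1 determines
  b, and shows whether b lies in A.\<close>

lemma slice:
  obtains E where "\<And>b. b \<in> carrier B \<Longrightarrow> E (TB.pure b \<one>\<^bsub>R\<^esub>) = b"
    "\<And>U. U \<in> carrier TA.T \<Longrightarrow> E (incl U) \<in> H"
proof -
  interpret VR: vector_space_over K R by unfold_locales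
  obtain l where l: "\<And>x. x \<in> carrier R \<Longrightarrow> l x \<in> carrier K"
    "\<And>x y. \<lbrakk>x \<in> carrier R; y \<in> carrier R\<rbrakk> \<Longrightarrow> l (x \<oplus>\<^bsub>R\<^esub> y) = l x \<oplus>\<^bsub>K\<^esub> l y"
    "\<And>c x. \<lbrakk>c \<in> carrier K; x \<in> carrier R\<rbrakk> \<Longrightarrow> l (c \<odot>\<^bsub>R\<^esub> x) = c \<otimes>\<^bsub>K\<^esub> l x"
    "l \<one>\<^bsub>R\<^esub> = \<one>\<^bsub>K\<^esub>"
    using VR.linear_functional[OF R.one_closed one_not_zero_R] by blast
  interpret E: tensor_lift K B R B "\<lambda>b r. l r \<odot>\<^bsub>B\<^esub> b"
    by (intro tensor_lift.intro tensor_lift_axioms.intro TB.tensor_pair_axioms module_axioms)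
      (simp_all add: l smult_l_distr smult_r_distr smult_assoc1[symmetric] K.m_comm)
  have "E.lift (incl U) \<in> H" if "U \<in> carrier TA.T" for U
    using that
  proof (induction rule: TA.tensor_induct)
    case (pure a b)
    then have incl: "incl (TA.pure a b) = TB.pure a b" by (simp add: incl_pure)
    from pure have "E.lift (TB.pure a b) \<in> H"
      using H_carrier[of a] l(1)[of b] E.lift_pure[of a b] by (simp add: H_closed)
    then show ?case by (simp only: incl)
  next
    case (add U V)
    then show ?case by (simp only: \<iota>.map_add \<iota>.map_closed E.lift_add H_closed)
  qed
  then show ?thesis using that[of E.lift] l(4) by (simp add: E.lift_pure)
qed

lemma pure_one_inj: "\<lbrakk>b \<in> carrier B; b' \<in> carrier B; TB.pure b \<one>\<^bsub>R\<^esub> = TB.pure b' \<one>\<^bsub>R\<^esub>\<rbrakk> \<Longrightarrow> b = b'"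
  using slice by metis

lemma incl_eq_pure:
  assumes U: "U \<in> carrier TA.T" and b: "b \<in> carrier B" and eq: "incl U = TB.pure b \<one>\<^bsub>R\<^esub>"
  shows "b \<in> H" "U = TA.pure b \<one>\<^bsub>R\<^esub>"
proof -
  show bH: "b \<in> H" using slice U b eq by metis
  have "incl U = incl (TA.pure b \<one>\<^bsub>R\<^esub>)" using eq bH by (simp add: incl_pure)
  then show "U = TA.pure b \<one>\<^bsub>R\<^esub>" using incl_inj U bH by (simp add: inj_on_eq_iff)
qed

lemma extension:
  assumes f: "f \<in> poisson_hom K A TA.T" and inj: "inj_on f H"
  obtains F where "F \<in> poisson_hom K B TB.T" "inj_on F (carrier B)" "\<And>a. a \<in> H \<Longrightarrow> F a = incl (f a)"
proof -
  have "f x \<in> carrier TA.T" if "x \<in> H" for x using poisson_homD(1)[OF f] that by simp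
  then have "inj_on (incl \<circ> f) H" by (intro comp_inj_on inj inj_on_subset[OF incl_inj]) auto
  then interpret e: poisson_extension K B H TB.T "incl \<circ> f"
    by (intro poisson_extension.intro codim_pair_axioms TB.TR.algebra_axioms poisson_extension_axioms.intro
        T_closed TB.bracket_closed TB.bracket_leibniz TB.bracket_antisym poisson_hom_comp[OF f incl_hom])
  show ?thesis using that e.ext_poisson_hom e.ext_inj e.ext_extends by auto
qed

lemma rel_dixmier_subalgebra:
  assumes B: "rel_dixmier K R B"
  shows "rel_dixmier K R A"
  unfolding rel_dixmier_def
proof (intro ballI impI)
  fix f assume f: "f \<in> poisson_hom K A TA.T" and inj: "inj_on f (carrier A)"
  obtain F where F: "F \<in> poisson_hom K B TB.T" "inj_on F (carrier B)"
    and Ff: "\<And>a. a \<in> H \<Longrightarrow> F a = incl (f a)" using extension[OF f] inj by auto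
  have fT: "f x \<in> carrier TA.T" if "x \<in> H" for x using poisson_homD(1)[OF f] that by simp
  have im: "F ` carrier B = {TB.pure b \<one>\<^bsub>R\<^esub> | b. b \<in> carrier B}"
    using B F by (simp add: rel_dixmier_def tensor_base_def)
  then have "\<exists>y. y \<in> carrier B \<and> F x = TB.pure y \<one>\<^bsub>R\<^esub>" if "x \<in> carrier B" for x using that by blast
  \<comment> \<open>The endomorphism of B hidden in \<open>F\<close>. Since the image of
    \<open>F\<close> is all of B \<otimes> 1, it is surjective; linearity is the structure that
    \<open>preimage_subset\<close> asks for.\<close>
  then obtain g where g: "\<And>x. x \<in> carrier B \<Longrightarrow> g x \<in> carrier B \<and> F x = TB.pure (g x) \<one>\<^bsub>R\<^esub>" by metis
  have lin: "lin_map K B B g"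
    unfolding lin_map_def
  proof (intro conjI ballI)
    show "g (x \<oplus>\<^bsub>B\<^esub> y) = g x \<oplus>\<^bsub>B\<^esub> g y" if "x \<in> carrier B" "y \<in> carrier B" for x y
      using that g[of x] g[of y] g[of "x \<oplus>\<^bsub>B\<^esub> y"] poisson_homD(2)[OF F(1), of x y]
      by (intro pure_one_inj) (simp_all add: TB.pure_add_left)
    show "g (c \<odot>\<^bsub>B\<^esub> x) = c \<odot>\<^bsub>B\<^esub> g x" if "c \<in> carrier K" "x \<in> carrier B" for c x
      using that g[of x] g[of "c \<odot>\<^bsub>B\<^esub> x"] poisson_homD(5)[OF F(1), of c x]
      by (intro pure_one_inj) (simp_all add: TB.pure_smult_left)
  qed (use g in auto)
  have surj: "g ` carrier B = carrier B"
  proof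
    show "carrier B \<subseteq> g ` carrier B"
    proof
      fix b assume b: "b \<in> carrier B"
      then have "TB.pure b \<one>\<^bsub>R\<^esub> \<in> F ` carrier B" using im by blast
      then obtain x where "x \<in> carrier B" "F x = TB.pure b \<one>\<^bsub>R\<^esub>" by auto
      then show "b \<in> g ` carrier B" using g[of x] pure_one_inj[of b "g x"] b by auto
    qed
  qed (use g in auto)
  have gH: "g a \<in> H \<and> f a = TA.pure (g a) \<one>\<^bsub>R\<^esub>" if a: "a \<in> H" for a
    using incl_eq_pure[OF fT[OF a], of "g a"] g[OF H_carrier[OF a]] Ff[OF a] by simp
  have "f ` H = {TA.pure a \<one>\<^bsub>R\<^esub> | a. a \<in> H}"
  proof
    show "f ` H \<subseteq> {TA.pure a \<one>\<^bsub>R\<^esub> | a. a \<in> H}" using gH by blast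
    show "{TA.pure a \<one>\<^bsub>R\<^esub> | a. a \<in> H} \<subseteq> f ` H"
    proof
      fix U assume "U \<in> {TA.pure a \<one>\<^bsub>R\<^esub> | a. a \<in> H}"
      then obtain b where b: "b \<in> H" "U = TA.pure b \<one>\<^bsub>R\<^esub>" by blast
      then obtain x where x: "x \<in> carrier B" "g x = b" using surj H_carrier by (metis imageE)
      have "x \<in> H" by (rule preimage_subset[OF lin surj]) (use gH x b in auto)
      then show "U \<in> f ` H" using gH[of x] x b by (metis imageI)
    qed
  qed
  then show "f ` carrier A = tensor_base K A R" by (simp add: tensor_base_def)
qed

text \<open>The augmentation pins down everything: it makes \<open>\<phi>\<close> injective, and
  once \<open>F\<close> takes values in B \<otimes> 1 it forces the image of each a in A to be a
  \<otimes> 1.\<close>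

lemma aug_dixmier_subalgebra:
  assumes B: "aug_dixmier K R B"
  shows "aug_dixmier K R A"
  unfolding aug_dixmier_def
proof (intro ballI impI)
  let ?K = "base_palg K"
  fix \<phi> \<pi> assume \<phi>: "\<phi> \<in> poisson_hom K A TA.T" and "\<pi> \<in> augmentations K R"
    and aug: "\<forall>a\<in>carrier A. tensor_map K A ?K id \<pi> (\<phi> a) = pure_tensor K A ?K a \<one>\<^bsub>K\<^esub>"
  then have \<pi>: "\<pi> \<in> poisson_hom K R ?K" by (simp add: augmentations_def)
  note Kp = base_palg_poisson[OF K.field_axioms]
  interpret BK: tensor_pair K B ?K by (intro tensor_pair.intro K.field_axioms poisson_algebra_axioms Kp)
  interpret AK: tensor_pair K A ?K by (intro tensor_pair.intro K.field_axioms A_poisson Kp)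
  interpret mB: tensor_mapping K B R B ?K id \<pi>
    by (intro tensor_mapping.intro tensor_mapping_axioms.intro TB.tensor_pair_axioms BK.tensor_pair_axioms
        poisson_hom_lin_map poisson_hom_id \<pi>)
  interpret mA: tensor_mapping K A R A ?K id \<pi>
    by (intro tensor_mapping.intro tensor_mapping_axioms.intro TA.tensor_pair_axioms AK.tensor_pair_axioms
        poisson_hom_lin_map poisson_hom_id \<pi>)
  interpret k: tensor_mapping K A ?K B ?K id id
    by (intro tensor_mapping.intro tensor_mapping_axioms.intro AK.tensor_pair_axioms BK.tensor_pair_axioms
        poisson_hom_lin_map poisson_hom_id incl_poisson_hom)
  have bK: "carrier ?K = carrier K" "\<one>\<^bsub>?K\<^esub> = \<one>\<^bsub>K\<^esub>" "add ?K = add K" "smult ?K = mult K" "mult ?K = mult K"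
    by (simp_all add: base_palg_def)
  \<comment> \<open>The canonical isomorphism from B \<otimes> K to B; \<open>all_pure\<close> below
    records that every element of B \<otimes> K has the form b \<otimes> 1.\<close>
  interpret D: tensor_lift K B ?K B "\<lambda>b c. c \<odot>\<^bsub>B\<^esub> b"
    by (intro tensor_lift.intro tensor_lift_axioms.intro BK.tensor_pair_axioms module_axioms)
      (simp_all add: bK smult_l_distr smult_r_distr smult_assoc1[symmetric] K.m_comm)
  have D_pure: "D.lift (BK.pure b \<one>\<^bsub>K\<^esub>) = b" if "b \<in> carrier B" for b
    using that by (simp add: D.lift_pure bK)
  have pure_eqD: "b = b'" if "b \<in> carrier B" "b' \<in> carrier B" "BK.pure b \<one>\<^bsub>K\<^esub> = BK.pure b' \<one>\<^bsub>K\<^esub>" for b b'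
    using that D_pure by metis
  have all_pure: "U = BK.pure (D.lift U) \<one>\<^bsub>K\<^esub>" if "U \<in> carrier BK.T" for U
    using that
  proof (induction rule: BK.tensor_induct)
    case (pure b c)
    then have "BK.pure (c \<odot>\<^bsub>B\<^esub> b) \<one>\<^bsub>K\<^esub> = BK.pure b (c \<odot>\<^bsub>?K\<^esub> \<one>\<^bsub>K\<^esub>)"
      using BK.pure_smult_left[of c b "\<one>\<^bsub>K\<^esub>"] BK.pure_smult_right[of c b "\<one>\<^bsub>K\<^esub>"] by (simp add: bK)
    then show ?case using pure by (simp add: D.lift_pure bK)
  next
    case (add U V)
    then show ?case using BK.pure_add_left[of "D.lift U" "D.lift V" "\<one>\<^bsub>K\<^esub>"]
      by (simp add: D.lift_add D.lift_closed bK)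
  qed
  have \<phi>T: "\<phi> a \<in> carrier TA.T" if "a \<in> H" for a using poisson_homD(1)[OF \<phi>] that by simp
  \<comment> \<open>Including A into B and applying the augmentation to the second factor commute.
    This carries the condition on \<open>\<phi>\<close> over to \<open>F\<close> on
    \<open>H\<close>.\<close>
  have comm: "mB.tm (incl U) = k.tm (mA.tm U)" if "U \<in> carrier TA.T" for U
    using that
  proof (induction rule: TA.tensor_induct)
    case (pure a b)
    then have incl: "incl (TA.pure a b) = TB.pure a b" by (simp add: incl_pure)
    from pure have "mB.tm (TB.pure a b) = BK.pure a (\<pi> b)" "mA.tm (TA.pure a b) = AK.pure a (\<pi> b)"
      "k.tm (AK.pure a (\<pi> b)) = BK.pure a (\<pi> b)"
      using H_carrier[of a] poisson_homD(1)[OF \<pi>, of b] mB.map_pure[of a b]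
        mA.map_pure[of a b] k.map_pure[of a "\<pi> b"] by simp_all
    then show ?case by (simp only: incl)
  next
    case (add U V)
    then show ?case
      by (simp only: \<iota>.map_add \<iota>.map_closed mB.map_add mA.map_add mA.map_closed k.map_add)
  qed
  have mA_\<phi>: "k.tm (mA.tm (\<phi> a)) = BK.pure a \<one>\<^bsub>K\<^esub>" if "a \<in> H" for a
    using that aug k.map_pure[of a "\<one>\<^bsub>K\<^esub>"] by (simp add: bK)
  have "inj_on \<phi> H" using mA_\<phi> pure_eqD H_carrier by (metis inj_onI)
  then obtain F where F: "F \<in> poisson_hom K B TB.T" "inj_on F (carrier B)"
    and F\<phi>: "\<And>a. a \<in> H \<Longrightarrow> F a = incl (\<phi> a)" using extension[OF \<phi>] by auto
  have FH: "mB.tm (F a) = BK.pure a \<one>\<^bsub>K\<^esub>" if "a \<in> H" for a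
    using that F\<phi> comm[OF \<phi>T] mA_\<phi> by simp
  note FT = poisson_homD(1)[OF F(1)]
  note mult = poisson_homD(3)[OF mB.tensor_map_poisson_hom[OF poisson_hom_id \<pi>]]
  \<comment> \<open>The augmentation condition extends from \<open>H\<close> to B: composing
    \<open>F\<close> with the augmentation is multiplicative and known on \<open>a\<close> and on
    the product of \<open>a\<close> and \<open>b\<close>, and the nonzero \<open>a\<close>
    cancels.\<close>
  have FB: "mB.tm (F b) = BK.pure b \<one>\<^bsub>K\<^esub>" if b: "b \<in> carrier B" for b
  proof -
    obtain a where a: "a \<in> H" "a \<noteq> \<zero>\<^bsub>B\<^esub>" "a \<otimes>\<^bsub>B\<^esub> b \<in> H" using denominator[OF b] .
    have aB: "a \<in> carrier B" using H_carrier a by blast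
    define b' where "b' = D.lift (mB.tm (F b))"
    have b': "b' \<in> carrier B" "mB.tm (F b) = BK.pure b' \<one>\<^bsub>K\<^esub>"
      using all_pure[OF mB.map_closed[OF FT[OF b]]] D.lift_closed[OF mB.map_closed[OF FT[OF b]]]
      by (simp_all add: b'_def)
    have "BK.pure (a \<otimes>\<^bsub>B\<^esub> b) \<one>\<^bsub>K\<^esub> = mB.tm (F a \<otimes>\<^bsub>TB.T\<^esub> F b)"
      using FH[OF a(3)] poisson_homD(3)[OF F(1) aB b] by simp
    also have "\<dots> = BK.pure a \<one>\<^bsub>K\<^esub> \<otimes>\<^bsub>BK.T\<^esub> BK.pure b' \<one>\<^bsub>K\<^esub>"
      using mult[OF FT[OF aB] FT[OF b]] FH[OF a(1)] b' by simp
    also have "\<dots> = BK.pure (a \<otimes>\<^bsub>B\<^esub> b') \<one>\<^bsub>K\<^esub>" using aB b' by (simp add: BK.pure_mult bK)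
    finally have "a \<otimes>\<^bsub>B\<^esub> b = a \<otimes>\<^bsub>B\<^esub> b'" using aB b b' by (intro pure_eqD) auto
    then have "b = b'" using a(2) aB b b' by (simp add: m_lcancel)
    then show ?thesis using b' by simp
  qed
  have im: "F ` carrier B = {TB.pure b \<one>\<^bsub>R\<^esub> | b. b \<in> carrier B}"
    using B F(1) \<open>\<pi> \<in> augmentations K R\<close> FB unfolding aug_dixmier_def tensor_base_def by blast
  have \<phi>_pure: "\<phi> a = TA.pure a \<one>\<^bsub>R\<^esub>" if a: "a \<in> H" for a
  proof -
    have aB: "a \<in> carrier B" using H_carrier a by blast
    then obtain b where b: "b \<in> carrier B" "F a = TB.pure b \<one>\<^bsub>R\<^esub>" using im by blast
    then have "BK.pure b \<one>\<^bsub>K\<^esub> = BK.pure a \<one>\<^bsub>K\<^esub>"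
      using FH[OF a] poisson_homD(4)[OF \<pi>] by (simp add: mB.map_pure bK)
    then have "b = a" using b aB by (intro pure_eqD) auto
    then show ?thesis using incl_eq_pure(2)[OF \<phi>T[OF a] aB] b F\<phi>[OF a] by simp
  qed
  then show "\<phi> ` carrier A = tensor_base K A R" by (auto simp: tensor_base_def)
qed

end

theorem lemma4p8:
  fixes K :: "'k ring" and B :: "('k, 'b) palg" and H :: "'b set" and A :: "('k, 'b) palg"
  assumes K: "field K" "char_zero K"
    and B: "poisson_domain K B" "integrally_closed_domain B"
    and A: "poisson_subalgebra K H B" "A = B\<lparr>carrier := H\<rparr>"
    and B_in_QA: "frac_embed B ` carrier B \<subseteq> sub_fracs B H"
    and dim_BA: "finite_dimensional K (quot_module B H)"
  shows
    "(dixmier K B \<longrightarrow> dixmier K A) \<and>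
     (\<forall>R :: ('k, 'r) palg. poisson_domain K R \<longrightarrow> integrally_closed_domain (tensor K B R) \<longrightarrow>
        rel_dixmier K R B \<longrightarrow> rel_dixmier K R A) \<and>
     (\<forall>n :: nat. 0 < n \<longrightarrow> n_dixmier K n B \<longrightarrow> n_dixmier K n A) \<and>
     (\<forall>R :: ('k, 'r) palg. poisson_algebra K R \<longrightarrow> integrally_closed_domain (tensor K B R) \<longrightarrow>
        aug_dixmier K R B \<longrightarrow> aug_dixmier K R A)"
proof -
  have pair: "codim_pair K B H"
    by (intro codim_pair.intro codim_pair_axioms.intro B(1) A(1) B_in_QA dim_BA)
  have Bc: "frac_closed B" by (rule integrally_closed_imp_frac_closed[OF B(2)])
  \<comment> \<open>Stated for any carrier type of \<open>R\<close>, since it is used both for the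
    algebras in (2) and (4) and for the polynomial algebra.\<close>
  have ct: "codim_tensor K B H R" if "poisson_algebra K R" "frac_closed (tensor K B R)"
    for R :: "('k, 's) palg"
    using pair that by (simp add: codim_tensor_def codim_tensor_axioms_def)
  show ?thesis unfolding A(2)
  proof (intro conjI allI impI)
    show "dixmier K (B\<lparr>carrier := H\<rparr>)" if "dixmier K B"
      by (rule codim_pair.dixmier_subalgebra[OF pair Bc that])
    show "rel_dixmier K R (B\<lparr>carrier := H\<rparr>)"
      if "poisson_domain K R" "integrally_closed_domain (tensor K B R)" "rel_dixmier K R B"
      for R :: "('k, 'r) palg"
      using codim_tensor.rel_dixmier_subalgebra[OF ct] that integrally_closed_imp_frac_closed
        poisson_domain.axioms(1) by blast
    show "n_dixmier K n (B\<lparr>carrier := H\<rparr>)" if "n_dixmier K n B" for n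
    proof -
      have "poly_tensor K B" by (rule poly_tensor.intro[OF B(1)])
      then have "frac_closed (tensor K B (poly_palg K n))"
        using poly_tensor.frac_closed_poly_tensor Bc K(2) by blast
      then show ?thesis
        using codim_tensor.rel_dixmier_subalgebra[OF ct[OF poly_palg_poisson[OF K(1)]]] that
        unfolding n_dixmier_def by blast
    qed
    show "aug_dixmier K R (B\<lparr>carrier := H\<rparr>)"
      if "poisson_algebra K R" "integrally_closed_domain (tensor K B R)" "aug_dixmier K R B"
      for R :: "('k, 'r) palg"
      using codim_tensor.aug_dixmier_subalgebra[OF ct] that integrally_closed_imp_frac_closed by blast
  qed
qed

end
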